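(* Let $\mathbf a=(a_0,a_1,a_2,\dots)$ be a sequence of natural numbers with $a_j>1$, and let $\Sigma_{\mathbf a}$ be the $\mathbf a$-adic solenoid. Assume $\Sigma_{\mathbf a}$ contains no elements of order $2$. Let $\xi_1,\xi_2,\xi_3$ be independent identically distributed random variables with values in $\Sigma_{\mathbf a}$ and a symmetric distribution $\mu$. Let $\alpha$ be a random variable with a Bernoulli distribution taking the values $0$ and $1$ with probability $\frac12$ each, independent of the random vector $(\xi_1,\xi_2,\xi_3)$. Then the following are equivalent: (i) the linear forms $2\xi_1$ and $\xi_1+\xi_2+2\alpha\xi_3$ are identically distributed; (ii) there exist a continuous monomorphism $\tau:\mathbb R\to\Sigma_{\mathbf a}$, a hyperbolic secant distribution $M$ on $\mathbb R$, and a compact Corwin subgroup $K$ of $\Sigma_{\mathbf a}$ such that $\mu=\tau(M)*m_K$.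
   Context: The $\mathbf a$-adic solenoid: let $\Delta_{\mathbf a}$ be the compact group of $\mathbf a$-adic integers (as a set $\prod_{n\ge0}\{0,1,\dots,a_n-1\}$, with addition with carries determined by $\mathbf a$), let $u=(1,0,0,\dots)\in\Delta_{\mathbf a}$, and let $B=\{(n,nu):n\in\mathbb Z\}\subset\mathbb R\times\Delta_{\mathbf a}$; then $\Sigma_{\mathbf a}=(\mathbb R\times\Delta_{\mathbf a})/B$. It is a compact connected Abelian group whose character group is the discrete group $H_{\mathbf a}=\{m/(a_0a_1\cdots a_n): n\ge0,\ m\in\mathbb Z\}\subset\mathbb Q$. A distribution $\mu$ is symmetric if $\mu(B)=\mu(-B)$ for all Borel sets $B$. A distribution $M$ on $\mathbb R$ is a hyperbolic secant distribution if its characteristic function is $\hat M(s)=\frac{2}{e^{\sigma s}+e^{-\sigma s}}$ for some real $\sigma$ (the case $\sigma=0$, i.e. the point mass at $0$, is included). A group $K$ is a Corwin group if $\{2x:x\in K\}=K$. For a compact subgroup $K$, $m_K$ denotes the Haar probability distribution on $K$. $\tau(M)$ is the image of $M$ under $\tau$, i.e. $\tau(M)(E)=M(\tau^{-1}(E))$, and $*$ denotes convolution of distributions. *)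

theory Defs
  imports "HOL-Analysis.Analysis" "HOL-Probability.Probability"
begin

definition adic :: "(nat \<Rightarrow> nat) \<Rightarrow> (nat \<Rightarrow> nat) set" where
  "adic a = {x. \<forall>n. x n < a n}"

fun adic_carry :: "(nat \<Rightarrow> nat) \<Rightarrow> (nat \<Rightarrow> nat) \<Rightarrow> (nat \<Rightarrow> nat) \<Rightarrow> nat \<Rightarrow> nat" where
  "adic_carry a x y 0 = 0"
| "adic_carry a x y (Suc n) = (x n + y n + adic_carry a x y n) div a n"

definition adic_add :: "(nat \<Rightarrow> nat) \<Rightarrow> (nat \<Rightarrow> nat) \<Rightarrow> (nat \<Rightarrow> nat) \<Rightarrow> (nat \<Rightarrow> nat)" where
  "adic_add a x y = (\<lambda>n. (x n + y n + adic_carry a x y n) mod a n)"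

definition adic_zero :: "nat \<Rightarrow> nat" where
  "adic_zero = (\<lambda>n. 0)"

definition adic_neg :: "(nat \<Rightarrow> nat) \<Rightarrow> (nat \<Rightarrow> nat) \<Rightarrow> (nat \<Rightarrow> nat)" where
  "adic_neg a x = (THE y. y \<in> adic a \<and> adic_add a x y = adic_zero)"

definition adic_u :: "nat \<Rightarrow> nat" where
  "adic_u = (\<lambda>n. if n = 0 then 1 else 0)"

definition adic_int :: "(nat \<Rightarrow> nat) \<Rightarrow> int \<Rightarrow> (nat \<Rightarrow> nat)" where
  "adic_int a k =
     (if 0 \<le> k then (adic_add a adic_u ^^ nat k) adic_zero
      else adic_neg a ((adic_add a adic_u ^^ nat (- k)) adic_zero))"

definition adic_top :: "(nat \<Rightarrow> nat) \<Rightarrow> (nat \<Rightarrow> nat) topology" where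
  "adic_top a = subtopology (product_topology (\<lambda>_. discrete_topology UNIV) UNIV) (adic a)"

text \<open>(t,x) ~ (s,y) iff (t,x) - (s,y) in B = {(k, k u) : k in Z}.\<close>
definition sol_rel :: "(nat \<Rightarrow> nat) \<Rightarrow> ((real \<times> (nat \<Rightarrow> nat)) \<times> (real \<times> (nat \<Rightarrow> nat))) set" where
  "sol_rel a = {((t, x), (s, y)). x \<in> adic a \<and> y \<in> adic a \<and>
       (\<exists>k::int. t = s + of_int k \<and> x = adic_add a y (adic_int a k))}"

type_synonym sol = "(real \<times> (nat \<Rightarrow> nat)) set"

definition solenoid :: "(nat \<Rightarrow> nat) \<Rightarrow> sol set" where
  "solenoid a = (UNIV \<times> adic a) // sol_rel a"

definition sol_class :: "(nat \<Rightarrow> nat) \<Rightarrow> real \<times> (nat \<Rightarrow> nat) \<Rightarrow> sol" where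
  "sol_class a p = sol_rel a `` {p}"

definition sol_zero :: "(nat \<Rightarrow> nat) \<Rightarrow> sol" where
  "sol_zero a = sol_class a (0, adic_zero)"

definition sol_add :: "(nat \<Rightarrow> nat) \<Rightarrow> sol \<Rightarrow> sol \<Rightarrow> sol" where
  "sol_add a X Y = (\<Union>p\<in>X. \<Union>q\<in>Y. sol_class a (fst p + fst q, adic_add a (snd p) (snd q)))"

definition sol_neg :: "(nat \<Rightarrow> nat) \<Rightarrow> sol \<Rightarrow> sol" where
  "sol_neg a X = (\<Union>p\<in>X. sol_class a (- fst p, adic_neg a (snd p)))"

definition sol_mult :: "(nat \<Rightarrow> nat) \<Rightarrow> nat \<Rightarrow> sol \<Rightarrow> sol" where
  "sol_mult a k X = (sol_add a X ^^ k) (sol_zero a)"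

text \<open>Quotient topology: U open iff its preimage (the union of its classes) is open.\<close>
definition sol_top :: "(nat \<Rightarrow> nat) \<Rightarrow> sol topology" where
  "sol_top a = topology (\<lambda>U. U \<subseteq> solenoid a \<and>
      openin (prod_topology euclideanreal (adic_top a)) (\<Union>U))"

definition sol_borel :: "(nat \<Rightarrow> nat) \<Rightarrow> sol measure" where
  "sol_borel a = sigma (solenoid a) {U. openin (sol_top a) U}"

definition sol_symmetric :: "(nat \<Rightarrow> nat) \<Rightarrow> sol measure \<Rightarrow> bool" where
  "sol_symmetric a \<mu> \<longleftrightarrow> (\<forall>B\<in>sets \<mu>. emeasure \<mu> B = emeasure \<mu> (sol_neg a ` B))"

definition sol_conv :: "(nat \<Rightarrow> nat) \<Rightarrow> sol measure \<Rightarrow> sol measure \<Rightarrow> sol measure" where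
  "sol_conv a \<mu> \<nu> = distr (\<mu> \<Otimes>\<^sub>M \<nu>) (sol_borel a) (\<lambda>(x, y). sol_add a x y)"

definition sol_subgroup :: "(nat \<Rightarrow> nat) \<Rightarrow> sol set \<Rightarrow> bool" where
  "sol_subgroup a K \<longleftrightarrow> K \<subseteq> solenoid a \<and> sol_zero a \<in> K \<and>
     (\<forall>x\<in>K. \<forall>y\<in>K. sol_add a x y \<in> K) \<and> (\<forall>x\<in>K. sol_neg a x \<in> K)"

definition sol_corwin :: "(nat \<Rightarrow> nat) \<Rightarrow> sol set \<Rightarrow> bool" where
  "sol_corwin a K \<longleftrightarrow> (\<lambda>x. sol_mult a 2 x) ` K = K"

definition sol_haar :: "(nat \<Rightarrow> nat) \<Rightarrow> sol set \<Rightarrow> sol measure \<Rightarrow> bool" where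
  "sol_haar a K m \<longleftrightarrow> prob_space m \<and> sets m = sets (sol_borel a) \<and>
     emeasure m (solenoid a - K) = 0 \<and>
     (\<forall>x\<in>K. \<forall>B\<in>sets m. emeasure m ((\<lambda>y. sol_add a x y) ` B) = emeasure m B)"

definition hyperbolic_secant :: "real measure \<Rightarrow> bool" where
  "hyperbolic_secant M \<longleftrightarrow> real_distribution M \<and>
     (\<exists>\<sigma>::real. \<forall>s. char M s = complex_of_real (2 / (exp (\<sigma> * s) + exp (- \<sigma> * s))))"

definition sol_cont_mono :: "(nat \<Rightarrow> nat) \<Rightarrow> (real \<Rightarrow> sol) \<Rightarrow> bool" where
  "sol_cont_mono a \<tau> \<longleftrightarrow> continuous_map euclideanreal (sol_top a) \<tau> \<and> inj \<tau> \<and>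
     (\<forall>x y. \<tau> (x + y) = sol_add a (\<tau> x) (\<tau> y))"

end

theory Submission
  imports Defs "HOL-Real_Asymp.Real_Asymp" "HOL-Number_Theory.Cong"
begin

text \<open>
  The characters of the solenoid are indexed by the rationals \<open>y = k / (a\<^sub>0 \<cdots> a\<^sub>n)\<close>, and a distribution
  is determined by its characteristic function \<open>f\<close>. For symmetric \<open>\<mu>\<close> the two forms are identically
  distributed iff \<open>f(2y) (2 - f(y)\<^sup>2) = f(y)\<^sup>2\<close>, i.e. \<open>1/f\<close> satisfies the doubling formula of
  \<open>cosh\<close>. As there are no elements of order 2, the dual group is divisible by 2, hence \<open>f \<ge> 0\<close>, and
  one can write \<open>f = 1 / cosh \<theta>\<close> where \<open>f \<noteq> 0\<close>, with \<open>\<theta>(y/2) = \<theta>(y)/2\<close>. Since \<open>sqrt (1 - f)\<close> is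
  subadditive and \<open>2\<^sup>n sqrt (1 - f(y / 2\<^sup>n))\<close> tends to \<open>\<theta>(y) / sqrt 2\<close>, the set where \<open>f \<noteq> 0\<close> is a
  subgroup \<open>S\<close> closed under halving and \<open>\<theta>\<close> is subadditive on it; being also homogeneous under
  doubling, \<open>\<theta>\<close> is \<open>\<sigma>\<bar>y\<bar>\<close> on the rank one group \<open>S\<close>. So \<open>f\<close> is a hyperbolic secant times the indicator
  function of \<open>S\<close>, which is the characteristic function of the Haar distribution on the annihilator
  of \<open>S\<close>. Conversely, every continuous monomorphism turns a character into \<open>t \<mapsto> exp (i c t)\<close>, the
  characteristic function of a Haar distribution is the indicator function of an annihilator, and
  the Corwin property makes that indicator invariant under doubling.
\<close>

section \<open>Functions satisfying the doubling formula of cosh\<close>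

text \<open>The square root has a geometric origin: \<open>sqrt (2 * (1 - f y))\<close> is the L2
  distance between the character \<open>y\<close> and the constant 1, so its subadditivity is the
  triangle inequality. It survives the rescaling because \<open>1 - 1 / cosh t\<close> behaves like
  \<open>t\<^sup>2 / 2\<close> at 0. All measure theory goes through a second model of the solenoid,
  the inverse limit of circles under \<open>z ^ a n\<close>. Coordinate \<open>j\<close> is a power
  of every later coordinate, so events about a single coordinate are already closed under
  intersection. Hence one-dimensional marginals determine a distribution, nonnegative moments
  determine each marginal, and a compatible sequence of laws on the circle can be glued together.
  The two factors of the decomposition have to be constructed. The Haar factor is glued from uniform
  laws on roots of unity or on the whole circle; the secant law comes from the Gamma function and is
  carried to the solenoid by the line \<open>t \<mapsto> (t, 0)\<close>. The constant
  \<open>\<sigma>\<close> is found on \<open>S\<close> only. Using it on the whole dual group does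
  no harm, because off \<open>S\<close> the Haar factor vanishes.\<close>

lemma sqrt_one_minus_sech_limit:
  fixes c :: real
  assumes "c \<ge> 0"
  shows "(\<lambda>n. 2 ^ n * sqrt (1 - 1 / cosh (c / 2 ^ n))) \<longlonglongrightarrow> c / sqrt 2"
proof (cases "c = 0")
  case False
  with assms have c: "c > 0" by simp
  \<comment> \<open>Expansion at 0: \<open>1 - 1 / cosh t\<close> is \<open>t\<^sup>2 / 2\<close> to
    leading order.\<close>
  have h: "((\<lambda>t::real. sqrt (1 - 1 / cosh t) / t) \<longlongrightarrow> 1 / sqrt 2) (at_right 0)"
    by real_asymp (simp add: powr_half_sqrt real_sqrt_divide)
  have l: "filterlim (\<lambda>n. c / 2 ^ n) (at_right 0) sequentially"
    using c by real_asymp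
  have "(\<lambda>n. sqrt (1 - 1 / cosh (c / 2 ^ n)) / (c / 2 ^ n)) \<longlonglongrightarrow> 1 / sqrt 2"
    using filterlim_compose[OF h l] .
  from tendsto_mult_left[OF this, of c] show ?thesis
    using c by (simp add: field_simps)
qed simp

text \<open>The analytic core, freed from the solenoid: \<open>H\<close> stands for the dual group
  and \<open>f\<close> for the real characteristic function. Positive definiteness enters only
  through \<open>f_subadd\<close>, and \<open>H_rat\<close> makes any two elements
  commensurable.\<close>

lemma cosh_doubling_on_subgroup:
  fixes H :: "real set" and f :: "real \<Rightarrow> real"
  assumes H0: "0 \<in> H" and H_add: "\<And>x y. x \<in> H \<Longrightarrow> y \<in> H \<Longrightarrow> x + y \<in> H"
    and H_minus: "\<And>x. x \<in> H \<Longrightarrow> - x \<in> H" and H_half: "\<And>x. x \<in> H \<Longrightarrow> x / 2 \<in> H"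
    and H_rat: "H \<subseteq> \<rat>"
    and f0: "f 0 = 1" and f_bound: "\<And>x. x \<in> H \<Longrightarrow> \<bar>f x\<bar> \<le> 1"
    and f_even: "\<And>x. x \<in> H \<Longrightarrow> f (- x) = f x"
    and f_double: "\<And>x. x \<in> H \<Longrightarrow> f (2 * x) * (2 - (f x)\<^sup>2) = (f x)\<^sup>2"
    and f_subadd: "\<And>x y. x \<in> H \<Longrightarrow> y \<in> H \<Longrightarrow> sqrt (1 - f (x + y)) \<le> sqrt (1 - f x) + sqrt (1 - f y)"
  shows "\<And>x y. x \<in> H \<Longrightarrow> y \<in> H \<Longrightarrow> f x \<noteq> 0 \<Longrightarrow> f y \<noteq> 0 \<Longrightarrow> f (x + y) \<noteq> 0"
    and "\<exists>\<sigma>. \<forall>x\<in>H. f x \<noteq> 0 \<longrightarrow> f x = 1 / cosh (\<sigma> * x)"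
    and "\<And>x. x \<in> H \<Longrightarrow> f x \<noteq> 0 \<Longrightarrow> f (x / 2) \<noteq> 0"
proof -
  have sq1: "(f x)\<^sup>2 \<le> 1" if "x \<in> H" for x
    using f_bound[OF that] by (simp add: abs_square_le_1)
  have H_double: "2 * x \<in> H" if "x \<in> H" for x
    using H_add[OF that that] by simp
  have f_double': "f (2 * x) = (f x)\<^sup>2 / (2 - (f x)\<^sup>2)" if "x \<in> H" for x
    using f_double[OF that] sq1[OF that] by (simp add: eq_divide_eq)
  \<comment> \<open>Halving is what excludes negative values: \<open>f x\<close> is the doubling
    formula evaluated at \<open>x / 2\<close>, a square over a positive number.\<close>
  have f_nonneg: "f x \<ge> 0" if "x \<in> H" for x
    using f_double'[OF H_half[OF that]] sq1[OF H_half[OF that]] by simp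
  have f_le1: "f x \<le> 1" if "x \<in> H" for x
    using f_bound[OF that] by simp
  define S where "S = {x \<in> H. f x \<noteq> 0}"
  define \<theta> where "\<theta> x = arcosh (1 / f x)" for x
  have S_pos: "f x > 0" if "x \<in> S" for x
    using that f_nonneg[of x] by (auto simp: S_def)
  have SH: "x \<in> H" if "x \<in> S" for x using that by (simp add: S_def)
  have ge1: "1 / f x \<ge> 1" if "x \<in> S" for x
    using S_pos[OF that] f_le1[OF SH[OF that]] by simp
  have \<theta>_nonneg: "\<theta> x \<ge> 0" if "x \<in> S" for x
    using ge1[OF that] by (simp add: \<theta>_def)
  have cosh_\<theta>: "cosh (\<theta> x) = 1 / f x" if "x \<in> S" for x
    unfolding \<theta>_def by (rule cosh_arcosh_real[OF ge1[OF that]])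
  have f_eq: "f x = 1 / cosh (\<theta> x)" if "x \<in> S" for x
    using cosh_\<theta>[OF that] by simp
  \<comment> \<open>The denominator \<open>2 - (f x)\<^sup>2\<close> lies between 1 and 2, so
    \<open>f (2 * x)\<close> vanishes exactly when \<open>f x\<close> does. Nonvanishing therefore
    moves both up and down the scales \<open>x / 2 ^ n\<close>.\<close>
  have S_double_iff: "2 * x \<in> S \<longleftrightarrow> x \<in> S" if "x \<in> H" for x
    using f_double'[OF that] sq1[OF that] that H_double[OF that] by (auto simp: S_def)
  have S_half: "x / 2 \<in> S" if "x \<in> S" for x
    using S_double_iff[OF H_half[OF SH[OF that]]] that by simp
  show "f (x / 2) \<noteq> 0" if "x \<in> H" "f x \<noteq> 0" for x
    using S_half[of x] that by (simp add: S_def)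
  have H_pow: "x / 2 ^ n \<in> H" if "x \<in> H" for x n
  proof (induction n)
    case (Suc n)
    then show ?case using H_half[OF Suc] by (simp add: field_simps)
  qed (use that in simp)
  have S_pow_iff: "x / 2 ^ n \<in> S \<longleftrightarrow> x \<in> S" if "x \<in> H" for x n
  proof (induction n)
    case (Suc n)
    have "2 * (x / 2 ^ Suc n) = x / 2 ^ n" by simp
    then show ?case using S_double_iff[OF H_pow[OF that, of "Suc n"]] Suc by simp
  qed simp
  have \<theta>_double: "\<theta> (2 * x) = 2 * \<theta> x" if "x \<in> S" for x
  proof -
    \<comment> \<open>Inverted, the doubling formula reads
      \<open>1 / f (2 * x) = 2 * (1 / f x)\<^sup>2 - 1\<close>, the double angle formula of
      \<open>cosh\<close>.\<close>
    have "cosh (2 * \<theta> x) = 2 * (1 / f x)\<^sup>2 - 1"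
      using cosh_\<theta>[OF that] by (simp add: cosh_double_cosh)
    also have "\<dots> = 1 / f (2 * x)"
      using S_pos[OF that] sq1[OF SH[OF that]]
      unfolding f_double'[OF SH[OF that]] by (simp add: field_simps)
    finally have "\<theta> (2 * x) = arcosh (cosh (2 * \<theta> x))"
      by (simp add: \<theta>_def)
    then show ?thesis using \<theta>_nonneg[OF that] by (simp add: arcosh_cosh_real)
  qed
  have \<theta>_pow: "\<theta> (x / 2 ^ n) = \<theta> x / 2 ^ n" if "x \<in> S" for x n
  proof (induction n)
    case (Suc n)
    have *: "2 * (x / 2 ^ Suc n) = x / 2 ^ n" by simp
    have "x / 2 ^ Suc n \<in> S" using S_pow_iff[OF SH[OF that]] that by blast
    from \<theta>_double[OF this] show ?case unfolding * Suc by simp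
  qed simp
  have lim: "(\<lambda>n. 2 ^ n * sqrt (1 - f (x / 2 ^ n))) \<longlonglongrightarrow> \<theta> x / sqrt 2" if "x \<in> S" for x
  proof -
    have "f (x / 2 ^ n) = 1 / cosh (\<theta> x / 2 ^ n)" for n
      using f_eq[of "x / 2 ^ n"] S_pow_iff[OF SH[OF that]] \<theta>_pow[OF that] that by simp
    then show ?thesis using sqrt_one_minus_sech_limit[OF \<theta>_nonneg[OF that]] by simp
  qed
  have lim0: "(\<lambda>n. sqrt (1 - f (x / 2 ^ n))) \<longlonglongrightarrow> 0" if "x \<in> S" for x
  proof -
    have "(\<lambda>n. (1 / 2 ^ n) * (2 ^ n * sqrt (1 - f (x / 2 ^ n)))) \<longlonglongrightarrow> 0 * (\<theta> x / sqrt 2)"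
      by (rule tendsto_mult[OF _ lim[OF that]]) real_asymp
    then show ?thesis by simp
  qed
  \<comment> \<open>At a fine enough scale both values are so close to 1 that the subadditive bound
    stays below 1. This forces \<open>f ((x + y) / 2 ^ n)\<close> to be positive, and doubling
    \<open>n\<close> times returns to \<open>x + y\<close>.\<close>
  have S_add: "x + y \<in> S" if "x \<in> S" "y \<in> S" for x y
  proof -
    have "(\<lambda>n. sqrt (1 - f (x / 2 ^ n)) + sqrt (1 - f (y / 2 ^ n))) \<longlonglongrightarrow> 0 + 0"
      by (intro tendsto_add lim0 that)
    then have "eventually (\<lambda>n. sqrt (1 - f (x / 2 ^ n)) + sqrt (1 - f (y / 2 ^ n)) < 1) sequentially"
      by (intro order_tendstoD) auto
    then obtain n where n: "sqrt (1 - f (x / 2 ^ n)) + sqrt (1 - f (y / 2 ^ n)) < 1"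
      by (auto simp: eventually_sequentially)
    have "sqrt (1 - f ((x + y) / 2 ^ n)) < 1"
      using f_subadd[OF H_pow[OF SH[OF that(1)], of n] H_pow[OF SH[OF that(2)], of n]] n
      unfolding add_divide_distrib by linarith
    then have "f ((x + y) / 2 ^ n) \<noteq> 0" by auto
    moreover have "x + y \<in> H" using H_add SH that by blast
    ultimately have "(x + y) / 2 ^ n \<in> S" using H_pow by (simp add: S_def)
    then show ?thesis using S_pow_iff[OF \<open>x + y \<in> H\<close>] by blast
  qed
  show "f (x + y) \<noteq> 0" if "x \<in> H" "y \<in> H" "f x \<noteq> 0" "f y \<noteq> 0" for x y
    using S_add[of x y] that by (simp add: S_def)
  have \<theta>_add: "\<theta> (x + y) \<le> \<theta> x + \<theta> y" if "x \<in> S" "y \<in> S" for x y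
  proof -
    have "\<theta> (x + y) / sqrt 2 \<le> \<theta> x / sqrt 2 + \<theta> y / sqrt 2"
    proof (rule LIMSEQ_le[OF lim[OF S_add[OF that]] tendsto_add[OF lim[OF that(1)] lim[OF that(2)]]])
      have "2 ^ n * sqrt (1 - f ((x + y) / 2 ^ n)) \<le> 2 ^ n * (sqrt (1 - f (x / 2 ^ n)) + sqrt (1 - f (y / 2 ^ n)))" for n
        using f_subadd[OF H_pow[OF SH[OF that(1)], of n] H_pow[OF SH[OF that(2)], of n]]
        by (intro mult_left_mono) (auto simp: add_divide_distrib)
      then show "\<exists>N. \<forall>n\<ge>N. 2 ^ n * sqrt (1 - f ((x + y) / 2 ^ n)) \<le> 2 ^ n * sqrt (1 - f (x / 2 ^ n)) + 2 ^ n * sqrt (1 - f (y / 2 ^ n))"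
        by (simp add: distrib_left)
    qed
    then show ?thesis by (simp add: field_simps)
  qed
  have \<theta>0: "\<theta> 0 = 0" by (simp add: \<theta>_def f0)
  have S0: "0 \<in> S" using H0 f0 by (simp add: S_def)
  have S_mult: "real m * x \<in> S" if "x \<in> S" for m x
    by (induction m) (use that S0 in \<open>auto simp: distrib_right intro: S_add\<close>)
  have \<theta>_mult_le: "\<theta> (real m * x) \<le> real m * \<theta> x" if "x \<in> S" for m x
  proof (induction m)
    case (Suc m)
    have "\<theta> (x + real m * x) \<le> \<theta> x + \<theta> (real m * x)" by (intro \<theta>_add that S_mult)
    with Suc show ?case by (simp add: algebra_simps)
  qed (simp add: \<theta>0)
  have \<theta>_pow2: "\<theta> (2 ^ k * x) = 2 ^ k * \<theta> x" if "x \<in> S" for k x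
  proof -
    have "2 ^ k * x \<in> S" using S_mult[OF that, of "2 ^ k"] by simp
    from \<theta>_pow[OF this, of k] show ?thesis by simp
  qed
  have \<theta>_mult: "\<theta> (real m * x) = real m * \<theta> x" if "x \<in> S" for m x
  proof (rule antisym[OF \<theta>_mult_le[OF that]])
    have m: "m < 2 ^ m" by simp
    \<comment> \<open>Homogeneity is known exactly at the multiplier \<open>2 ^ m\<close>, which
      exceeds \<open>m\<close>. Splitting it as \<open>m + (2 ^ m - m)\<close> leaves no slack in
      the upper bounds of the two parts, so both are equalities.\<close>
    have "2 ^ m * x = real m * x + real (2 ^ m - m) * x"
      using m by (simp add: of_nat_diff algebra_simps)
    then have "2 ^ m * \<theta> x \<le> \<theta> (real m * x) + \<theta> (real (2 ^ m - m) * x)"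
      using \<theta>_add[OF S_mult[OF that, of m] S_mult[OF that, of "2 ^ m - m"]] \<theta>_pow2[OF that, of m]
      by simp
    also have "\<dots> \<le> \<theta> (real m * x) + real (2 ^ m - m) * \<theta> x"
      using \<theta>_mult_le[OF that, of "2 ^ m - m"] by linarith
    finally show "real m * \<theta> x \<le> \<theta> (real m * x)"
      using m by (simp add: of_nat_diff algebra_simps)
  qed
  have \<theta>_minus: "\<theta> (- x) = \<theta> x" if "x \<in> H" for x
    using f_even[OF that] by (simp add: \<theta>_def)
  show "\<exists>\<sigma>. \<forall>x\<in>H. f x \<noteq> 0 \<longrightarrow> f x = 1 / cosh (\<sigma> * x)"
  proof (cases "S \<subseteq> {0}")
    case True
    then have "\<forall>x\<in>H. f x \<noteq> 0 \<longrightarrow> f x = 1 / cosh (0 * x)"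
      using f0 by (auto simp: S_def)
    then show ?thesis by blast
  next
    case False
    then obtain y where y: "y \<in> S" "y \<noteq> 0" by auto
    define \<sigma> where "\<sigma> = \<theta> y / \<bar>y\<bar>"
    have "f x = 1 / cosh (\<sigma> * x)" if x: "x \<in> S" for x
    proof -
      \<comment> \<open>Rank one: \<open>q * \<bar>x\<bar> = p * \<bar>y\<bar>\<close>, so
        homogeneity of \<open>\<theta>\<close> fixes its value at \<open>x\<close> from the single
        value at \<open>y\<close>.\<close>
      have "x / y \<in> \<rat>" using H_rat SH x y by (intro Rats_divide) auto
      then obtain p q where q: "q \<noteq> 0" and pq: "\<bar>x / y\<bar> = real p / real q"
        by (rule Rats_abs_nat_div_natE)
      then have "real q * \<bar>x\<bar> = real p * \<bar>y\<bar>" using y by (simp add: field_simps)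
      moreover have "\<theta> \<bar>z\<bar> = \<theta> z" "\<bar>z\<bar> \<in> S" if "z \<in> S" for z
        using \<theta>_minus[OF SH[OF that]] that H_minus f_even by (auto simp: abs_if S_def)
      ultimately have "real q * \<theta> x = real p * \<theta> y"
        using \<theta>_mult[of "\<bar>x\<bar>" q] \<theta>_mult[of "\<bar>y\<bar>" p] x y by metis
      then have "\<theta> x = (real p / real q) * \<theta> y" using q by (simp add: field_simps)
      also have "\<dots> = \<sigma> * \<bar>x\<bar>" unfolding pq[symmetric] \<sigma>_def by (simp add: abs_divide)
      finally have "cosh (\<theta> x) = cosh (\<sigma> * x)"
        by (cases "x \<ge> 0") auto
      then show ?thesis using f_eq[OF x] by simp
    qed
    then show ?thesis unfolding S_def by blast
  qed
qed

section \<open>Measures on the unit circle\<close>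

text \<open>The indicator of a nonempty closed set is the pointwise limit of the continuous
  functions \<open>max 0 (1 - n * infdist x C)\<close>, all bounded by 1, so dominated convergence
  applies. Closed sets form an intersection-stable generator.\<close>

lemma closed_sets_measure_eqI:
  fixes M N :: "'a::metric_space measure"
  assumes "finite_measure M" "finite_measure N" and sets: "sets M = sets borel" "sets N = sets borel"
    and eq: "\<And>f::'a \<Rightarrow> real. continuous_on UNIV f \<Longrightarrow> (\<And>x. \<bar>f x\<bar> \<le> 1) \<Longrightarrow> integral\<^sup>L M f = integral\<^sup>L N f"
  shows "M = N"
proof -
  interpret M: finite_measure M by fact
  interpret N: finite_measure N by fact
  have sp: "space M = UNIV" "space N = UNIV"
    using sets_eq_imp_space_eq[OF sets(1)] sets_eq_imp_space_eq[OF sets(2)] by auto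
  have mb: "f \<in> borel_measurable M" "f \<in> borel_measurable N"
    if "f \<in> borel_measurable borel" for f :: "'a \<Rightarrow> real"
    using that unfolding measurable_cong_sets[OF sets(1) refl] measurable_cong_sets[OF sets(2) refl] by assumption+
  have closed_eq: "measure M C = measure N C" if C: "closed C" for C
  proof (cases "C = {}")
    case False
    define g where "g n x = max 0 (1 - real n * infdist x C)" for n and x :: 'a
    have g_cont: "continuous_on UNIV (g n)" for n
      unfolding g_def by (intro continuous_intros)
    have g_bound: "\<bar>g n x\<bar> \<le> 1" for n x
      using infdist_nonneg[of x C] by (auto simp: g_def max_def)
    have g_lim: "(\<lambda>n. g n x) \<longlonglongrightarrow> indicator C x" for x
    proof (cases "x \<in> C")
      case True
      then show ?thesis by (simp add: g_def)
    next
      case x: False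
      then have "infdist x C > 0"
        using in_closed_iff_infdist_zero[OF C False] infdist_nonneg[of x C] by fastforce
      then obtain n0 :: nat where n0: "1 / infdist x C < n0" using reals_Archimedean2 by blast
      have "g n x = 0" if "n \<ge> n0" for n
      proof -
        have "1 / infdist x C < real n" using n0 that by linarith
        then show ?thesis using \<open>infdist x C > 0\<close> by (simp add: g_def field_simps)
      qed
      then have "eventually (\<lambda>n. g n x = indicator C x) sequentially"
        using x by (auto simp: eventually_sequentially)
      then show ?thesis by (rule tendsto_eventually)
    qed
    have gm: "g n \<in> borel_measurable borel" for n
      using g_cont by (rule borel_measurable_continuous_onI)
    have Cm: "C \<in> sets borel" using C by simp
    have "(\<lambda>n. integral\<^sup>L M (g n)) \<longlonglongrightarrow> integral\<^sup>L M (indicator C)"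
    proof (rule integral_dominated_convergence[where w="\<lambda>_. 1"])
      show "(indicator C :: 'a \<Rightarrow> real) \<in> borel_measurable M" by (rule mb) (use Cm in simp)
    qed (simp_all add: g_lim g_bound mb gm)
    moreover have "(\<lambda>n. integral\<^sup>L N (g n)) \<longlonglongrightarrow> integral\<^sup>L N (indicator C)"
    proof (rule integral_dominated_convergence[where w="\<lambda>_. 1"])
      show "(indicator C :: 'a \<Rightarrow> real) \<in> borel_measurable N" by (rule mb) (use Cm in simp)
    qed (simp_all add: g_lim g_bound mb gm)
    moreover have "integral\<^sup>L M (g n) = integral\<^sup>L N (g n)" for n
      by (rule eq[OF g_cont g_bound])
    ultimately have "integral\<^sup>L M (indicator C) = (integral\<^sup>L N (indicator C) :: real)"
      using LIMSEQ_unique by simp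
    then show ?thesis by (simp add: sp)
  qed simp
  show ?thesis
  proof (rule measure_eqI_generator_eq[where E="Collect closed" and \<Omega>=UNIV and A="\<lambda>_. UNIV"])
    show "Int_stable (Collect closed :: 'a set set)" by (auto simp: Int_stable_def)
    show "emeasure M X = emeasure N X" if "X \<in> Collect closed" for X
      using closed_eq that by (simp add: M.emeasure_eq_measure N.emeasure_eq_measure)
    show "sets M = sigma_sets UNIV (Collect closed)" "sets N = sigma_sets UNIV (Collect closed)"
      using sets by (simp_all add: borel_eq_closed)
  qed (auto simp: sp)
qed

text \<open>Real functions of the form \<open>p(z) / z\<^sup>n\<close> on the unit circle form an algebra containing
  the real and imaginary part, because the inverse of \<open>z\<close> is its conjugate.\<close>

lemma circle_trig_approx:
  fixes f :: "complex \<Rightarrow> real"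
  assumes "continuous_on (sphere 0 1) f" "e > 0"
  shows "\<exists>g p n. continuous_on (sphere 0 1) g \<and> (\<forall>z\<in>sphere 0 1. of_real (g z) * z ^ n = poly p z)
     \<and> (\<forall>z\<in>sphere 0 1. \<bar>f z - g z\<bar> < e)"
proof -
  define Q :: "(complex \<Rightarrow> real) \<Rightarrow> complex poly \<Rightarrow> nat \<Rightarrow> bool"
    where "Q g p n \<longleftrightarrow> (\<forall>z\<in>sphere 0 1. of_real (g z) * z ^ n = poly p z)" for g p n
  define P where "P g \<longleftrightarrow> continuous_on (sphere 0 1) g \<and> (\<exists>p n. Q g p n)" for g
  have conj: "z * cnj z = 1" if "norm z = 1" for z :: complex
    using that complex_norm_square[of z] by simp
  have "\<exists>g. P g \<and> (\<forall>z\<in>sphere 0 1. \<bar>f z - g z\<bar> < e)"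
  proof (rule Stone_Weierstrass_HOL)
    show "P (\<lambda>x. c)" for c
      unfolding P_def Q_def by (intro conjI exI[of _ "[:of_real c:]"] exI[of _ 0]) auto
    show "P (\<lambda>x. g x + h x)" if gh: "P g \<and> P h" for g h
    proof -
      obtain p n where "Q g p n" using gh unfolding P_def by blast
      moreover obtain q m where "Q h q m" using gh unfolding P_def by blast
      \<comment> \<open>Both numerators are brought to the common denominator
        \<open>z ^ (n + m)\<close>.\<close>
      ultimately have "Q (\<lambda>x. g x + h x) (p * monom 1 m + q * monom 1 n) (n + m)"
        by (auto simp: Q_def poly_monom power_add algebra_simps)
      then show ?thesis using gh by (auto simp: P_def intro: continuous_intros)
    qed
    show "P (\<lambda>x. g x * h x)" if gh: "P g \<and> P h" for g h
    proof -
      obtain p n where gp: "Q g p n" using gh unfolding P_def by blast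
      obtain q m where hq: "Q h q m" using gh unfolding P_def by blast
      have "Q (\<lambda>x. g x * h x) (p * q) (n + m)"
        unfolding Q_def
      proof (intro ballI)
        fix z :: complex assume z: "z \<in> sphere 0 1"
        have "of_real (g z * h z) * z ^ (n + m) = (of_real (g z) * z ^ n) * (of_real (h z) * z ^ m)"
          by (simp add: power_add)
        also have "\<dots> = poly p z * poly q z"
          using gp[unfolded Q_def, rule_format, OF z] hq[unfolded Q_def, rule_format, OF z] by (rule arg_cong2)
        finally show "of_real (g z * h z) * z ^ (n + m) = poly (p * q) z"
          by (simp only: poly_mult)
      qed
      then show ?thesis using gh by (auto simp: P_def intro: continuous_intros)
    qed
    show "\<exists>f. P f \<and> f x \<noteq> f y" if "x \<in> sphere 0 1 \<and> y \<in> sphere 0 1 \<and> x \<noteq> y" for x y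
    proof -
      have halve: "w = v / 2" if "2 * w = v" for w v :: complex using that by auto
      \<comment> \<open>The coefficients come from \<open>2 * Re z = z + 1 / z\<close> on the
        circle, multiplied by \<open>z\<close>; those for \<open>Im\<close> below come from
        \<open>2 * \<i> * Im z = z - 1 / z\<close>.\<close>
      have "Q Re [:1/2, 0, 1/2:] 1" unfolding Q_def
      proof
        fix z :: complex assume "z \<in> sphere 0 1"
        then have "norm z = 1" by simp
        then have "(z + cnj z) * z = 1 + z * z" using conj[of z] by (simp add: algebra_simps)
        then have "2 * (of_real (Re z) * z) = 1 + z * z" by (simp add: complex_add_cnj mult.assoc)
        from halve[OF this] show "of_real (Re z) * z ^ 1 = poly [:1/2, 0, 1/2:] z"
          by (simp add: add_divide_distrib)
      qed
      moreover have "Q Im [:\<i>/2, 0, - \<i>/2:] 1" unfolding Q_def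
      proof
        fix z :: complex assume "z \<in> sphere 0 1"
        then have "norm z = 1" by simp
        then have "(z - cnj z) * z = z * z - 1" using conj[of z] by (simp add: algebra_simps)
        then have "\<i> * (2 * (of_real (Im z) * z)) = z * z - 1" by (simp add: complex_diff_cnj mult.assoc mult.left_commute)
        then have "- \<i> * (\<i> * (2 * (of_real (Im z) * z))) = - \<i> * (z * z - 1)" by simp
        then have "2 * (of_real (Im z) * z) = \<i> - \<i> * (z * z)" by (simp add: algebra_simps)
        from halve[OF this] show "of_real (Im z) * z ^ 1 = poly [:\<i>/2, 0, - \<i>/2:] z"
          by (simp add: diff_divide_distrib mult.left_commute)
      qed
      moreover have "continuous_on (sphere 0 1) Re" "continuous_on (sphere 0 1) Im"
        by (rule continuous_on_Re[OF continuous_on_id] continuous_on_Im[OF continuous_on_id])+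
      ultimately have "P Re" "P Im" unfolding P_def by blast+
      then show ?thesis using that complex_eq_iff by blast
    qed
  qed (use assms in \<open>auto simp: P_def\<close>)
  then show ?thesis unfolding P_def Q_def by blast
qed

text \<open>Moments of negative order are conjugates of the given ones, so all trigonometric
  polynomials integrate equally, and they approximate continuous functions uniformly on the circle.
  The measures live on the whole plane and charge only the circle, hence the almost-everywhere
  hypotheses.\<close>

lemma circle_measure_eqI:
  fixes M N :: "complex measure"
  assumes "finite_measure M" "finite_measure N" and sets: "sets M = sets borel" "sets N = sets borel"
    and AE: "AE z in M. norm z = 1" "AE z in N. norm z = 1"
    and moments: "\<And>k::nat. integral\<^sup>L M (\<lambda>z. z ^ k) = integral\<^sup>L N (\<lambda>z. z ^ k)"
  shows "M = N"
proof (rule closed_sets_measure_eqI)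
  interpret M: finite_measure M by fact
  interpret N: finite_measure N by fact
  have mb: "f \<in> borel_measurable M" "f \<in> borel_measurable N"
    if "f \<in> borel_measurable borel" for f :: "complex \<Rightarrow> 'b::topological_space"
    using that unfolding measurable_cong_sets[OF sets(1) refl] measurable_cong_sets[OF sets(2) refl] by assumption+
  have int: "integrable K f"
    if "finite_measure K" "sets K = sets borel" "AE z in K. norm z = 1"
      "f \<in> borel_measurable borel" "\<And>z. norm z = 1 \<Longrightarrow> norm (f z) \<le> B"
    for K B and f :: "complex \<Rightarrow> 'b::{banach, second_countable_topology}"
  proof -
    interpret K: finite_measure K by fact
    have "f \<in> borel_measurable K" using that by (simp cong: measurable_cong_sets)
    then show ?thesis
      by (intro K.integrable_const_bound[where B=B]) (use that in auto)
  qed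
  have mono: "integral\<^sup>L M (\<lambda>z. z ^ k * cnj z ^ n) = integral\<^sup>L N (\<lambda>z. z ^ k * cnj z ^ n)" for k n
  proof -
    \<comment> \<open>On the circle \<open>cnj z\<close> is the inverse of \<open>z\<close>, so the
      mixed moment has exponent \<open>k - n\<close>, read as a conjugate when this is
      negative.\<close>
    have red: "integral\<^sup>L K (\<lambda>z. z ^ k * cnj z ^ n) =
        (if n \<le> k then integral\<^sup>L K (\<lambda>z. z ^ (k - n)) else cnj (integral\<^sup>L K (\<lambda>z. z ^ (n - k))))"
      if K: "AE z in K. norm z = 1" "sets K = sets borel" for K
    proof -
      have m: "f \<in> borel_measurable K" if "f \<in> borel_measurable borel" for f :: "complex \<Rightarrow> complex"
        using that K(2) by (simp cong: measurable_cong_sets)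
      have c: "z ^ k * cnj z ^ n = (if n \<le> k then z ^ (k - n) else cnj (z ^ (n - k)))"
        if "norm z = 1" for z :: complex
      proof -
        have zz: "z * cnj z = 1" using that complex_norm_square[of z] by simp
        show ?thesis
        proof (cases "n \<le> k")
          case True
          then have "z ^ k = z ^ (k - n) * z ^ n" by (metis le_add_diff_inverse2 power_add)
          moreover have "z ^ n * cnj z ^ n = 1" using zz by (metis power_mult_distrib power_one)
          ultimately show ?thesis using True by (simp only: mult.assoc mult_1_right if_True)
        next
          case False
          then have "cnj z ^ n = cnj z ^ k * cnj z ^ (n - k)" by (metis le_add_diff_inverse nat_le_linear power_add)
          moreover have "z ^ k * cnj z ^ k = 1" using zz by (metis power_mult_distrib power_one)
          ultimately have "z ^ k * cnj z ^ n = cnj z ^ (n - k)" by (metis mult.assoc mult_1_left)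
          then show ?thesis using False by simp
        qed
      qed
      have "integral\<^sup>L K (\<lambda>z. z ^ k * cnj z ^ n) = integral\<^sup>L K (\<lambda>z. if n \<le> k then z ^ (k - n) else cnj (z ^ (n - k)))"
      proof (rule integral_cong_AE)
        show "(\<lambda>z. z ^ k * cnj z ^ n) \<in> borel_measurable K"
          by (intro m borel_measurable_continuous_onI continuous_intros)
        show "(\<lambda>z. if n \<le> k then z ^ (k - n) else cnj (z ^ (n - k))) \<in> borel_measurable K"
          by (cases "n \<le> k") (simp_all, (intro m borel_measurable_continuous_onI continuous_intros)+)
        show "AE z in K. z ^ k * cnj z ^ n = (if n \<le> k then z ^ (k - n) else cnj (z ^ (n - k)))"
          using K(1) by eventually_elim (rule c)
      qed
      also have "\<dots> = (if n \<le> k then integral\<^sup>L K (\<lambda>z. z ^ (k - n)) else cnj (integral\<^sup>L K (\<lambda>z. z ^ (n - k))))"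
        by (cases "n \<le> k") (simp_all only: if_True if_False Bochner_Integration.integral_cnj)
      finally show ?thesis .
    qed
    show ?thesis unfolding red[OF AE(1) sets(1)] red[OF AE(2) sets(2)] by (simp add: moments)
  qed
  fix f :: "complex \<Rightarrow> real"
  assume f: "continuous_on UNIV f" and f1: "\<And>x. \<bar>f x\<bar> \<le> 1"
  have fb: "f \<in> borel_measurable borel" using f by (rule borel_measurable_continuous_onI)
  \<comment> \<open>The summand 1 makes \<open>C\<close> positive and the final estimate strict: the
    total error is at most \<open>e\<close> times the two masses, hence less than
    \<open>e * C\<close>, which is the assumed gap.\<close>
  define C where "C = 1 + measure M (space M) + measure N (space N)"
  have C: "C > 0" unfolding C_def by (simp add: add_pos_nonneg)
  show "integral\<^sup>L M f = integral\<^sup>L N f"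
  proof (rule ccontr)
    assume ne: "integral\<^sup>L M f \<noteq> integral\<^sup>L N f"
    define e where "e = \<bar>integral\<^sup>L M f - integral\<^sup>L N f\<bar> / C"
    have e: "e > 0" using ne C by (simp add: e_def)
    obtain g p n where gp: "\<forall>z\<in>sphere 0 1. of_real (g z) * z ^ n = poly p z"
        "\<forall>z\<in>sphere 0 1. \<bar>f z - g z\<bar> < e"
      using circle_trig_approx[OF continuous_on_subset[OF f subset_UNIV] e] by blast
    have g: "of_real (g z) * z ^ n = poly p z" and fg: "\<bar>f z - g z\<bar> < e" if "norm z = 1" for z
      using gp that by simp_all
    \<comment> \<open>\<open>g\<close> is controlled on the circle only. \<open>h\<close> equals
      \<open>g\<close> there, but is a polynomial in \<open>z\<close> and \<open>cnj z\<close> on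
      the whole plane, so it is measurable and its integral is a combination of moments.\<close>
    define h where "h z = poly p z * cnj z ^ n" for z
    have hg: "h z = of_real (g z)" if "norm z = 1" for z
    proof -
      have zz: "z * cnj z = 1" using that complex_norm_square[of z] by simp
      have "h z = of_real (g z) * (z ^ n * cnj z ^ n)" using g[OF that] by (simp add: h_def mult.assoc)
      also have "z ^ n * cnj z ^ n = 1" using zz by (metis power_mult_distrib power_one)
      finally show ?thesis by simp
    qed
    have hb: "h \<in> borel_measurable borel"
      unfolding h_def by (intro borel_measurable_continuous_onI continuous_intros)
    have h_int: "integral\<^sup>L K h = (\<Sum>i\<le>degree p. coeff p i * integral\<^sup>L K (\<lambda>z. z ^ i * cnj z ^ n))"
      if K: "finite_measure K" "sets K = sets borel" "AE z in K. norm z = 1" for K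
    proof -
      have "integral\<^sup>L K h = integral\<^sup>L K (\<lambda>z. \<Sum>i\<le>degree p. coeff p i * (z ^ i * cnj z ^ n))"
        unfolding h_def[abs_def] by (simp only: poly_altdef sum_distrib_right mult.assoc)
      also have "\<dots> = (\<Sum>i\<le>degree p. integral\<^sup>L K (\<lambda>z. coeff p i * (z ^ i * cnj z ^ n)))"
      proof (rule Bochner_Integration.integral_sum)
        show "integrable K (\<lambda>z. coeff p i * (z ^ i * cnj z ^ n))" for i
        proof (rule int[OF K])
          show "(\<lambda>z. coeff p i * (z ^ i * cnj z ^ n)) \<in> borel_measurable borel"
            by (intro borel_measurable_continuous_onI continuous_intros)
          show "norm (coeff p i * (z ^ i * cnj z ^ n)) \<le> norm (coeff p i)" if "norm z = 1" for z
            using that by (simp add: norm_mult norm_power)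
        qed
      qed
      finally show ?thesis by (simp only: integral_mult_right_zero)
    qed
    have close: "\<bar>integral\<^sup>L K f - Re (integral\<^sup>L K h)\<bar> \<le> e * measure K (space K)"
      if K: "finite_measure K" "sets K = sets borel" "AE z in K. norm z = 1" for K
    proof -
      interpret K: finite_measure K by fact
      have fi: "integrable K f" by (rule int[OF K fb]) (rule f1[folded real_norm_def])
      have hi: "integrable K h"
      proof (rule int[OF K hb])
        fix z :: complex assume z: "norm z = 1"
        show "norm (h z) \<le> 1 + e" using hg[OF z] fg[OF z] f1[of z] by auto
      qed
      have "\<bar>integral\<^sup>L K f - Re (integral\<^sup>L K h)\<bar> = \<bar>integral\<^sup>L K (\<lambda>z. f z - Re (h z))\<bar>"
        using fi hi by (simp add: integral_Re)
      also have "\<dots> \<le> integral\<^sup>L K (\<lambda>z. \<bar>f z - Re (h z)\<bar>)"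
        by (rule integral_abs_bound)
      also have "\<dots> \<le> integral\<^sup>L K (\<lambda>z. e)"
      proof (rule integral_mono_AE)
        show "AE z in K. \<bar>f z - Re (h z)\<bar> \<le> e"
          using K(3) by eventually_elim (use hg fg in \<open>fastforce\<close>)
        show "integrable K (\<lambda>z. \<bar>f z - Re (h z)\<bar>)" using fi hi by auto
      qed simp
      finally show ?thesis by (simp add: mult.commute)
    qed
    have "integral\<^sup>L M h = integral\<^sup>L N h"
      using h_int[OF assms(1) sets(1) AE(1)] h_int[OF assms(2) sets(2) AE(2)] mono by simp
    then have "\<bar>integral\<^sup>L M f - integral\<^sup>L N f\<bar> \<le> e * (measure M (space M) + measure N (space N))"
      using close[OF assms(1) sets(1) AE(1)] close[OF assms(2) sets(2) AE(2)] by (simp add: distrib_left)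
    also have "\<dots> < e * C" using e by (simp add: C_def)
    finally show False using C by (simp add: e_def)
  qed
qed fact+

section \<open>Hyperbolic secant distributions and characters of the real line\<close>

lemma integral_pair_mult:
  fixes f :: "'a \<Rightarrow> complex" and g :: "'b \<Rightarrow> complex"
  assumes "prob_space M" "prob_space N" "f \<in> borel_measurable M" "g \<in> borel_measurable N"
    and "\<And>x. x \<in> space M \<Longrightarrow> norm (f x) \<le> 1" "\<And>y. y \<in> space N \<Longrightarrow> norm (g y) \<le> 1"
  shows "(\<integral>p. f (fst p) * g (snd p) \<partial>(M \<Otimes>\<^sub>M N)) = integral\<^sup>L M f * integral\<^sup>L N g"
proof -
  interpret M: prob_space M by fact
  interpret N: prob_space N by fact
  interpret P: pair_prob_space M N ..
  have [measurable]: "f \<in> borel_measurable M" "g \<in> borel_measurable N" by fact+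
  have "integrable (M \<Otimes>\<^sub>M N) (\<lambda>p. f (fst p) * g (snd p))"
  proof (rule P.P.integrable_const_bound[where B=1])
    show "AE p in M \<Otimes>\<^sub>M N. norm (f (fst p) * g (snd p)) \<le> 1"
      using assms(5,6) by (intro AE_I2) (auto simp: space_pair_measure norm_mult intro!: mult_le_one)
  qed measurable
  then show ?thesis by (simp add: P.integral_fst'[symmetric])
qed

text \<open>Euler's integral at \<open>z = 1/2 + \<i> * s\<close>, with
  \<open>t powr (z - 1)\<close> split into a modulus, which is an unnormalised density, and the
  phase \<open>iexp (s * ln t)\<close>. It is thus the Fourier transform of the law of
  \<open>ln t\<close>.\<close>

lemma Gamma_line_integral:
  fixes s :: real
  shows "(\<integral>t. (indicator {0<..} t * (t powr (-1/2) / exp t)) *\<^sub>R iexp (s * ln t) \<partial>lborel) = Gamma (1/2 + \<i> * s)"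
    and "integrable lborel (\<lambda>t. (indicator {0<..} t * (t powr (-1/2) / exp t)) *\<^sub>R iexp (s * ln t))"
proof -
  define z where "z = 1/2 + \<i> * s"
  have z: "Re z > 0" by (simp add: z_def)
  let ?f = "\<lambda>t. complex_of_real t powr (z - 1) / of_real (exp t)"
  let ?h = "\<lambda>t. (indicator {0<..} t * (t powr (-1/2) / exp t)) *\<^sub>R iexp (s * ln t)"
  have eq: "indicator {0<..} t *\<^sub>R ?f t = ?h t" for t :: real
  proof (cases "t > 0")
    case True
    then have "complex_of_real t powr (z - 1) = exp (of_real (- (1/2) * ln t)) * iexp (s * ln t)"
      by (simp add: powr_def z_def Ln_of_real algebra_simps flip: exp_add)
    also have "exp (complex_of_real (- (1/2) * ln t)) = of_real (t powr (-1/2))"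
      using True unfolding exp_of_real by (simp add: powr_def)
    finally show ?thesis using True by (simp add: scaleR_conv_of_real)
  qed simp
  have hm: "?h \<in> borel_measurable lborel" by measurable
  have si: "set_integrable lebesgue {0<..} ?f"
    using absolutely_integrable_Gamma_integral'[OF z] .
  then have "integrable lebesgue ?h" unfolding set_integrable_def eq .
  then show "integrable lborel ?h" using integrable_completion[OF hm] by blast
  have "(LINT t:{0<..}|lebesgue. ?f t) = Gamma z"
    using has_integral_unique[OF has_integral_set_lebesgue[OF si] Gamma_integral_complex'[OF z]] .
  then have "integral\<^sup>L lebesgue ?h = Gamma z" unfolding set_lebesgue_integral_def eq .
  then show "integral\<^sup>L lborel ?h = Gamma (1/2 + \<i> * s)"
    using integral_completion[OF hm] by (simp add: z_def)
qed

text \<open>The logarithm of a Gamma(1/2) variable has characteristic function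
  \<open>\<Gamma>(1/2 + is) / \<surd>\<pi>\<close>; by the reflection formula the difference of two independent
  copies has characteristic function \<open>1 / cosh (\<pi> s)\<close>.\<close>
lemma hyperbolic_secant_exists:
  fixes \<sigma> :: real
  obtains N where "real_distribution N" "\<And>s. char N s = of_real (1 / cosh (\<sigma> * s))"
proof -
  \<comment> \<open>The density of a Gamma(1/2) variable; \<open>sqrt pi\<close> is the value
    \<open>Gamma (1/2)\<close>.\<close>
  define D where "D t = indicator {0<..} t * (t powr (-1/2) / exp t) / sqrt pi" for t :: real
  define G where "G = density lborel (\<lambda>t. ennreal (D t))"
  have D_nonneg: "D t \<ge> 0" for t by (simp add: D_def)
  have Dm[measurable]: "D \<in> borel_measurable borel" unfolding D_def by measurable
  have D_int: "(\<integral>t. D t *\<^sub>R iexp (s * ln t) \<partial>lborel) = Gamma (1/2 + \<i> * s) / sqrt pi" for s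
  proof -
    have "(\<lambda>t. D t *\<^sub>R iexp (s * ln t)) =
      (\<lambda>t. ((indicator {0<..} t * (t powr (-1/2) / exp t)) *\<^sub>R iexp (s * ln t)) / sqrt pi)"
      by (simp add: D_def fun_eq_iff scaleR_conv_of_real)
    then show ?thesis using Gamma_line_integral(1)[of s] by simp
  qed
  have D_integrable: "integrable lborel D"
  proof -
    have "integrable lborel (\<lambda>t. Re ((indicator {0<..} t * (t powr (-1/2) / exp t)) *\<^sub>R iexp (0 * ln t)) / sqrt pi)"
      using Gamma_line_integral(2)[of 0] by (intro integrable_divide integrable_Re) 
    then show ?thesis by (simp add: D_def[abs_def])
  qed
  have "of_real (integral\<^sup>L lborel D) = (1::complex)"
    using D_int[of 0] by (simp add: Gamma_one_half_complex scaleR_conv_of_real)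
  then have "integral\<^sup>L lborel D = 1" using of_real_eq_1_iff by blast
  then have "(\<integral>\<^sup>+ t. ennreal (D t) \<partial>lborel) = 1"
    using nn_integral_eq_integral[OF D_integrable] D_nonneg by simp
  then interpret G: prob_space G
    by (intro prob_spaceI) (simp add: G_def emeasure_density)
  have sets_G[measurable_cong]: "sets G = sets borel" by (simp add: G_def)
  have G_int: "(\<integral>t. iexp (s * ln t) \<partial>G) = Gamma (1/2 + \<i> * s) / sqrt pi" for s :: real
    using D_int[of s] D_nonneg unfolding G_def by (subst integral_density) auto
  interpret P: pair_prob_space G G ..
  \<comment> \<open>Rescaling turns \<open>cosh (pi * s)\<close> into
    \<open>cosh (\<sigma> * s)\<close>; for \<open>\<sigma> = 0\<close> it produces the point mass
    at 0.\<close>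
  define c where "c = \<sigma> / pi"
  define N where "N = distr (G \<Otimes>\<^sub>M G) borel (\<lambda>p. c * ln (fst p) - c * ln (snd p))"
  have "real_distribution N" unfolding N_def by (intro P.P.real_distribution_distr) measurable
  moreover have "char N s = of_real (1 / cosh (\<sigma> * s))" for s
  proof -
    have "char N s = (\<integral>p. iexp (s * c * ln (fst p)) * iexp (- (s * c) * ln (snd p)) \<partial>(G \<Otimes>\<^sub>M G))"
      unfolding char_def N_def
      by (subst integral_distr) (auto intro!: Bochner_Integration.integral_cong simp: algebra_simps simp flip: exp_add)
    also have "\<dots> = (\<integral>t. iexp (s * c * ln t) \<partial>G) * (\<integral>t. iexp (- (s * c) * ln t) \<partial>G)"
      by (rule integral_pair_mult) (auto simp: G.prob_space_axioms)
    also have "\<dots> = Gamma (1/2 + \<i> * (s * c)) * Gamma (1/2 - \<i> * (s * c)) / pi"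
      unfolding G_int by (simp add: of_real_mult[symmetric] real_sqrt_mult_self del: of_real_mult)
    also have "\<dots> = 1 / sin (pi * (1/2 + \<i> * (s * c)))"
      using Gamma_reflection_complex[of "1/2 + \<i> * (s * c)"] by (simp add: algebra_simps)
    also have "pi * (1/2 + \<i> * (s * c)) = pi / 2 + \<i> * (\<sigma> * s)"
      by (simp add: c_def algebra_simps)
    also have "sin (of_real (pi / 2) + \<i> * (\<sigma> * s)) = cosh (of_real (\<sigma> * s))"
      by (simp add: cosh_conv_cos sin_add sin_of_real[of "pi/2", simplified] cos_of_real[of "pi/2", simplified])
    also have "cosh (complex_of_real (\<sigma> * s)) = of_real (cosh (\<sigma> * s))"
      by (simp add: cosh_field_def flip: exp_of_real)
    finally show ?thesis by simp
  qed
  ultimately show ?thesis by (rule that)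
qed

lemma continuous_additive_real:
  fixes f :: "real \<Rightarrow> real"
  assumes cont: "continuous_on UNIV f" and add: "\<And>s t. f (s + t) = f s + f t"
  shows "f t = t * f 1"
proof -
  interpret additive f by (rule additive.intro) (rule add)
  have nat_mult: "f (real n * x) = real n * f x" for n x
    by (induction n) (simp_all add: zero add distrib_right)
  have int_mult: "f (of_int k * x) = of_int k * f x" for k x
    by (cases k rule: int_cases2) (use nat_mult in \<open>simp_all add: minus\<close>)
  have rat: "f q - q * f 1 = 0" if "q \<in> \<rat>" for q
  proof -
    obtain a b where b: "b > 0" and q: "q = of_int a / of_int b" using \<open>q \<in> \<rat>\<close> by (rule Rats_cases')
    have "of_int b * f q = of_int a * f 1" using int_mult[of b q] int_mult[of a 1] b by (simp add: q)
    then show ?thesis using b by (simp add: q field_simps)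
  qed
  have "f t - t * f 1 = 0"
  proof (rule continuous_constant_on_closure[of \<rat> "\<lambda>t. f t - t * f 1"])
    show "continuous_on (closure \<rat>) (\<lambda>t. f t - t * f 1)"
      unfolding Rats_closure_real by (intro continuous_intros cont)
    show "f q - q * f 1 = 0" if "q \<in> \<rat>" for q using that by (rule rat)
    show "t \<in> closure \<rat>" by (simp only: Rats_closure_real UNIV_I)
  qed
  then show ?thesis by (simp only: right_minus_eq)
qed

text \<open>A continuous logarithm exists because the line is contractible. Its imaginary part is
  additive up to a defect in the integer multiples of \<open>2 * pi\<close>, and this defect is
  constant by connectedness.\<close>

lemma continuous_real_character:
  fixes \<psi> :: "real \<Rightarrow> complex"
  assumes cont: "continuous_on UNIV \<psi>" and add: "\<And>s t. \<psi> (s + t) = \<psi> s * \<psi> t"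
    and norm1: "\<And>t. norm (\<psi> t) = 1"
  obtains c where "\<And>t. \<psi> t = cis (c * t)"
proof -
  obtain g where g: "continuous_on UNIV g" "\<And>x. \<psi> x = exp (g x)"
    using continuous_logarithm_on_contractible[OF cont convex_imp_contractible[OF convex_UNIV]] norm1
    by (metis UNIV_I norm_zero zero_neq_one)
  define h where "h t = Im (g t)" for t
  have h_cont: "continuous_on UNIV h" unfolding h_def by (intro continuous_intros g)
  have \<psi>: "\<psi> t = cis (h t)" for t
  proof -
    have "exp (Re (g t)) = 1" using norm1[of t] g(2)[of t] by simp
    then show ?thesis using g(2)[of t] by (simp add: exp_eq_polar h_def)
  qed
  define E where "E q = h (fst q + snd q) - h (fst q) - h (snd q)" for q :: "real \<times> real"
  have int: "E q / (2 * pi) \<in> \<int>" for q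
  proof -
    have "cis (E q) = 1"
      using add[of "fst q" "snd q"] unfolding \<psi> E_def by (simp add: cis_mult flip: cis_divide)
    then have "cos (E q) = 1" by (simp add: complex_eq_iff)
    then obtain n :: int where "E q = n * 2 * pi" by (auto simp: cos_one_2pi_int)
    then show ?thesis by simp
  qed
  have "E constant_on UNIV"
  proof (rule continuous_discrete_range_constant)
    show "continuous_on UNIV E"
      unfolding E_def by (intro continuous_intros continuous_on_compose2[OF h_cont]) auto
    \<comment> \<open>Distinct values of the defect differ by at least \<open>2 * pi\<close>, so its
      range is discrete.\<close>
    have "1 \<le> norm (E q - E p)" if "E q \<noteq> E p" for p q
    proof -
      have "(E q - E p) / (2 * pi) \<in> \<int>" using Ints_diff[OF int int] by (simp add: diff_divide_distrib)
      moreover have "(E q - E p) / (2 * pi) \<noteq> 0" using that by simp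
      ultimately have "1 \<le> \<bar>(E q - E p) / (2 * pi)\<bar>" by (rule Ints_nonzero_abs_ge1)
      then have "2 * pi \<le> norm (E q - E p)" by (simp add: abs_divide field_simps)
      then show ?thesis using pi_gt3 by linarith
    qed
    then show "\<exists>e>0. \<forall>q. q \<in> UNIV \<and> E q \<noteq> E p \<longrightarrow> e \<le> norm (E q - E p)" for p
      by (intro exI[of _ 1]) simp
  qed (rule convex_connected[OF convex_UNIV])
  then obtain k where k': "\<And>q. E q = k" unfolding constant_on_def by blast
  have k: "h (s + t) - h s - h t = k" for s t using k'[of "(s, t)"] by (simp add: E_def)
  \<comment> \<open>Adding the constant defect once turns \<open>h\<close> into an additive
    function; it leaves the character unchanged because \<open>cis k = 1\<close>.\<close>
  define f where "f t = h t + k" for t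
  have f_add: "f (s + t) = f s + f t" for s t using k[of s t] by (simp add: f_def)
  have f_cont: "continuous_on UNIV f" unfolding f_def by (intro continuous_intros h_cont)
  have f_lin: "f t = t * f 1" for t by (rule continuous_additive_real[OF f_cont f_add])
  have "cis k = 1"
  proof -
    have "\<psi> 0 = 1" using add[of 0 0] norm1[of 0] by (metis add_0 mult_cancel_left1 norm_zero zero_neq_one)
    moreover have "h 0 = - k" using k[of 0 0] by simp
    ultimately show ?thesis using \<psi>[of 0] by (simp add: complex_eq_iff)
  qed
  then have "\<psi> t = cis (f 1 * t)" for t
  proof -
    have "cis (f t) = \<psi> t" using \<open>cis k = 1\<close> \<psi>[of t] by (simp add: f_def flip: cis_mult)
    then show ?thesis using f_lin[of t] by (simp only: mult.commute)
  qed
  then show ?thesis by (rule that)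
qed

section \<open>Haar measures of closed subgroups of the circle\<close>

text \<open>Division with remainder by the least positive element. The trivial subgroup is the case
  \<open>d = 0\<close>, since 0 divides only 0.\<close>

lemma int_subgroup_eq_multiples:
  fixes S :: "int set"
  assumes zero: "0 \<in> S" and add: "\<And>k l. k \<in> S \<Longrightarrow> l \<in> S \<Longrightarrow> k + l \<in> S" and minus: "\<And>k. k \<in> S \<Longrightarrow> - k \<in> S"
  obtains d :: nat where "S = {k. int d dvd k}"
proof (cases "S = {0}")
  case True
  then have "S = {k. int 0 dvd k}" by auto
  then show ?thesis by (rule that)
next
  case False
  define d where "d = (LEAST n. n > 0 \<and> int n \<in> S)"
  obtain k where k: "k \<in> S" "k \<noteq> 0" using False zero by auto
  have "nat \<bar>k\<bar> > 0 \<and> int (nat \<bar>k\<bar>) \<in> S" using k minus by (auto simp: abs_if)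
  then have d: "d > 0" "int d \<in> S" unfolding d_def by (metis (mono_tags, lifting) LeastI)+
  have least: "d \<le> n" if "n > 0" "int n \<in> S" for n unfolding d_def using that by (intro Least_le) simp
  have mult_nat: "int n * int d \<in> S" for n
    by (induction n) (simp_all add: zero add d distrib_right)
  have mult: "l * int d \<in> S" for l
    using mult_nat minus[OF mult_nat] by (cases l rule: int_cases2) simp_all
  have "int d dvd l" if "l \<in> S" for l
  proof (rule ccontr)
    assume "\<not> int d dvd l"
    then have "l mod int d \<noteq> 0" by (simp add: dvd_eq_mod_eq_0)
    moreover have "0 \<le> l mod int d" "l mod int d < int d" using d by simp_all
    moreover have "l mod int d \<in> S"
      using add[OF that mult[of "- (l div int d)"]] by (simp add: minus_div_mult_eq_mod[symmetric])
    ultimately have "nat (l mod int d) > 0" "int (nat (l mod int d)) \<in> S" "nat (l mod int d) < d"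
      by auto
    then show False using least[of "nat (l mod int d)"] by linarith
  qed
  moreover have "l \<in> S" if "int d dvd l" for l
    using mult that by (metis dvd_def mult.commute)
  ultimately have "S = {k. int d dvd k}" by blast
  then show ?thesis by (rule that)
qed

text \<open>With \<open>S\<close> the multiples of \<open>d\<close>, the measure is the Haar
  distribution of the annihilator of \<open>S\<close> in the circle: the uniform law on the
  \<open>d\<close>-th roots of unity, or on the whole circle when \<open>d = 0\<close>.\<close>

lemma circle_dual_measure:
  fixes S :: "int set"
  assumes "0 \<in> S" "\<And>k l. k \<in> S \<Longrightarrow> l \<in> S \<Longrightarrow> k + l \<in> S" "\<And>k. k \<in> S \<Longrightarrow> - k \<in> S"
  obtains \<nu> :: "complex measure" where "prob_space \<nu>" "sets \<nu> = sets borel" "AE z in \<nu>. norm z = 1"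
    "\<And>k::nat. integral\<^sup>L \<nu> (\<lambda>z. z ^ k) = (if int k \<in> S then 1 else 0)"
proof -
  obtain d where S: "S = {k. int d dvd k}"
    using int_subgroup_eq_multiples[OF assms] by blast
  show ?thesis
  proof (cases "d = 0")
    case True
    define U where "U = density lborel (\<lambda>t. ennreal (indicator {0..1::real} t))"
    interpret U: prob_space U
      by (intro prob_spaceI) (simp add: U_def emeasure_density ennreal_indicator)
    have [measurable_cong]: "sets U = sets borel" by (simp add: U_def)
    define e where "e t = cis (2 * pi * t)" for t
    have [measurable]: "e \<in> borel_measurable borel"
      unfolding e_def by (intro borel_measurable_continuous_onI continuous_intros)
    have int: "integral\<^sup>L (distr U borel e) (\<lambda>z. z ^ k) = (if int k \<in> S then 1 else 0)" for k
    proof (cases "k = 0")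
      case True
      have "prob_space (distr U borel e)" by (rule U.prob_space_distr) measurable
      from prob_space.prob_space[OF this] show ?thesis using True by (simp add: assms)
    next
      case False
      define C where "C = of_real (2 * pi * k) * \<i>"
      have C: "C \<noteq> 0" using False by (simp add: C_def)
      have e_pow: "e t ^ k = exp (C * of_real t)" for t
      proof -
        have "e t ^ k = cis (real k * (2 * pi * t))" unfolding e_def by (rule Complex.DeMoivre)
        then show ?thesis by (simp add: cis_conv_exp C_def algebra_simps)
      qed
      \<comment> \<open>An antiderivative of \<open>exp (C * t)\<close>. Its values at 0 and 1 agree
        because \<open>exp C\<close> is the \<open>k\<close>-th power of
        \<open>e 1 = 1\<close>.\<close>
      define F where "F z = exp (C * z) / C" for z
      have "((\<lambda>t. e t ^ k) has_integral (F (of_real 1) - F (of_real 0))) {0..1}"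
        unfolding e_pow
      proof (rule fundamental_theorem_of_calculus)
        show "((\<lambda>t. F (of_real t)) has_vector_derivative exp (C * of_real t)) (at t within {0..1})" for t
          unfolding F_def using C
          by (intro has_vector_derivative_real_field) (auto intro!: derivative_eq_intros)
      qed simp
      moreover have "F 1 = F 0"
        using e_pow[of 1] by (simp add: F_def e_def)
      ultimately have hi: "((\<lambda>t. e t ^ k) has_integral 0) {0..1}" by simp
      have "set_integrable lborel {0..1} (\<lambda>t. e t ^ k)"
        unfolding e_def by (intro borel_integrable_atLeastAtMost' continuous_intros)
      from set_borel_integral_eq_integral(2)[OF this] have "(LINT t:{0..1}|lborel. e t ^ k) = 0"
        using hi by (simp add: integral_unique)
      then have "integral\<^sup>L U (\<lambda>t. e t ^ k) = 0"
        unfolding U_def by (subst integral_density) (simp_all add: set_lebesgue_integral_def)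
      then show ?thesis using False \<open>d = 0\<close> by (simp add: S integral_distr)
    qed
    show ?thesis
    proof (rule that[OF _ _ _ int])
      show "AE z in distr U borel e. norm z = 1" by (subst AE_distr_iff) (auto simp: e_def)
    qed (auto intro!: U.prob_space_distr)
  next
    case False
    then have d: "d > 0" by simp
    define U where "U = measure_pmf (pmf_of_set {..<d})"
    interpret U: prob_space U unfolding U_def by (rule measure_pmf.prob_space_axioms)
    define e where "e j = cis (2 * pi * real j / real d)" for j :: nat
    have em[measurable]: "e \<in> borel_measurable U" by (simp add: U_def)
    have int: "integral\<^sup>L (distr U borel e) (\<lambda>z. z ^ k) = (if int k \<in> S then 1 else 0)" for k
    proof -
      define w where "w = cis (2 * pi * real k / real d)"
      have "integral\<^sup>L (distr U borel e) (\<lambda>z. z ^ k) = integral\<^sup>L U (\<lambda>j. e j ^ k)"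
        by (subst integral_distr) auto
      also have "\<dots> = (\<Sum>j<d. e j ^ k) / d"
        unfolding U_def using d
        by (subst integral_measure_pmf[of "{..<d}"])
          (auto simp: lessThan_empty_iff scaleR_conv_of_real sum_divide_distrib)
      \<comment> \<open>Exchanging the roles of \<open>j\<close> and \<open>k\<close> makes this a
        geometric sum with ratio \<open>w\<close>, where \<open>w ^ d = 1\<close> and
        \<open>w = 1\<close> exactly when \<open>d\<close> divides \<open>k\<close>.\<close>
      also have "(\<Sum>j<d. e j ^ k) = (\<Sum>j<d. w ^ j)"
        by (simp add: e_def w_def Complex.DeMoivre mult.commute mult.left_commute)
      also have "\<dots> = (if int d dvd int k then d else 0)"
      proof (cases "int d dvd int k")
        case True
        then obtain q where "k = d * q" by auto
        then have "w = 1" using d cis_multiple_2pi[of "real q"] by (simp add: w_def mult.assoc)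
        then show ?thesis using True by simp
      next
        case nd: False
        have "w \<noteq> 1"
        proof
          assume "w = 1"
          then have "cos (2 * pi * real k / real d) = 1" by (simp add: w_def complex_eq_iff)
          then obtain n :: int where "2 * pi * real k / real d = of_int n * 2 * pi"
            by (auto simp: cos_one_2pi_int)
          then have "real k = of_int n * real d" using d by (simp add: field_simps)
          then have "int k = n * int d" by (metis of_int_eq_iff of_int_mult of_int_of_nat_eq)
          then show False using nd by simp
        qed
        moreover have "w ^ d = 1" using d cis_multiple_2pi[of "real k"] by (simp add: w_def Complex.DeMoivre mult.assoc)
        ultimately show ?thesis using nd by (simp add: geometric_sum)
      qed
      finally show ?thesis using d by (simp add: S)
    qed
    show ?thesis
    proof (rule that[OF _ _ _ int])
      show "AE z in distr U borel e. norm z = 1" by (subst AE_distr_iff) (auto simp: e_def)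
    qed (auto intro!: U.prob_space_distr)
  qed
qed

section \<open>The group of adic integers\<close>

definition adic_mod :: "(nat \<Rightarrow> nat) \<Rightarrow> nat \<Rightarrow> nat" where
  "adic_mod a n = (\<Prod>i<n. a i)"

text \<open>The adic integers form the inverse limit of the rings of integers modulo
  \<open>adic_mod a n\<close>; this is the representative of the \<open>n\<close>-th residue, the
  mixed radix number written by the first \<open>n\<close> digits.\<close>

definition adic_val :: "(nat \<Rightarrow> nat) \<Rightarrow> (nat \<Rightarrow> nat) \<Rightarrow> nat \<Rightarrow> nat" where
  "adic_val a x n = (\<Sum>i<n. x i * adic_mod a i)"

locale adic_seq =
  fixes a :: "nat \<Rightarrow> nat"
  assumes a_gt1: "a j > 1"
begin

abbreviation P where "P \<equiv> adic_mod a"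
abbreviation val where "val \<equiv> adic_val a"

lemma a_pos: "a j > 0" using a_gt1[of j] by simp

lemma P_0 [simp]: "P 0 = 1" and P_Suc: "P (Suc n) = P n * a n"
  by (simp_all add: adic_mod_def)

lemma P_pos [simp]: "P n > 0"
  using a_pos by (simp add: adic_mod_def prod_pos)

lemma P_dvd: "m \<le> n \<Longrightarrow> P m dvd P n"
  by (induction n rule: dec_induct) (auto simp: P_Suc)

lemma P_ge: "P n > n"
proof (induction n)
  case (Suc n)
  have "Suc n \<le> P n * 1" using Suc by simp
  also have "\<dots> < P n * a n" using a_gt1[of n] by (intro mult_strict_left_mono) auto
  finally show ?case by (simp add: P_Suc)
qed simp

lemma val_0 [simp]: "val x 0 = 0" and val_Suc: "val x (Suc n) = val x n + x n * P n"
  by (simp_all add: adic_val_def)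

lemma val_less:
  assumes "x \<in> adic a"
  shows "val x n < P n"
proof (induction n)
  case (Suc n)
  have "val x (Suc n) < P n + x n * P n" using Suc by (simp add: val_Suc)
  also have "\<dots> = Suc (x n) * P n" by simp
  also have "\<dots> \<le> a n * P n" using assms by (intro mult_right_mono) (auto simp: adic_def Suc_le_eq)
  finally show ?case by (simp add: P_Suc mult.commute)
qed simp

lemma adic_add_closed [simp]: "adic_add a x y \<in> adic a"
  using a_pos by (simp add: adic_def adic_add_def)

lemma val_add: "val (adic_add a x y) n + P n * adic_carry a x y n = val x n + val y n"
proof (induction n)
  case (Suc n)
  define s where "s = x n + y n + adic_carry a x y n"
  define q r where "q = s div a n" and "r = s mod a n"
  have qr: "r + a n * q = s" by (simp add: q_def r_def)
  have "adic_add a x y n = r" "adic_carry a x y (Suc n) = q"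
    by (simp_all add: adic_add_def s_def q_def r_def)
  then have "val (adic_add a x y) (Suc n) + P (Suc n) * adic_carry a x y (Suc n)
      = val (adic_add a x y) n + P n * (r + a n * q)"
    by (simp only: val_Suc P_Suc) (simp add: algebra_simps)
  also have "\<dots> = val (adic_add a x y) n + P n * s" by (simp only: qr)
  also have "\<dots> = val x (Suc n) + val y (Suc n)" using Suc by (simp add: val_Suc s_def algebra_simps)
  finally show ?case .
qed simp

lemma val_add_cong: "[int (val (adic_add a x y) n) = int (val x n) + int (val y n)] (mod int (P n))"
proof -
  have "int (val (adic_add a x y) n) = int (val x n) + int (val y n) + int (P n) * (- int (adic_carry a x y n))"
    using arg_cong[OF val_add[of x y n], of int] by simp
  then show ?thesis unfolding cong_def by (simp only: mod_mult_self2)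
qed

lemma val_cong_Suc: "[int (val x (Suc n)) = int (val x n)] (mod int (P n))"
  by (simp add: val_Suc cong_def)

text \<open>Truncations are smaller than the modulus, so congruent ones are equal, and two
  consecutive truncations give back the digit between them.\<close>

lemma adic_eqI:
  assumes "x \<in> adic a" "y \<in> adic a" "\<And>n. [int (val x n) = int (val y n)] (mod int (P n))"
  shows "x = y"
proof -
  have eq: "val x n = val y n" for n
    using assms(3)[of n] val_less[OF assms(1), of n] val_less[OF assms(2), of n]
    by (simp add: cong_def)
  show ?thesis
  proof
    fix n
    have "x n * P n = y n * P n" using eq[of n] eq[of "Suc n"] by (simp add: val_Suc)
    then show "x n = y n" using P_pos[of n] by simp
  qed
qed

text \<open>Completeness of the inverse limit: new adic integers are produced by prescribing their
  residues instead of their digits.\<close>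

lemma adic_exists:
  fixes c :: "nat \<Rightarrow> int"
  assumes c: "\<And>n. [c (Suc n) = c n] (mod int (P n))"
  obtains x where "x \<in> adic a" "\<And>n. [int (val x n) = c n] (mod int (P n))"
proof -
  \<comment> \<open>The leading mixed radix digit of the residue of \<open>c (Suc n)\<close>; the
    lower digits already encode \<open>c n\<close> by compatibility.\<close>
  define x where "x n = nat ((c (Suc n) mod int (P (Suc n))) div int (P n))" for n
  have nonneg: "(c (Suc n) mod int (P (Suc n))) div int (P n) \<ge> 0" for n
    using P_pos[of n] P_pos[of "Suc n"] by (intro pos_imp_zdiv_nonneg_iff[THEN iffD2]) auto
  have val: "int (val x n) = c n mod int (P n)" for n
  proof (induction n)
    case (Suc n)
    have "c (Suc n) mod int (P (Suc n)) mod int (P n) = c n mod int (P n)"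
      using c[of n] by (simp add: P_Suc mod_mod_cancel cong_def)
    moreover have "int (x n) = (c (Suc n) mod int (P (Suc n))) div int (P n)"
      using nonneg[of n] by (simp add: x_def)
    ultimately have "int (val x (Suc n)) = (c (Suc n) mod int (P (Suc n))) mod int (P n)
        + (c (Suc n) mod int (P (Suc n))) div int (P n) * int (P n)"
      using Suc by (simp add: val_Suc)
    then show ?case by simp
  qed simp
  have "x n < a n" for n
  proof -
    have "c (Suc n) mod int (P (Suc n)) < int (P n) * int (a n)"
      using P_pos[of "Suc n"] unfolding of_nat_mult[symmetric] P_Suc[symmetric] by (intro pos_mod_bound) simp
    moreover have "int (P n) * ((c (Suc n) mod int (P (Suc n))) div int (P n)) \<le> c (Suc n) mod int (P (Suc n))"
      by (simp add: minus_mod_eq_mult_div[symmetric])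
    ultimately have "(c (Suc n) mod int (P (Suc n))) div int (P n) < int (a n)"
      using P_pos[of n] by (smt (verit) mult_less_cancel_left_pos of_nat_0_less_iff)
    then show ?thesis using nonneg[of n] by (simp add: x_def)
  qed
  then have "x \<in> adic a" by (simp add: adic_def)
  then show ?thesis by (rule that) (simp add: val cong_def)
qed

lemma adic_zero_closed [simp]: "adic_zero \<in> adic a" and val_zero [simp]: "val adic_zero n = 0"
  using a_pos by (simp_all add: adic_def adic_zero_def adic_val_def)

text \<open>The definite description in \<open>adic_neg\<close> needs a unique witness: the negated
  residues are compatible, which gives existence, and residues determine an adic integer, which
  gives uniqueness.\<close>

lemma adic_neg:
  assumes x: "x \<in> adic a"
  shows adic_neg_closed: "adic_neg a x \<in> adic a"
    and val_neg_cong: "[int (val (adic_neg a x) n) = - int (val x n)] (mod int (P n))"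
proof -
  obtain y where y: "y \<in> adic a" "\<And>n. [int (val y n) = - int (val x n)] (mod int (P n))"
    using adic_exists[of "\<lambda>n. - int (val x n)"] val_cong_Suc by (metis cong_minus_minus_iff)
  have sum: "[int (val (adic_add a x w) n) = 0] (mod int (P n)) \<longleftrightarrow> [int (val w n) = - int (val x n)] (mod int (P n))" for w n
  proof -
    have "[int (val (adic_add a x w) n) = 0] (mod int (P n)) \<longleftrightarrow> [int (val x n) + int (val w n) = 0] (mod int (P n))"
      using val_add_cong[of x w n] cong_sym cong_trans by blast
    then show ?thesis by (simp add: cong_iff_dvd_diff add.commute)
  qed
  have "(THE y. y \<in> adic a \<and> adic_add a x y = adic_zero) = y"
  proof (rule the_equality)
    show "y \<in> adic a \<and> adic_add a x y = adic_zero"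
      using y sum by (auto intro!: adic_eqI)
    fix w assume w: "w \<in> adic a \<and> adic_add a x w = adic_zero"
    have "[int (val w n) = int (val y n)] (mod int (P n))" for n
    proof -
      have "[int (val w n) = - int (val x n)] (mod int (P n))"
        using sum[of w n] w by simp
      then show ?thesis using y(2)[of n] by (simp add: cong_def)
    qed
    then show "w = y" using w y by (intro adic_eqI) auto
  qed
  then have "adic_neg a x = y" by (simp add: adic_neg_def)
  then show "adic_neg a x \<in> adic a" "[int (val (adic_neg a x) n) = - int (val x n)] (mod int (P n))"
    using y by auto
qed

lemma val_u_cong: "[int (val adic_u n) = 1] (mod int (P n))"
proof (cases n)
  case (Suc m)
  have "val adic_u (Suc m) = 1" for m
    by (induction m) (simp_all add: val_Suc adic_u_def)
  then show ?thesis using Suc by simp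
qed simp

lemma adic_nat_mult:
  shows "(adic_add a adic_u ^^ k) adic_zero \<in> adic a"
    and "[int (val ((adic_add a adic_u ^^ k) adic_zero) n) = int k] (mod int (P n))"
proof -
  show "(adic_add a adic_u ^^ k) adic_zero \<in> adic a" by (cases k) auto
  show "[int (val ((adic_add a adic_u ^^ k) adic_zero) n) = int k] (mod int (P n))"
  proof (induction k)
    case (Suc k)
    have "[int (val ((adic_add a adic_u ^^ Suc k) adic_zero) n) =
        int (val adic_u n) + int (val ((adic_add a adic_u ^^ k) adic_zero) n)] (mod int (P n))"
      using val_add_cong by simp
    also have "[int (val adic_u n) + int (val ((adic_add a adic_u ^^ k) adic_zero) n) = 1 + int k] (mod int (P n))"
      by (rule cong_add[OF val_u_cong Suc])
    finally show ?case by simp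
  qed simp
qed

lemma adic_int:
  shows adic_int_closed: "adic_int a k \<in> adic a"
    and val_int_cong: "[int (val (adic_int a k) n) = k] (mod int (P n))"
proof -
  show "adic_int a k \<in> adic a"
    using adic_nat_mult(1) adic_neg_closed by (simp add: adic_int_def)
  show "[int (val (adic_int a k) n) = k] (mod int (P n))"
  proof (cases "k \<ge> 0")
    case True
    then show ?thesis using adic_nat_mult(2)[of "nat k" n] by (simp add: adic_int_def)
  next
    case False
    let ?y = "(adic_add a adic_u ^^ nat (- k)) adic_zero"
    have "[int (val (adic_neg a ?y) n) = - int (val ?y n)] (mod int (P n))"
      by (rule val_neg_cong[OF adic_nat_mult(1)])
    also have "[- int (val ?y n) = - int (nat (- k))] (mod int (P n))"
      using adic_nat_mult(2) by (simp only: cong_minus_minus_iff)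
    finally show ?thesis using False by (simp add: adic_int_def)
  qed
qed

end

section \<open>Coordinates on the solenoid\<close>

text \<open>The character \<open>(t, x) \<mapsto> exp (2 pi i (t - x) / P n)\<close> of the product
  group. The minus sign makes it trivial on the subgroup of all \<open>(k, k u)\<close>, because the
  \<open>n\<close>-th residue of \<open>k u\<close> is \<open>k\<close>.\<close>

definition adic_exp :: "(nat \<Rightarrow> nat) \<Rightarrow> real \<times> (nat \<Rightarrow> nat) \<Rightarrow> nat \<Rightarrow> complex" where
  "adic_exp a p n = cis (2 * pi * ((fst p - real (adic_val a (snd p) n)) / real (adic_mod a n)))"

text \<open>The characters above descend to the quotient, so the chosen representative does not
  matter (\<open>coord_class\<close>). Over all \<open>n\<close> they embed the solenoid into an
  inverse limit of circles.\<close>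

definition sol_coord :: "(nat \<Rightarrow> nat) \<Rightarrow> sol \<Rightarrow> nat \<Rightarrow> complex" where
  "sol_coord a X = adic_exp a (SOME p. p \<in> X)"

lemma cis_2pi_eq_iff: "cis (2 * pi * x) = cis (2 * pi * y) \<longleftrightarrow> x - y \<in> \<int>"
proof -
  have "cis (2 * pi * x) = cis (2 * pi * y) \<longleftrightarrow> cis (2 * pi * x) / cis (2 * pi * y) = 1"
    by simp
  also have "\<dots> \<longleftrightarrow> cis (2 * pi * (x - y)) = 1"
    by (simp add: cis_divide right_diff_distrib)
  also have "\<dots> \<longleftrightarrow> cos (2 * pi * (x - y)) = 1"
  proof
    assume "cos (2 * pi * (x - y)) = 1"
    moreover from this have "sin (2 * pi * (x - y)) = 0"
      using sin_cos_squared_add[of "2 * pi * (x - y)"] by simp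
    ultimately show "cis (2 * pi * (x - y)) = 1" by (simp add: complex_eq_iff)
  qed (simp add: complex_eq_iff)
  also have "\<dots> \<longleftrightarrow> (\<exists>n::int. x - y = n)"
    unfolding cos_one_2pi_int by (simp add: mult.commute[of _ "2 * pi"] flip: mult.assoc)
  also have "\<dots> \<longleftrightarrow> x - y \<in> \<int>" by (auto simp: Ints_def)
  finally show ?thesis .
qed

context adic_seq
begin

abbreviation e where "e \<equiv> adic_exp a"
abbreviation \<Phi> where "\<Phi> \<equiv> sol_coord a"

lemma e_eq_iff: "e p n = e q n \<longleftrightarrow>
    (fst p - real (val (snd p) n)) / real (P n) - (fst q - real (val (snd q) n)) / real (P n) \<in> \<int>"
  unfolding adic_exp_def by (rule cis_2pi_eq_iff)

lemma div_P_Ints_iff: "real_of_int k / real (P n) \<in> \<int> \<longleftrightarrow> int (P n) dvd k"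
  using of_int_div_of_int_in_Ints_iff[of k "int (P n)", where 'a=real] P_pos[of n] by simp

lemma e_shift_iff:
  "e (s + of_int k, x) n = e (s, y) n \<longleftrightarrow> [k = int (val x n) - int (val y n)] (mod int (P n))"
proof -
  have "e (s + of_int k, x) n = e (s, y) n \<longleftrightarrow>
      of_int (k - (int (val x n) - int (val y n))) / real (P n) \<in> \<int>"
    unfolding e_eq_iff by (simp add: diff_divide_distrib[symmetric] algebra_simps)
  also have "\<dots> \<longleftrightarrow> int (P n) dvd k - (int (val x n) - int (val y n))"
    by (simp only: div_P_Ints_iff)
  finally show ?thesis by (simp add: cong_iff_dvd_diff)
qed

text \<open>Coordinate 0 has modulus 1 and no digits, so it forces \<open>t - s\<close> to be an
  integer \<open>k\<close>. The remaining coordinates then say that \<open>x\<close> and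
  \<open>y + k u\<close> have the same residues.\<close>

lemma e_eq_imp_rel:
  assumes "x \<in> adic a" "y \<in> adic a" "e (t, x) = e (s, y)"
  shows "((t, x), (s, y)) \<in> sol_rel a"
proof -
  have "t - s \<in> \<int>" using fun_cong[OF assms(3), of 0] by (simp add: e_eq_iff)
  then obtain k where "t - s = of_int k" by (auto elim: Ints_cases)
  then have t: "t = s + of_int k" by simp
  have "x = adic_add a y (adic_int a k)"
  proof (rule adic_eqI)
    fix n
    have "[k = int (val x n) - int (val y n)] (mod int (P n))"
      using fun_cong[OF assms(3), of n] unfolding t e_shift_iff .
    moreover have "[int (val (adic_add a y (adic_int a k)) n) = int (val y n) + k] (mod int (P n))"
      using cong_trans[OF val_add_cong cong_add[OF cong_refl val_int_cong]] .
    ultimately have "[int (val (adic_add a y (adic_int a k)) n) = int (val y n) + (int (val x n) - int (val y n))] (mod int (P n))"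
      using cong_trans cong_add[OF cong_refl] by blast
    then show "[int (val x n) = int (val (adic_add a y (adic_int a k)) n)] (mod int (P n))"
      by (simp add: cong_sym_eq)
  qed (use assms in auto)
  then show ?thesis using t assms by (auto simp: sol_rel_def)
qed

lemma sol_rel_iff:
  assumes "p \<in> UNIV \<times> adic a" "q \<in> UNIV \<times> adic a"
  shows "(p, q) \<in> sol_rel a \<longleftrightarrow> e p = e q"
proof (cases p; cases q)
  fix t x s y assume pq: "p = (t, x)" "q = (s, y)"
  show ?thesis
  proof
    assume "(p, q) \<in> sol_rel a"
    then obtain k :: int where k: "t = s + of_int k" "x = adic_add a y (adic_int a k)"
      by (auto simp: sol_rel_def pq)
    show "e p = e q"
    proof
      fix n
      have "[int (val x n) = int (val y n) + k] (mod int (P n))"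
        unfolding k using cong_trans[OF val_add_cong cong_add[OF cong_refl val_int_cong]] .
      then have "[k = int (val x n) - int (val y n)] (mod int (P n))"
        by (simp add: cong_iff_dvd_diff) (simp add: dvd_diff_commute algebra_simps)
      then show "e p n = e q n" by (simp add: pq k(1) e_shift_iff)
    qed
  qed (use assms e_eq_imp_rel pq in auto)
qed

text \<open>Written as the kernel of the map \<open>e\<close>, the relation is visibly an
  equivalence, and its classes are the fibres of \<open>e\<close>.\<close>

lemma sol_rel_alt: "sol_rel a = {(p, q). p \<in> UNIV \<times> adic a \<and> q \<in> UNIV \<times> adic a \<and> e p = e q}"
proof -
  have "(p, q) \<in> sol_rel a \<Longrightarrow> p \<in> UNIV \<times> adic a \<and> q \<in> UNIV \<times> adic a" for p q
    by (auto simp: sol_rel_def)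
  then show ?thesis using sol_rel_iff by blast
qed

lemma sol_class_alt:
  "p \<in> UNIV \<times> adic a \<Longrightarrow> sol_class a p = {q \<in> UNIV \<times> adic a. e q = e p}"
  by (auto simp: sol_class_def sol_rel_alt)

lemma sol_class_eq_iff:
  "p \<in> UNIV \<times> adic a \<Longrightarrow> q \<in> UNIV \<times> adic a \<Longrightarrow> sol_class a p = sol_class a q \<longleftrightarrow> e p = e q"
  by (auto simp: sol_class_alt)

lemma sol_class_in [simp]: "p \<in> UNIV \<times> adic a \<Longrightarrow> sol_class a p \<in> solenoid a"
  by (auto simp: solenoid_def sol_class_def quotient_def)

lemma solenoidE:
  assumes "X \<in> solenoid a"
  obtains p where "p \<in> UNIV \<times> adic a" "X = sol_class a p"
  using assms by (auto simp: solenoid_def sol_class_def quotient_def)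

lemma coord_class [simp]:
  assumes "p \<in> UNIV \<times> adic a"
  shows "\<Phi> (sol_class a p) = e p"
proof -
  have "(SOME q. q \<in> sol_class a p) \<in> sol_class a p"
    using assms by (intro someI[of "\<lambda>q. q \<in> sol_class a p" p]) (simp add: sol_class_alt)
  then show ?thesis using assms by (simp add: sol_class_alt sol_coord_def)
qed

lemma coord_inj: "X \<in> solenoid a \<Longrightarrow> Y \<in> solenoid a \<Longrightarrow> \<Phi> X = \<Phi> Y \<Longrightarrow> X = Y"
  by (elim solenoidE) (simp add: sol_class_eq_iff)

lemma coord_iff_mem:
  assumes "X \<in> solenoid a"
  shows "p \<in> X \<longleftrightarrow> p \<in> UNIV \<times> adic a \<and> e p = \<Phi> X"
proof -
  obtain q where q: "q \<in> UNIV \<times> adic a" "X = sol_class a q" using assms by (rule solenoidE)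
  show ?thesis using coord_class[OF q(1)] sol_class_alt[OF q(1)] by (simp add: q(2))
qed

lemma norm_coord [simp]: "X \<in> solenoid a \<Longrightarrow> norm (\<Phi> X n) = 1"
  by (elim solenoidE) (simp add: adic_exp_def)

lemma coord_nonzero [simp]: "X \<in> solenoid a \<Longrightarrow> \<Phi> X n \<noteq> 0"
  using norm_coord[of X n] by (metis norm_zero zero_neq_one)

text \<open>The power cancels the factor \<open>a n\<close> of \<open>P (Suc n)\<close>. Digit
  \<open>n\<close> then contributes \<open>x n * P n / P n\<close>, an integer, which
  \<open>cis\<close> ignores.\<close>

lemma e_Suc_power: "e p (Suc n) ^ a n = e p n"
proof -
  obtain t x where p: "p = (t, x)" by (cases p)
  have "e p (Suc n) ^ a n = cis (2 * pi * ((t - real (val x (Suc n))) / real (P n)))"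
  proof -
    have "real (a n) * (2 * pi * ((t - real (val x (Suc n))) / real (P (Suc n)))) =
        2 * pi * ((t - real (val x (Suc n))) / real (P n))"
      using a_pos[of n] by (simp add: P_Suc)
    then show ?thesis by (simp add: p adic_exp_def Complex.DeMoivre)
  qed
  also have "\<dots> = e p n"
    unfolding adic_exp_def p cis_2pi_eq_iff
    using P_pos[of n] by (simp add: val_Suc diff_divide_distrib add_divide_distrib)
  finally show ?thesis .
qed

text \<open>The inverse limit of circles under the maps \<open>z ^ a n\<close>, the second standard
  model of the solenoid; \<open>coord_in_sys\<close> and \<open>sys_is_coord\<close> identify it
  with the range of \<open>\<Phi>\<close>.\<close>

definition circle_sys :: "(nat \<Rightarrow> complex) set" where
  "circle_sys = {z. \<forall>n. norm (z n) = 1 \<and> z (Suc n) ^ a n = z n}"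

lemma coord_in_sys: "X \<in> solenoid a \<Longrightarrow> \<Phi> X \<in> circle_sys"
  using e_Suc_power by (elim solenoidE) (simp add: circle_sys_def adic_exp_def)

lemma sys_power:
  assumes "z \<in> circle_sys" "m \<le> n"
  shows "z n ^ (P n div P m) = z m"
  using assms(2)
proof (induction n rule: dec_induct)
  case base
  then show ?case by simp
next
  case (step n)
  have "P (Suc n) div P m = a n * (P n div P m)"
    using P_dvd[OF step(1)] by (simp add: P_Suc div_mult_swap mult.commute)
  then have "z (Suc n) ^ (P (Suc n) div P m) = (z (Suc n) ^ a n) ^ (P n div P m)"
    by (simp add: power_mult)
  then show ?case using assms(1) step by (simp add: circle_sys_def)
qed

text \<open>The real component is an angle \<open>r 0\<close> of the zeroth coordinate. The angles
  of the others differ from \<open>r 0 / P n\<close> by integers over \<open>P n\<close>, and these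
  integers are compatible residues of the adic component.\<close>

lemma sys_is_coord:
  assumes z: "z \<in> circle_sys"
  obtains X where "X \<in> solenoid a" "\<Phi> X = z"
proof -
  have z_cis: "\<exists>r. z n = cis (2 * pi * r)" for n
  proof -
    have "norm (z n) = 1" using z by (simp add: circle_sys_def)
    then have "z n = cis (Arg (z n))" using rcis_cmod_Arg[of "z n"] by (simp add: rcis_def)
    then have "z n = cis (2 * pi * (Arg (z n) / (2 * pi)))" by simp
    then show ?thesis ..
  qed
  then obtain r where r: "\<And>n. z n = cis (2 * pi * r n)" by metis
  \<comment> \<open>From \<open>z n ^ P n = z 0\<close>. The integer found here is what the residue
    of the adic component must be at level \<open>n\<close>.\<close>
  have "\<exists>c::int. r 0 - r n * real (P n) = of_int c" for n
  proof -
    have "z n ^ P n = z 0" using sys_power[OF z, of 0 n] by simp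
    then have "cis (2 * pi * r 0) = cis (2 * pi * (r n * P n))"
      by (simp add: r Complex.DeMoivre algebra_simps)
    then show ?thesis unfolding cis_2pi_eq_iff by (auto elim: Ints_cases)
  qed
  then obtain c :: "nat \<Rightarrow> int" where c: "\<And>n. r 0 - r n * real (P n) = of_int (c n)" by metis
  have zc: "z n = cis (2 * pi * ((r 0 - of_int (c n)) / real (P n)))" for n
    using c[of n] P_pos[of n] by (simp add: r field_simps)
  have "[c (Suc n) = c n] (mod int (P n))" for n
  proof -
    have "cis (2 * pi * ((r 0 - of_int (c (Suc n))) / real (P (Suc n)))) ^ a n =
        cis (2 * pi * ((r 0 - of_int (c n)) / real (P n)))"
      using z unfolding zc[symmetric] by (simp add: circle_sys_def)
    then have "cis (2 * pi * ((r 0 - of_int (c (Suc n))) / real (P n))) =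
        cis (2 * pi * ((r 0 - of_int (c n)) / real (P n)))"
      using a_pos[of n] by (simp add: Complex.DeMoivre P_Suc)
    then have "of_int (c n - c (Suc n)) / real (P n) \<in> \<int>"
      unfolding cis_2pi_eq_iff by (simp add: diff_divide_distrib[symmetric])
    then have "int (P n) dvd c n - c (Suc n)"
      by (simp only: div_P_Ints_iff)
    then show ?thesis by (simp add: cong_iff_dvd_diff dvd_diff_commute)
  qed
  then obtain x where x: "x \<in> adic a" "\<And>n. [int (val x n) = c n] (mod int (P n))"
    using adic_exists by blast
  have "e (r 0, x) = z"
  proof
    fix n
    have "int (P n) dvd c n - int (val x n)" using x(2)[of n] by (simp add: cong_iff_dvd_diff dvd_diff_commute)
    then have "of_int (c n - int (val x n)) / real (P n) \<in> \<int>"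
      by (simp only: div_P_Ints_iff)
    then show "e (r 0, x) n = z n"
      unfolding zc adic_exp_def cis_2pi_eq_iff by (simp add: diff_divide_distrib[symmetric])
  qed
  then show ?thesis using x by (intro that[of "sol_class a (r 0, x)"]) auto
qed

lemma e_add: "e (t + s, adic_add a x y) n = e (t, x) n * e (s, y) n"
proof -
  have "int (P n) dvd int (val x n) + int (val y n) - int (val (adic_add a x y) n)"
    using val_add_cong[of x y n] by (simp add: cong_iff_dvd_diff dvd_diff_commute)
  then have "of_int (int (val x n) + int (val y n) - int (val (adic_add a x y) n)) / real (P n) \<in> \<int>"
    by (simp only: div_P_Ints_iff)
  then have "cis (2 * pi * ((t + s - real (val (adic_add a x y) n)) / real (P n))) =
      cis (2 * pi * ((t - real (val x n)) / real (P n) + (s - real (val y n)) / real (P n)))"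
    unfolding cis_2pi_eq_iff by (simp add: diff_divide_distrib add_divide_distrib algebra_simps)
  then show ?thesis by (simp add: adic_exp_def cis_mult distrib_left)
qed

lemma e_neg:
  assumes "x \<in> adic a"
  shows "e (- t, adic_neg a x) n = cnj (e (t, x) n)"
proof -
  have "int (P n) dvd - int (val x n) - int (val (adic_neg a x) n)"
    using val_neg_cong[OF assms, of n] by (simp only: cong_iff_dvd_diff dvd_diff_commute)
  then have "of_int (- int (val x n) - int (val (adic_neg a x) n)) / real (P n) \<in> \<int>"
    by (simp only: div_P_Ints_iff)
  moreover have "(- t - real (val (adic_neg a x) n)) / real (P n) - - ((t - real (val x n)) / real (P n))
      = of_int (- int (val x n) - int (val (adic_neg a x) n)) / real (P n)"
    using P_pos[of n] by (simp add: field_simps)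
  ultimately have "cis (2 * pi * ((- t - real (val (adic_neg a x) n)) / real (P n))) =
      cis (2 * pi * (- ((t - real (val x n)) / real (P n))))"
    unfolding cis_2pi_eq_iff by metis
  then show ?thesis by (simp add: adic_exp_def cis_cnj)
qed

text \<open>\<open>sol_add\<close> is a union over all pairs of representatives. Multiplicativity of
  \<open>e\<close> shows that every pair yields the same class, so the union is that class.\<close>

lemma sol_add_class:
  assumes "p \<in> UNIV \<times> adic a" "q \<in> UNIV \<times> adic a"
  shows "sol_add a (sol_class a p) (sol_class a q) = sol_class a (fst p + fst q, adic_add a (snd p) (snd q))"
proof -
  have "sol_class a (fst p' + fst q', adic_add a (snd p') (snd q')) =
      sol_class a (fst p + fst q, adic_add a (snd p) (snd q))"
    if "p' \<in> sol_class a p" "q' \<in> sol_class a q" for p' q'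
    using that assms by (subst sol_class_eq_iff) (auto simp: sol_class_alt fun_eq_iff e_add)
  moreover have "p \<in> sol_class a p" "q \<in> sol_class a q" using assms by (auto simp: sol_class_alt)
  ultimately show ?thesis unfolding sol_add_def by blast
qed

lemma sol_neg_class:
  assumes "p \<in> UNIV \<times> adic a"
  shows "sol_neg a (sol_class a p) = sol_class a (- fst p, adic_neg a (snd p))"
proof -
  have "sol_class a (- fst p', adic_neg a (snd p')) = sol_class a (- fst p, adic_neg a (snd p))"
    if "p' \<in> sol_class a p" for p'
    using that assms adic_neg_closed
    by (subst sol_class_eq_iff) (auto simp: sol_class_alt fun_eq_iff e_neg)
  moreover have "p \<in> sol_class a p" using assms by (auto simp: sol_class_alt)
  ultimately show ?thesis unfolding sol_neg_def by blast
qed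

lemma sol_add_closed [simp]: "X \<in> solenoid a \<Longrightarrow> Y \<in> solenoid a \<Longrightarrow> sol_add a X Y \<in> solenoid a"
  and coord_add: "X \<in> solenoid a \<Longrightarrow> Y \<in> solenoid a \<Longrightarrow> \<Phi> (sol_add a X Y) n = \<Phi> X n * \<Phi> Y n"
  by (elim solenoidE, simp add: sol_add_class e_add)+

lemma sol_neg_closed [simp]: "X \<in> solenoid a \<Longrightarrow> sol_neg a X \<in> solenoid a"
  and coord_neg: "X \<in> solenoid a \<Longrightarrow> \<Phi> (sol_neg a X) n = cnj (\<Phi> X n)"
  by (elim solenoidE, auto simp add: sol_neg_class e_neg adic_neg_closed)+

lemma sol_zero_closed [simp]: "sol_zero a \<in> solenoid a"
  and coord_zero [simp]: "\<Phi> (sol_zero a) n = 1"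
  by (simp_all add: sol_zero_def adic_exp_def)

lemma sol_mult_closed [simp]: "X \<in> solenoid a \<Longrightarrow> sol_mult a k X \<in> solenoid a"
  and coord_mult: "X \<in> solenoid a \<Longrightarrow> \<Phi> (sol_mult a k X) n = \<Phi> X n ^ k"
proof -
  assume X: "X \<in> solenoid a"
  have *: "sol_mult a k X \<in> solenoid a \<and> \<Phi> (sol_mult a k X) n = \<Phi> X n ^ k"
    by (induction k) (use X in \<open>auto simp: sol_mult_def coord_add\<close>)
  then show "sol_mult a k X \<in> solenoid a" "\<Phi> (sol_mult a k X) n = \<Phi> X n ^ k" by auto
qed

end

section \<open>Topology and Borel structure of the solenoid\<close>

context adic_seq
begin

abbreviation T where "T \<equiv> prod_topology euclideanreal (adic_top a)"

lemma topspace_adic_top [simp]: "topspace (adic_top a) = adic a"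
  by (simp add: adic_top_def)

lemma adic_eq_PiE: "adic a = (\<Pi>\<^sub>E n\<in>UNIV. {..<a n})"
  by (auto simp: adic_def)

lemma compactin_adic: "compactin (adic_top a) (adic a)"
  unfolding adic_top_def compactin_subtopology
  by (simp add: adic_eq_PiE compactin_PiE compactin_discrete_topology)

lemma continuous_map_digit: "continuous_map T euclideanreal (\<lambda>p. real (snd p i))"
proof -
  have "continuous_map (adic_top a) (discrete_topology UNIV) (\<lambda>x. x i)"
    unfolding adic_top_def by (intro continuous_map_from_subtopology continuous_map_product_projection) simp
  then have "continuous_map T (discrete_topology UNIV) ((\<lambda>x. x i) \<circ> snd)"
    by (rule continuous_map_compose[OF continuous_map_snd])
  moreover have "continuous_map (discrete_topology UNIV) euclideanreal real"
    by (simp add: continuous_map_from_discrete_topology)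
  ultimately have "continuous_map T euclideanreal (real \<circ> ((\<lambda>x. x i) \<circ> snd))"
    by (rule continuous_map_compose)
  then show ?thesis by (simp add: o_def)
qed

lemma continuous_map_e: "continuous_map T euclidean e"
proof -
  have comp: "continuous_map T euclidean (\<lambda>p. e p n)" for n
  proof -
    have v: "continuous_map T euclideanreal (\<lambda>p. real (val (snd p) n))"
      unfolding adic_val_def of_nat_sum of_nat_mult
      by (intro continuous_map_sum continuous_map_real_mult continuous_map_digit) auto
    have "continuous_map T euclideanreal (\<lambda>p. 2 * pi * ((fst p - real (val (snd p) n)) / real (P n)))"
      by (intro continuous_map_real_mult continuous_map_real_divide continuous_map_diff continuous_map_fst v) auto
    moreover have "continuous_map euclideanreal euclidean cis"
      by (simp add: continuous_on_cis continuous_on_id)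
    ultimately have "continuous_map T euclidean (cis \<circ> (\<lambda>p. 2 * pi * ((fst p - real (val (snd p) n)) / real (P n))))"
      by (rule continuous_map_compose)
    then show ?thesis by (simp add: adic_exp_def o_def)
  qed
  have "continuous_map T (product_topology (\<lambda>_. euclidean) UNIV) e"
    unfolding continuous_map_componentwise_UNIV using comp by blast
  then show ?thesis by (simp add: euclidean_product_topology)
qed

text \<open>Distinct classes are disjoint, so taking unions of classes commutes with
  intersection.\<close>

lemma istopology_sol: "istopology (\<lambda>U. U \<subseteq> solenoid a \<and> openin T (\<Union>U))"
  unfolding istopology_def
proof (intro conjI allI impI)
  fix U V assume U: "U \<subseteq> solenoid a \<and> openin T (\<Union>U)" and V: "V \<subseteq> solenoid a \<and> openin T (\<Union>V)"
  have "X = Y" if "p \<in> X" "p \<in> Y" "X \<in> U" "Y \<in> V" for p X Y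
  proof -
    have XY: "X \<in> solenoid a" "Y \<in> solenoid a" using that U V by auto
    then have "\<Phi> X = \<Phi> Y" using that coord_iff_mem by metis
    then show ?thesis using XY by (intro coord_inj)
  qed
  then have "\<Union>(U \<inter> V) = \<Union>U \<inter> \<Union>V" by blast
  then show "openin T (\<Union>(U \<inter> V))" using U V by auto
  show "U \<inter> V \<subseteq> solenoid a" using U by blast
next
  fix \<U> assume \<U>: "\<forall>K\<in>\<U>. K \<subseteq> solenoid a \<and> openin T (\<Union>K)"
  then show "\<Union>\<U> \<subseteq> solenoid a" by blast
  have "\<Union>(\<Union>\<U>) = \<Union>(Union ` \<U>)" by blast
  then show "openin T (\<Union>(\<Union>\<U>))" using \<U> by auto
qed

lemma openin_sol_top: "openin (sol_top a) U \<longleftrightarrow> U \<subseteq> solenoid a \<and> openin T (\<Union>U)"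
  unfolding sol_top_def by (simp add: topology_inverse'[OF istopology_sol])

lemma Union_solenoid: "\<Union>(solenoid a) = UNIV \<times> adic a"
proof -
  have "p \<in> sol_class a p" if "p \<in> UNIV \<times> adic a" for p using that by (auto simp: sol_class_alt)
  then show ?thesis using coord_iff_mem sol_class_in by blast
qed

lemma topspace_T [simp]: "topspace T = UNIV \<times> adic a"
  by simp

lemma topspace_sol_top [simp]: "topspace (sol_top a) = solenoid a"
proof -
  have "openin (sol_top a) (solenoid a)"
    unfolding openin_sol_top Union_solenoid by (metis openin_topspace order_refl topspace_T)
  then show ?thesis using openin_sol_top openin_subset openin_topspace by blast
qed

lemma mem_Union_iff:
  assumes "U \<subseteq> solenoid a" "p \<in> UNIV \<times> adic a"
  shows "p \<in> \<Union>U \<longleftrightarrow> sol_class a p \<in> U"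
proof
  assume "p \<in> \<Union>U"
  then obtain X where X: "X \<in> U" "p \<in> X" by blast
  then have "X = sol_class a p" using assms coord_iff_mem[of X p] by (intro coord_inj) auto
  then show "sol_class a p \<in> U" using X by simp
next
  have "p \<in> sol_class a p" using assms by (auto simp: sol_class_alt)
  then show "sol_class a p \<in> U \<Longrightarrow> p \<in> \<Union>U" by blast
qed

lemma continuous_map_sol_class: "continuous_map T (sol_top a) (sol_class a)"
  unfolding continuous_map_def
proof (intro conjI allI impI)
  show "sol_class a \<in> topspace T \<rightarrow> topspace (sol_top a)" by (auto simp del: topspace_prod_topology)
  fix U assume "openin (sol_top a) U"
  then have U: "U \<subseteq> solenoid a" "openin T (\<Union>U)" by (auto simp: openin_sol_top)
  have "\<Union>U \<subseteq> UNIV \<times> adic a" using Union_solenoid U(1) by blast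
  then have "{p \<in> topspace T. sol_class a p \<in> U} = \<Union>U"
    unfolding topspace_T using mem_Union_iff[OF U(1)] by blast
  then show "openin T {p \<in> topspace T. sol_class a p \<in> U}" using U(2) by simp
qed

lemma continuous_map_coord: "continuous_map (sol_top a) euclidean \<Phi>"
  unfolding continuous_map_def
proof (intro conjI allI impI)
  fix V :: "(nat \<Rightarrow> complex) set" assume V: "openin euclidean V"
  let ?U = "{X \<in> topspace (sol_top a). \<Phi> X \<in> V}"
  have "\<Union>?U = {p \<in> topspace T. e p \<in> V}"
  proof (intro set_eqI)
    fix p
    show "p \<in> \<Union>?U \<longleftrightarrow> p \<in> {p \<in> topspace T. e p \<in> V}"
    proof (cases "p \<in> UNIV \<times> adic a")
      case True
      then show ?thesis using mem_Union_iff[of ?U p] by auto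
    next
      case False
      then show ?thesis using Union_solenoid by auto
    qed
  qed
  moreover have "openin T {p \<in> topspace T. e p \<in> V}"
    using continuous_map_e V unfolding continuous_map_def by blast
  ultimately show "openin (sol_top a) ?U" by (auto simp: openin_sol_top)
qed simp

lemma e_int: "e (of_int k, adic_int a k) n = 1"
proof -
  have "int (P n) dvd k - int (val (adic_int a k) n)"
    using val_int_cong[of k n] by (simp add: cong_iff_dvd_diff dvd_diff_commute)
  then have "of_int (k - int (val (adic_int a k) n)) / real (P n) \<in> \<int>"
    by (simp only: div_P_Ints_iff)
  then have "cis (2 * pi * ((of_int k - real (val (adic_int a k) n)) / real (P n))) = cis (2 * pi * 0)"
    unfolding cis_2pi_eq_iff by simp
  then show ?thesis by (simp add: adic_exp_def)
qed

text \<open>Subtracting the floor of the real component along the subgroup of all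
  \<open>(k, k u)\<close> moves every representative into the compact set
  \<open>{0..1} \<times> adic a\<close>.\<close>

lemma compactin_solenoid: "compactin (sol_top a) (solenoid a)"
proof -
  have "solenoid a \<subseteq> sol_class a ` ({0..1} \<times> adic a)"
  proof
    fix X assume "X \<in> solenoid a"
    then obtain t x where x: "x \<in> adic a" "X = sol_class a (t, x)" by (auto elim: solenoidE)
    let ?q = "(t + of_int (- \<lfloor>t\<rfloor>), adic_add a x (adic_int a (- \<lfloor>t\<rfloor>)))"
    have "X = sol_class a ?q"
      using x by (simp only: x, subst sol_class_eq_iff) (auto simp: fun_eq_iff e_add e_int simp del: of_int_minus)
    moreover have "?q \<in> {0..1} \<times> adic a"
      using real_of_int_floor_add_one_ge[of t] by (auto simp: algebra_simps)
    ultimately show "X \<in> sol_class a ` ({0..1} \<times> adic a)" by blast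
  qed
  then have "solenoid a = sol_class a ` ({0..1} \<times> adic a)" by auto
  moreover have "compactin T ({0..1} \<times> adic a)"
    using compactin_adic by (simp add: compactin_Times)
  ultimately show ?thesis using image_compactin[OF _ continuous_map_sol_class] by metis
qed

text \<open>A continuous injection from a compact space into a Hausdorff space is a closed map; this
  makes \<open>\<Phi>\<close> a homeomorphism onto its range.\<close>

lemma closedin_imp_coord_closed:
  assumes "closedin (sol_top a) C"
  shows "closed (\<Phi> ` C)" "C = \<Phi> -` (\<Phi> ` C) \<inter> solenoid a"
proof -
  have "compactin (sol_top a) C"
    using closed_compactin[OF compactin_solenoid _ assms] closedin_subset[OF assms] by simp
  from image_compactin[OF this continuous_map_coord] show "closed (\<Phi> ` C)"
    by (simp add: compact_imp_closed)
  have "C \<subseteq> solenoid a" using closedin_subset[OF assms] by simp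
  then show "C = \<Phi> -` (\<Phi> ` C) \<inter> solenoid a" using coord_inj by blast
qed

text \<open>The quotient topology is the one pulled back along \<open>\<Phi>\<close>, so from here
  on the Borel structure can be handled in coordinates.\<close>

lemma openin_sol_top_iff: "openin (sol_top a) U \<longleftrightarrow> (\<exists>V. open V \<and> U = \<Phi> -` V \<inter> solenoid a)"
proof
  assume U: "openin (sol_top a) U"
  then have cl: "closedin (sol_top a) (solenoid a - U)" by (metis closedin_diff closedin_topspace topspace_sol_top)
  have "U = \<Phi> -` (- \<Phi> ` (solenoid a - U)) \<inter> solenoid a"
    using closedin_imp_coord_closed(2)[OF cl] openin_subset[OF U] by auto
  then show "\<exists>V. open V \<and> U = \<Phi> -` V \<inter> solenoid a"
    using closedin_imp_coord_closed(1)[OF cl] by (metis open_Compl)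
next
  assume "\<exists>V. open V \<and> U = \<Phi> -` V \<inter> solenoid a"
  then obtain V where V: "open V" "U = \<Phi> -` V \<inter> solenoid a" by blast
  then have "U = {X \<in> topspace (sol_top a). \<Phi> X \<in> V}" by auto
  moreover have "openin (sol_top a) {X \<in> topspace (sol_top a). \<Phi> X \<in> V}"
    using V(1) by (intro openin_continuous_map_preimage[OF continuous_map_coord]) simp
  ultimately show "openin (sol_top a) U" by simp
qed

lemma compactin_imp_closedin:
  assumes "compactin (sol_top a) K"
  shows "closedin (sol_top a) K"
proof -
  have K: "K \<subseteq> solenoid a" using compactin_subset_topspace[OF assms] by simp
  have "closed (\<Phi> ` K)"
    using image_compactin[OF assms continuous_map_coord] by (simp add: compact_imp_closed)
  moreover have "solenoid a - K = \<Phi> -` (- \<Phi> ` K) \<inter> solenoid a" using K coord_inj by blast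
  ultimately have "openin (sol_top a) (solenoid a - K)" unfolding openin_sol_top_iff by blast
  then show ?thesis using K by (simp add: closedin_def)
qed

lemma space_sol_borel [simp]: "space (sol_borel a) = solenoid a"
  by (simp add: sol_borel_def space_measure_of_conv)

lemma sets_sol_borel: "sets (sol_borel a) = {\<Phi> -` B \<inter> solenoid a | B. B \<in> sets borel}"
proof -
  have "{U. openin (sol_top a) U} \<subseteq> Pow (solenoid a)"
    using openin_subset by fastforce
  then have "sets (sol_borel a) = sigma_sets (solenoid a) {U. openin (sol_top a) U}"
    by (simp add: sol_borel_def)
  also have "{U. openin (sol_top a) U} = {\<Phi> -` V \<inter> solenoid a | V. V \<in> {V. open V}}"
    by (auto simp: openin_sol_top_iff)
  also have "sigma_sets (solenoid a) \<dots> = {\<Phi> -` B \<inter> solenoid a | B. B \<in> sigma_sets UNIV {V. open V}}"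
    by (rule sigma_sets_vimage_commute[symmetric]) simp
  finally show ?thesis by (simp add: borel_def)
qed

text \<open>There are countably many coordinates with values in a second countable space, so Borel
  measurability into the sequence space is coordinatewise.\<close>

lemma measurable_sol_borel_iff:
  "f \<in> measurable M (sol_borel a) \<longleftrightarrow>
     f \<in> space M \<rightarrow> solenoid a \<and> (\<forall>n. (\<lambda>\<omega>. \<Phi> (f \<omega>) n) \<in> borel_measurable M)"
proof
  assume f: "f \<in> measurable M (sol_borel a)"
  then have sp: "f \<in> space M \<rightarrow> solenoid a" using measurable_space[OF f] by auto
  have "(\<lambda>\<omega>. \<Phi> (f \<omega>)) \<in> borel_measurable M"
  proof (rule measurableI)
    fix B :: "(nat \<Rightarrow> complex) set" assume "B \<in> sets borel"
    then have "\<Phi> -` B \<inter> solenoid a \<in> sets (sol_borel a)" by (auto simp: sets_sol_borel)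
    then have "f -` (\<Phi> -` B \<inter> solenoid a) \<inter> space M \<in> sets M" using f by (rule measurable_sets[rotated])
    also have "f -` (\<Phi> -` B \<inter> solenoid a) \<inter> space M = (\<lambda>\<omega>. \<Phi> (f \<omega>)) -` B \<inter> space M"
      using sp by auto
    finally show "(\<lambda>\<omega>. \<Phi> (f \<omega>)) -` B \<inter> space M \<in> sets M" .
  qed simp
  then have "(\<lambda>\<omega>. \<Phi> (f \<omega>) n) \<in> borel_measurable M" for n
    by (rule measurable_product_then_coordinatewise)
  then show "f \<in> space M \<rightarrow> solenoid a \<and> (\<forall>n. (\<lambda>\<omega>. \<Phi> (f \<omega>) n) \<in> borel_measurable M)"
    using sp by blast
next
  assume R: "f \<in> space M \<rightarrow> solenoid a \<and> (\<forall>n. (\<lambda>\<omega>. \<Phi> (f \<omega>) n) \<in> borel_measurable M)"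
  then have m: "(\<lambda>\<omega>. \<Phi> (f \<omega>)) \<in> borel_measurable M"
    by (intro measurable_coordinatewise_then_product) auto
  show "f \<in> measurable M (sol_borel a)"
  proof (rule measurableI)
    fix A assume "A \<in> sets (sol_borel a)"
    then obtain B where B: "B \<in> sets borel" "A = \<Phi> -` B \<inter> solenoid a" by (auto simp: sets_sol_borel)
    have "f -` A \<inter> space M = (\<lambda>\<omega>. \<Phi> (f \<omega>)) -` B \<inter> space M" using R B by auto
    then show "f -` A \<inter> space M \<in> sets M" using measurable_sets[OF m B(1)] by simp
  qed (use R in auto)
qed

lemma measurable_coord [measurable]: "(\<lambda>X. \<Phi> X n) \<in> borel_measurable (sol_borel a)"
  using measurable_sol_borel_iff[of "\<lambda>X. X" "sol_borel a"] by simp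

lemma sol_measure_eqI:
  assumes "prob_space \<mu>" "prob_space \<nu>" and sets: "sets \<mu> = sets (sol_borel a)" "sets \<nu> = sets (sol_borel a)"
    and eq: "\<And>n k::nat. (\<integral>X. \<Phi> X n ^ k \<partial>\<mu>) = (\<integral>X. \<Phi> X n ^ k \<partial>\<nu>)"
  shows "\<mu> = \<nu>"
proof -
  interpret \<mu>: prob_space \<mu> by fact
  interpret \<nu>: prob_space \<nu> by fact
  have sp: "space \<mu> = solenoid a" "space \<nu> = solenoid a"
    using sets[THEN sets_eq_imp_space_eq] by simp_all
  have mc: "(\<lambda>X. \<Phi> X n) \<in> borel_measurable \<mu>" "(\<lambda>X. \<Phi> X n) \<in> borel_measurable \<nu>" for n
    using measurable_coord[of n] measurable_cong_sets[OF sets(1) refl] measurable_cong_sets[OF sets(2) refl] by blast+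
  have marg: "distr \<mu> borel (\<lambda>X. \<Phi> X n) = distr \<nu> borel (\<lambda>X. \<Phi> X n)" for n
  proof (rule circle_measure_eqI)
    show "finite_measure (distr \<mu> borel (\<lambda>X. \<Phi> X n))" "finite_measure (distr \<nu> borel (\<lambda>X. \<Phi> X n))"
      using mc by (auto intro: \<mu>.prob_space_distr \<nu>.prob_space_distr prob_space.finite_measure)
    show "AE z in distr \<mu> borel (\<lambda>X. \<Phi> X n). norm z = 1"
      using mc by (subst AE_distr_iff) (auto simp: sp)
    show "AE z in distr \<nu> borel (\<lambda>X. \<Phi> X n). norm z = 1"
      using mc by (subst AE_distr_iff) (auto simp: sp)
    show "integral\<^sup>L (distr \<mu> borel (\<lambda>X. \<Phi> X n)) (\<lambda>z. z ^ k) = integral\<^sup>L (distr \<nu> borel (\<lambda>X. \<Phi> X n)) (\<lambda>z. z ^ k)" for k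
      using mc by (simp add: integral_distr eq)
  qed simp_all
  define E where "E = {(\<lambda>X. \<Phi> X n) -` B \<inter> solenoid a | n B. B \<in> sets borel}"
  have E_sub: "E \<subseteq> Pow (solenoid a)" by (auto simp: E_def)
  have gen: "sets (sol_borel a) = sigma_sets (solenoid a) E"
  proof
    have "E \<subseteq> sets (sol_borel a)"
      using measurable_sets[OF measurable_coord] by (auto simp: E_def)
    then show "sigma_sets (solenoid a) E \<subseteq> sets (sol_borel a)"
      using sets.sigma_sets_subset[of E "sol_borel a"] by simp
    have "(\<lambda>X. X) \<in> measurable (sigma (solenoid a) E) (sol_borel a)"
      unfolding measurable_sol_borel_iff
    proof (intro conjI allI)
      show "(\<lambda>X. \<Phi> X n) \<in> borel_measurable (sigma (solenoid a) E)" for n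
        using E_sub by (intro measurableI) (auto simp: E_def)
    qed (simp add: space_measure_of_conv)
    from measurable_sets[OF this] show "sets (sol_borel a) \<subseteq> sigma_sets (solenoid a) E"
      using E_sub sets.sets_into_space[of _ "sol_borel a"] by (auto simp: space_measure_of_conv Int_absorb2)
  qed
  show ?thesis
  proof (rule measure_eqI_generator_eq[where E=E and \<Omega>="solenoid a" and A="\<lambda>_. solenoid a"])
    show "Int_stable E"
    proof (rule Int_stableI)
      fix A B assume "A \<in> E" "B \<in> E"
      then obtain n m C D where A: "A = (\<lambda>X. \<Phi> X n) -` C \<inter> solenoid a" "C \<in> sets borel"
        and B: "B = (\<lambda>X. \<Phi> X m) -` D \<inter> solenoid a" "D \<in> sets borel" by (auto simp: E_def)
      define N where "N = max n m"
      let ?f = "\<lambda>j (z::complex). z ^ (P N div P j)"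
      have pw: "\<Phi> X j = ?f j (\<Phi> X N)" if "X \<in> solenoid a" "j \<le> N" for X j
        using sys_power[OF coord_in_sys[OF that(1)] that(2)] by simp
      have "A \<inter> B = (\<lambda>X. \<Phi> X N) -` (?f n -` C \<inter> ?f m -` D) \<inter> solenoid a"
        using pw[of _ n] pw[of _ m] by (auto simp: A B N_def)
      moreover have "?f n -` C \<inter> ?f m -` D \<in> sets borel"
      proof -
        have "?f j \<in> borel_measurable borel" for j by measurable
        from measurable_sets[OF this] show ?thesis using A B by fastforce
      qed
      ultimately show "A \<inter> B \<in> E" unfolding E_def by blast
    qed
    show "emeasure \<mu> A = emeasure \<nu> A" if "A \<in> E" for A
    proof -
      from that obtain n C where A: "A = (\<lambda>X. \<Phi> X n) -` C \<inter> solenoid a" "C \<in> sets borel" by (auto simp: E_def)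
      then show ?thesis
        using emeasure_distr[OF mc(1)[of n] A(2)] emeasure_distr[OF mc(2)[of n] A(2)] marg[of n] by (simp add: sp)
    qed
    have "solenoid a \<in> E"
      unfolding E_def mem_Collect_eq by (intro exI[of _ 0] exI[of _ UNIV]) simp
    then show "range (\<lambda>_. solenoid a) \<subseteq> E" by blast
    show "sets \<mu> = sigma_sets (solenoid a) E" "sets \<nu> = sigma_sets (solenoid a) E"
      using sets gen by simp_all
  qed (use E_sub in simp_all)
qed

end

section \<open>Characters and characteristic functions\<close>

text \<open>The character group as rationals. \<open>adic_mod a n\<close> is the product of the
  first \<open>n\<close> factors, so the denominator 1 is included as well; the group is the same,
  since integers are fractions over \<open>a 0\<close>.\<close>

definition sol_dual :: "(nat \<Rightarrow> nat) \<Rightarrow> real set" where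
  "sol_dual a = {real_of_int k / real (adic_mod a n) | k n. True}"

text \<open>A rational has many representations \<open>k / P n\<close>. One is chosen here, and
  \<open>char_frac\<close> shows that every other one gives the same value.\<close>

definition sol_char :: "(nat \<Rightarrow> nat) \<Rightarrow> real \<Rightarrow> sol \<Rightarrow> complex" where
  "sol_char a y X = (let (n, k) = (SOME (n, k). y = real_of_int k / real (adic_mod a n))
     in sol_coord a X n powi k)"

definition sol_cf :: "(nat \<Rightarrow> nat) \<Rightarrow> sol measure \<Rightarrow> real \<Rightarrow> complex" where
  "sol_cf a \<mu> y = (\<integral>X. sol_char a y X \<partial>\<mu>)"

context adic_seq
begin

abbreviation "H \<equiv> sol_dual a"
abbreviation "chr \<equiv> sol_char a"
abbreviation "cf \<equiv> sol_cf a"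

lemma dual_refine:
  assumes "n \<le> N"
  shows "real_of_int k / real (P n) = real_of_int (k * int (P N div P n)) / real (P N)"
proof -
  have "P N = P n * (P N div P n)" using P_dvd[OF assms] by simp
  then have "real (P N) = real (P n) * real (P N div P n)" by (metis of_nat_mult)
  moreover have "real (P N) > 0" by simp
  ultimately show ?thesis by (simp add: field_simps zero_less_mult_iff)
qed

lemma coord_refine:
  assumes "X \<in> solenoid a" "n \<le> N"
  shows "\<Phi> X n powi k = \<Phi> X N powi (k * int (P N div P n))"
proof -
  have "\<Phi> X n = \<Phi> X N powi int (P N div P n)"
    using sys_power[OF coord_in_sys[OF assms(1)] assms(2)] by simp
  then show ?thesis by (simp only: power_int_mult[symmetric] mult.commute)
qed

text \<open>Both fractions are refined to the common denominator \<open>P N\<close>, where their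
  numerators must coincide, and the coordinates are refined in the same way.\<close>

lemma char_frac:
  assumes X: "X \<in> solenoid a"
  shows "chr (real_of_int k / real (P n)) X = \<Phi> X n powi k"
proof -
  define y where "y = real_of_int k / real (P n)"
  obtain n' k' where nk: "(SOME (n, k). y = real_of_int k / real (P n)) = (n', k')"
    by (cases "SOME (n, k). y = real_of_int k / real (P n)") blast
  have "case (SOME (n, k). y = real_of_int k / real (P n)) of (n, k) \<Rightarrow> y = real_of_int k / real (P n)"
    by (rule someI[of "\<lambda>(n, k). y = real_of_int k / real (P n)" "(n, k)"]) (simp add: y_def)
  then have y': "y = real_of_int k' / real (P n')" by (simp add: nk)
  define N where "N = max n n'"
  have "real_of_int (k * int (P N div P n)) / real (P N) = real_of_int (k' * int (P N div P n')) / real (P N)"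
    using y' dual_refine[of n N k] dual_refine[of n' N k'] unfolding y_def N_def by simp
  then have "k * int (P N div P n) = k' * int (P N div P n')"
    using P_pos[of N] by (metis div_by_0 divide_cancel_right less_irrefl of_int_eq_iff of_nat_eq_0_iff)
  then have "\<Phi> X n powi k = \<Phi> X n' powi k'"
    using coord_refine[OF X, of n N k] coord_refine[OF X, of n' N k'] by (simp add: N_def)
  then show ?thesis unfolding y_def[symmetric] by (simp add: sol_char_def nk)
qed

lemma dualI [intro]: "real_of_int k / real (P n) \<in> H"
  by (auto simp: sol_dual_def)

lemma dualE:
  assumes "y \<in> H"
  obtains k n where "y = real_of_int k / real (P n)"
  using assms by (auto simp: sol_dual_def)

lemma dual_common:
  assumes "x \<in> H" "y \<in> H"
  obtains k l n where "x = real_of_int k / real (P n)" "y = real_of_int l / real (P n)"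
proof -
  obtain k n l m where "x = real_of_int k / real (P n)" "y = real_of_int l / real (P m)"
    using assms by (metis dualE)
  then show ?thesis
    using dual_refine[of n "max n m" k] dual_refine[of m "max n m" l]
    by (intro that[of "k * int (P (max n m) div P n)" "max n m" "l * int (P (max n m) div P m)"]) simp_all
qed

lemma dual_zero [simp]: "0 \<in> H"
  using dualI[of 0 0] by simp

lemma dual_add [intro]: "x \<in> H \<Longrightarrow> y \<in> H \<Longrightarrow> x + y \<in> H"
  using dual_common[of x y] dualI by (metis add_divide_distrib of_int_add)

lemma dual_minus [intro]: "x \<in> H \<Longrightarrow> - x \<in> H"
  by (metis dualE dualI minus_divide_left of_int_minus)

lemma dual_double [intro]: "x \<in> H \<Longrightarrow> 2 * x \<in> H"
  using dual_add[of x x] by simp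

lemma dual_rat: "H \<subseteq> \<rat>"
  by (auto simp: sol_dual_def)

lemma countable_dual: "countable H"
  using countable_subset[OF dual_rat countable_rat] .

lemma char_zero [simp]: "X \<in> solenoid a \<Longrightarrow> chr 0 X = 1"
  using char_frac[of X 0 0] by simp

lemma char_add:
  assumes "x \<in> H" "y \<in> H" "X \<in> solenoid a"
  shows "chr (x + y) X = chr x X * chr y X"
proof -
  obtain k l n where "x = real_of_int k / real (P n)" "y = real_of_int l / real (P n)"
    using dual_common[OF assms(1,2)] .
  moreover from this have "x + y = real_of_int (k + l) / real (P n)" by (simp add: add_divide_distrib)
  ultimately show ?thesis using assms(3) by (simp only: char_frac power_int_add coord_nonzero simp_thms)
qed

lemma norm_char [simp]: "y \<in> H \<Longrightarrow> X \<in> solenoid a \<Longrightarrow> norm (chr y X) = 1"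
  by (elim dualE) (simp add: char_frac norm_power_int)

lemma char_minus:
  assumes "x \<in> H" "X \<in> solenoid a"
  shows "chr (- x) X = cnj (chr x X)"
proof -
  have "chr (- x) X * chr x X = 1"
    using char_add[of "- x" x X] assms by (simp add: dual_minus)
  moreover have "cnj (chr x X) * chr x X = 1"
    using norm_char[OF assms] complex_norm_square[of "chr x X"] by (simp add: mult.commute)
  ultimately show ?thesis using norm_char[OF assms]
    by (metis mult_right_cancel norm_zero zero_neq_one)
qed

lemma char_double: "x \<in> H \<Longrightarrow> X \<in> solenoid a \<Longrightarrow> chr (2 * x) X = (chr x X)\<^sup>2"
  using char_add[of x x X] by (simp add: power2_eq_square)

lemma char_sol_add:
  "y \<in> H \<Longrightarrow> X \<in> solenoid a \<Longrightarrow> Y \<in> solenoid a \<Longrightarrow> chr y (sol_add a X Y) = chr y X * chr y Y"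
  by (elim dualE) (simp add: char_frac coord_add power_int_mult_distrib)

lemma char_sol_neg:
  assumes "y \<in> H" "X \<in> solenoid a"
  shows "chr y (sol_neg a X) = cnj (chr y X)"
  using assms by (elim dualE) (simp add: char_frac coord_neg)

lemma char_sol_mult:
  assumes "y \<in> H" "X \<in> solenoid a"
  shows "chr y (sol_mult a k X) = chr y X ^ k"
proof -
  obtain l n where "y = real_of_int l / real (P n)" using assms(1) by (rule dualE)
  then show ?thesis using assms(2)
    by (simp add: char_frac coord_mult) (simp add: power_int_mult[symmetric] mult.commute flip: power_int_of_nat)
qed

lemma char_measurable [measurable]: "y \<in> H \<Longrightarrow> chr y \<in> borel_measurable (sol_borel a)"
proof (elim dualE)
  fix k n assume y: "y = real_of_int k / real (P n)"
  have "(\<lambda>X. \<Phi> X n powi k) \<in> borel_measurable (sol_borel a)"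
    unfolding power_int_def by measurable
  then show ?thesis
    unfolding y by (subst measurable_cong) (auto simp: char_frac)
qed

lemma sol_add_measurable:
  "(\<lambda>(X, Y). sol_add a X Y) \<in> measurable (sol_borel a \<Otimes>\<^sub>M sol_borel a) (sol_borel a)"
  unfolding measurable_sol_borel_iff
proof (intro conjI allI)
  fix n
  have "(\<lambda>p. \<Phi> (fst p) n * \<Phi> (snd p) n) \<in> borel_measurable (sol_borel a \<Otimes>\<^sub>M sol_borel a)" by measurable
  moreover have "\<Phi> (case p of (X, Y) \<Rightarrow> sol_add a X Y) n = \<Phi> (fst p) n * \<Phi> (snd p) n"
    if "p \<in> space (sol_borel a \<Otimes>\<^sub>M sol_borel a)" for p
    using that by (auto simp: space_pair_measure coord_add)
  ultimately show "(\<lambda>p. \<Phi> (case p of (X, Y) \<Rightarrow> sol_add a X Y) n) \<in> borel_measurable (sol_borel a \<Otimes>\<^sub>M sol_borel a)"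
    by (simp cong: measurable_cong)
qed (auto simp: space_pair_measure)

lemma sol_neg_measurable: "sol_neg a \<in> measurable (sol_borel a) (sol_borel a)"
  unfolding measurable_sol_borel_iff
proof (intro conjI allI)
  fix n
  have "(\<lambda>X. cnj (\<Phi> X n)) \<in> borel_measurable (sol_borel a)"
    by (intro measurable_compose[OF measurable_coord] borel_measurable_continuous_onI continuous_intros)
  then show "(\<lambda>X. \<Phi> (sol_neg a X) n) \<in> borel_measurable (sol_borel a)"
    by (subst measurable_cong) (auto simp: coord_neg)
qed auto

lemma sol_mult_measurable: "sol_mult a k \<in> measurable (sol_borel a) (sol_borel a)"
  unfolding measurable_sol_borel_iff
proof (intro conjI allI)
  fix n
  have "(\<lambda>X. \<Phi> X n ^ k) \<in> borel_measurable (sol_borel a)" by measurable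
  then show "(\<lambda>X. \<Phi> (sol_mult a k X) n) \<in> borel_measurable (sol_borel a)"
    by (subst measurable_cong) (auto simp: coord_mult)
qed auto

definition sol_prob :: "sol measure \<Rightarrow> bool" where
  "sol_prob \<mu> \<longleftrightarrow> prob_space \<mu> \<and> sets \<mu> = sets (sol_borel a)"

lemma sol_prob_space: "sol_prob \<mu> \<Longrightarrow> space \<mu> = solenoid a"
  unfolding sol_prob_def using sets_eq_imp_space_eq[of \<mu> "sol_borel a"] by simp

lemma sol_prob_measurable: "sol_prob \<mu> \<Longrightarrow> measurable \<mu> N = measurable (sol_borel a) N"
  unfolding sol_prob_def by (rule measurable_cong_sets) auto

lemma sol_prob_distr:
  "prob_space M \<Longrightarrow> f \<in> measurable M (sol_borel a) \<Longrightarrow> sol_prob (distr M (sol_borel a) f)"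
  unfolding sol_prob_def by (simp add: prob_space.prob_space_distr)

lemma cf_distr:
  "f \<in> measurable M (sol_borel a) \<Longrightarrow> y \<in> H \<Longrightarrow> cf (distr M (sol_borel a) f) y = (\<integral>\<omega>. chr y (f \<omega>) \<partial>M)"
  unfolding sol_cf_def by (rule integral_distr) auto

lemma char_integrable:
  assumes "prob_space M" "f \<in> measurable M (sol_borel a)" "y \<in> H"
  shows "integrable M (\<lambda>\<omega>. chr y (f \<omega>))"
proof -
  interpret prob_space M by fact
  show ?thesis
  proof (rule integrable_const_bound[where B=1])
    show "AE \<omega> in M. norm (chr y (f \<omega>)) \<le> 1"
      using measurable_space[OF assms(2)] assms(3) by (intro AE_I2) simp
    show "(\<lambda>\<omega>. chr y (f \<omega>)) \<in> borel_measurable M"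
      using measurable_compose[OF assms(2) char_measurable[OF assms(3)]] .
  qed
qed

lemma char_integrable': "sol_prob \<mu> \<Longrightarrow> y \<in> H \<Longrightarrow> integrable \<mu> (chr y)"
  by (rule char_integrable[of \<mu> "\<lambda>X. X" y]) (simp_all add: sol_prob_measurable, simp add: sol_prob_def)

lemma cf_eqI:
  assumes "sol_prob \<mu>" "sol_prob \<nu>" "\<And>y. y \<in> H \<Longrightarrow> cf \<mu> y = cf \<nu> y"
  shows "\<mu> = \<nu>"
proof (rule sol_measure_eqI)
  fix n k :: nat
  have "(\<integral>X. \<Phi> X n ^ k \<partial>\<mu>) = cf \<mu> (real_of_int (int k) / real (P n))" if "sol_prob \<mu>" for \<mu>
    unfolding sol_cf_def using sol_prob_space[OF that]
    by (intro Bochner_Integration.integral_cong) (simp_all only: char_frac power_int_of_nat)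
  then show "(\<integral>X. \<Phi> X n ^ k \<partial>\<mu>) = (\<integral>X. \<Phi> X n ^ k \<partial>\<nu>)" using assms dualI by metis
qed (use assms in \<open>auto simp: sol_prob_def\<close>)

lemma cf_minus:
  assumes "sol_prob \<mu>" "y \<in> H"
  shows "cf \<mu> (- y) = cnj (cf \<mu> y)"
proof -
  have "cf \<mu> (- y) = (\<integral>X. cnj (chr y X) \<partial>\<mu>)"
    unfolding sol_cf_def using assms sol_prob_space
    by (intro Bochner_Integration.integral_cong) (auto simp: char_minus)
  then show ?thesis by (simp add: sol_cf_def)
qed

lemma cf_zero: "sol_prob \<mu> \<Longrightarrow> cf \<mu> 0 = 1"
proof -
  assume \<mu>: "sol_prob \<mu>"
  then interpret prob_space \<mu> by (simp add: sol_prob_def)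
  have "cf \<mu> 0 = (\<integral>X. 1 \<partial>\<mu>)"
    unfolding sol_cf_def by (intro Bochner_Integration.integral_cong) (auto simp: sol_prob_space[OF \<mu>])
  then show ?thesis by (simp add: prob_space)
qed

lemma norm_cf_le_1:
  assumes "sol_prob \<mu>" "y \<in> H"
  shows "norm (cf \<mu> y) \<le> 1"
proof -
  interpret prob_space \<mu> using assms by (simp add: sol_prob_def)
  have "norm (cf \<mu> y) \<le> (\<integral>X. norm (chr y X) \<partial>\<mu>)" unfolding sol_cf_def by simp
  also have "\<dots> = (\<integral>X. 1 \<partial>\<mu>)"
    by (intro Bochner_Integration.integral_cong) (auto simp: sol_prob_space[OF assms(1)] assms)
  finally show ?thesis by (simp add: prob_space)
qed

lemma sol_conv_prob:
  assumes "sol_prob \<mu>" "sol_prob \<nu>"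
  shows "sol_prob (sol_conv a \<mu> \<nu>)"
proof -
  interpret \<mu>: prob_space \<mu> using assms by (simp add: sol_prob_def)
  interpret \<nu>: prob_space \<nu> using assms by (simp add: sol_prob_def)
  interpret pair_prob_space \<mu> \<nu> ..
  have "sets (\<mu> \<Otimes>\<^sub>M \<nu>) = sets (sol_borel a \<Otimes>\<^sub>M sol_borel a)"
    using assms by (intro sets_pair_measure_cong) (auto simp: sol_prob_def)
  then have "(\<lambda>(X, Y). sol_add a X Y) \<in> measurable (\<mu> \<Otimes>\<^sub>M \<nu>) (sol_borel a)"
    using sol_add_measurable measurable_cong_sets by blast
  then show ?thesis unfolding sol_conv_def by (intro sol_prob_distr) (rule P.prob_space_axioms)
qed

lemma cf_conv:
  assumes "sol_prob \<mu>" "sol_prob \<nu>" "y \<in> H"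
  shows "cf (sol_conv a \<mu> \<nu>) y = cf \<mu> y * cf \<nu> y"
proof -
  have s: "sets (\<mu> \<Otimes>\<^sub>M \<nu>) = sets (sol_borel a \<Otimes>\<^sub>M sol_borel a)"
    using assms by (intro sets_pair_measure_cong) (auto simp: sol_prob_def)
  then have m: "(\<lambda>(X, Y). sol_add a X Y) \<in> measurable (\<mu> \<Otimes>\<^sub>M \<nu>) (sol_borel a)"
    using sol_add_measurable measurable_cong_sets by blast
  have "cf (sol_conv a \<mu> \<nu>) y = (\<integral>p. chr y (case p of (X, Y) \<Rightarrow> sol_add a X Y) \<partial>(\<mu> \<Otimes>\<^sub>M \<nu>))"
    unfolding sol_conv_def by (rule cf_distr[OF m assms(3)])
  also have "\<dots> = (\<integral>p. chr y (fst p) * chr y (snd p) \<partial>(\<mu> \<Otimes>\<^sub>M \<nu>))"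
    using assms sol_prob_space
    by (intro Bochner_Integration.integral_cong) (auto simp: space_pair_measure char_sol_add)
  also have "\<dots> = cf \<mu> y * cf \<nu> y"
    unfolding sol_cf_def using assms
    by (intro integral_pair_mult) (auto simp: sol_prob_measurable sol_prob_space, auto simp: sol_prob_def)
  finally show ?thesis .
qed

end

section \<open>Distributions with a given consistent family of coordinates\<close>

context adic_seq
begin

text \<open>Kolmogorov extension. The law on a finite index set is the image of the law at its
  largest index under the power maps, so one-dimensional compatibility suffices. The limit lives on
  all complex sequences but charges only \<open>circle_sys\<close>, from where it is carried back to
  the solenoid.\<close>

lemma sol_projective_limit:
  fixes \<nu> :: "nat \<Rightarrow> complex measure"
  assumes prob: "\<And>n. prob_space (\<nu> n)" and sets: "\<And>n. sets (\<nu> n) = sets borel"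
    and circle: "\<And>n. AE z in \<nu> n. norm z = 1"
    and consistent: "\<And>n m. m \<le> n \<Longrightarrow> distr (\<nu> n) borel (\<lambda>z. z ^ (P n div P m)) = \<nu> m"
  obtains \<mu> where "sol_prob \<mu>" "\<And>n. distr \<mu> borel (\<lambda>X. \<Phi> X n) = \<nu> n"
proof -
  \<comment> \<open>Inserting 0 gives the empty index set a maximum.\<close>
  define M where "M J = Max (insert 0 J)" for J :: "nat set"
  have M_ge: "j \<le> M J" if "finite J" "j \<in> J" for j J using that by (simp add: M_def)
  have M_mono: "M J \<le> M K" if "J \<subseteq> K" "finite K" for J K
    unfolding M_def using that by (intro Max_mono) auto
  define Q where "Q J = distr (\<nu> (M J)) (PiM J (\<lambda>_. borel)) (\<lambda>z. \<lambda>j\<in>J. z ^ (P (M J) div P j))"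
    for J :: "nat set"
  have meas: "(\<lambda>z::complex. \<lambda>j\<in>J. z ^ f j) \<in> measurable (\<nu> n) (PiM J (\<lambda>_. borel))" for n J and f :: "nat \<Rightarrow> nat"
  proof (rule measurable_restrict)
    show "(\<lambda>z::complex. z ^ f j) \<in> borel_measurable (\<nu> n)" for j
      by (subst measurable_cong_sets[OF sets refl]) measurable
  qed
  have pow_div: "P n div P m * (P m div P j) = P n div P j" if jm: "j \<le> m" and mn: "m \<le> n" for j m n
  proof -
    obtain k where k: "P m = P j * k" using P_dvd[OF jm] by (auto simp: dvd_def)
    obtain l where l: "P n = P m * l" using P_dvd[OF mn] by (auto simp: dvd_def)
    have "P m \<noteq> 0" "P j \<noteq> 0" using P_pos[of m] P_pos[of j] by auto
    then show ?thesis using k l by (metis div_mult_swap dvd_triv_left mult.commute nonzero_mult_div_cancel_left)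
  qed
  interpret PF: polish_projective "UNIV :: nat set" Q
  proof (intro polish_projective.intro projective_family.intro)
    fix J K :: "nat set" assume JK: "J \<subseteq> K" "finite K"
    have fJ: "finite J" using JK finite_subset by blast
    have "distr (Q K) (PiM J (\<lambda>_. borel)) (\<lambda>f. restrict f J) =
        distr (\<nu> (M K)) (PiM J (\<lambda>_. borel)) ((\<lambda>f. restrict f J) \<circ> (\<lambda>z. \<lambda>j\<in>K. z ^ (P (M K) div P j)))"
      unfolding Q_def by (rule distr_distr[OF measurable_restrict_subset[OF JK(1)] meas])
    also have "(\<lambda>f. restrict f J) \<circ> (\<lambda>z::complex. \<lambda>j\<in>K. z ^ (P (M K) div P j)) =
        (\<lambda>z. \<lambda>j\<in>J. z ^ (P (M J) div P j)) \<circ> (\<lambda>z. z ^ (P (M K) div P (M J)))"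
    proof (intro ext)
      fix z :: complex and j
      show "((\<lambda>f. restrict f J) \<circ> (\<lambda>z. \<lambda>j\<in>K. z ^ (P (M K) div P j))) z j =
        ((\<lambda>z. \<lambda>j\<in>J. z ^ (P (M J) div P j)) \<circ> (\<lambda>z. z ^ (P (M K) div P (M J)))) z j"
        using JK pow_div[OF M_ge[OF fJ] M_mono[OF JK], of j]
        by (auto simp: restrict_def power_mult[symmetric])
    qed
    also have "distr (\<nu> (M K)) (PiM J (\<lambda>_. borel)) \<dots> =
        distr (distr (\<nu> (M K)) borel (\<lambda>z. z ^ (P (M K) div P (M J)))) (PiM J (\<lambda>_. borel)) (\<lambda>z. \<lambda>j\<in>J. z ^ (P (M J) div P j))"
    proof (rule distr_distr[symmetric])
      show "(\<lambda>z. z ^ (P (M K) div P (M J))) \<in> borel_measurable (\<nu> (M K))"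
        by (subst measurable_cong_sets[OF sets refl]) measurable
      show "(\<lambda>z::complex. \<lambda>j\<in>J. z ^ (P (M J) div P j)) \<in> measurable borel (PiM J (\<lambda>_. borel))"
        by (subst measurable_cong_sets[OF sets[of 0, symmetric] refl]) (rule meas)
    qed
    also have "\<dots> = Q J" unfolding consistent[OF M_mono[OF JK]] Q_def ..
    finally show "Q J = distr (Q K) (PiM J (\<lambda>_. borel)) (\<lambda>f. restrict f J)" by (rule sym)
  next
    fix J :: "nat set"
    show "prob_space (Q J)" unfolding Q_def by (rule prob_space.prob_space_distr[OF prob meas])
  qed
  define L where "L = PF.lim"
  interpret L: prob_space L unfolding L_def by (rule PF.P.prob_space_axioms)
  have sets_L [measurable_cong]: "sets L = sets (PiM UNIV (\<lambda>_. borel))" by (simp add: L_def)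
  have space_L: "space L = UNIV" using sets_eq_imp_space_eq[OF sets_L] by (simp add: space_PiM)
  have marg: "distr L (PiM J (\<lambda>_. borel)) (\<lambda>\<omega>. restrict \<omega> J) = Q J" if J: "finite J" for J
  proof (rule measure_eqI)
    fix A assume "A \<in> sets (distr L (PiM J (\<lambda>_. borel)) (\<lambda>\<omega>. restrict \<omega> J))"
    then have A: "A \<in> sets (PiM J (\<lambda>_. borel))" by simp
    have "emeasure (distr L (PiM J (\<lambda>_. borel)) (\<lambda>\<omega>. restrict \<omega> J)) A =
        emeasure L ((\<lambda>\<omega>. restrict \<omega> J) -` A \<inter> space L)"
      using A by (intro emeasure_distr) (simp_all add: measurable_restrict_subset cong: measurable_cong_sets[OF sets_L refl])
    also have "(\<lambda>\<omega>. restrict \<omega> J) -` A \<inter> space L = PF.emb UNIV J A"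
      by (auto simp: prod_emb_def space_L)
    finally show "emeasure (distr L (PiM J (\<lambda>_. borel)) (\<lambda>\<omega>. restrict \<omega> J)) A = emeasure (Q J) A"
      unfolding L_def by (rule trans) (rule PF.emeasure_lim_emb[OF subset_UNIV J A])
  qed (simp add: Q_def)
  have coord_L [measurable]: "(\<lambda>\<omega>. \<omega> n) \<in> borel_measurable L" for n
    by (subst measurable_cong_sets[OF sets_L refl]) measurable
  have rm: "(\<lambda>\<omega>. restrict \<omega> J) \<in> measurable L (PiM J (\<lambda>_. borel))" for J :: "nat set"
    by (subst measurable_cong_sets[OF sets_L refl]) (simp add: measurable_restrict_subset)
  have L_marg: "distr L borel (\<lambda>\<omega>. \<omega> n) = \<nu> n" for n
  proof -
    have "distr L borel (\<lambda>\<omega>. \<omega> n) = distr (Q {n}) borel (\<lambda>f. f n)"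
      unfolding marg[of "{n}", symmetric, simplified]
      by (subst distr_distr[OF _ rm]) (auto simp: o_def)
    also have "\<dots> = distr (\<nu> n) borel ((\<lambda>f. f n) \<circ> (\<lambda>z. \<lambda>j\<in>{n}. z ^ (P n div P j)))"
      unfolding Q_def by (subst distr_distr[OF _ meas]) (auto simp: M_def)
    also have "\<dots> = distr (\<nu> n) borel (\<lambda>z. z ^ (P n div P n))" by (simp add: o_def)
    finally show ?thesis using consistent[of n n] by simp
  qed
  have AE_norm: "AE \<omega> in L. norm (\<omega> n) = 1" for n
  proof -
    have "AE z in distr L borel (\<lambda>\<omega>. \<omega> n). norm z = 1" unfolding L_marg by (rule circle)
    then show ?thesis by (subst (asm) AE_distr_iff) auto
  qed
  have AE_step: "AE \<omega> in L. \<omega> (Suc n) ^ a n = \<omega> n" for n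
  proof -
    \<comment> \<open>The relation between neighbouring coordinates is a statement about their joint
      law, hence the two-element index set.\<close>
    let ?J = "{n, Suc n}"
    have MJ: "M ?J = Suc n" by (simp add: M_def)
    have st: "{f \<in> space (PiM ?J (\<lambda>_. borel)). f (Suc n) ^ a n = (f n :: complex)} \<in> sets (PiM ?J (\<lambda>_. borel))"
      by measurable
    have "AE f in Q ?J. f (Suc n) ^ a n = f n"
      unfolding Q_def
    proof (subst AE_distr_iff[OF meas])
      have "P (Suc n) div P n = a n" using P_pos[of n] by (simp add: P_Suc del: P_pos)
      then show "AE z in \<nu> (M ?J). (\<lambda>j\<in>?J. z ^ (P (M ?J) div P j)) (Suc n) ^ a n = (\<lambda>j\<in>?J. z ^ (P (M ?J) div P j)) n"
        unfolding MJ using P_pos[of "Suc n"] by (simp del: P_pos)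
    qed (rule st)
    then have "AE f in distr L (PiM ?J (\<lambda>_. borel)) (\<lambda>\<omega>. restrict \<omega> ?J). f (Suc n) ^ a n = f n"
      by (subst marg) simp_all
    then show ?thesis by (subst (asm) AE_distr_iff[OF rm st]) simp
  qed
  have AE_sys: "AE \<omega> in L. \<omega> \<in> circle_sys"
    unfolding circle_sys_def mem_Collect_eq AE_all_countable using AE_norm AE_step by (auto intro: AE_conjI)
  \<comment> \<open>The inverse of \<open>\<Phi>\<close>, with the neutral element as default off
    \<open>circle_sys\<close>. All coordinates of the default are 1, which is the
    \<open>else\<close> branch in the measurability proof below.\<close>
  define g where "g \<omega> = (if \<omega> \<in> circle_sys then (SOME X. X \<in> solenoid a \<and> \<Phi> X = \<omega>) else sol_zero a)" for \<omega>
  have g: "g \<omega> \<in> solenoid a \<and> \<Phi> (g \<omega>) = \<omega>" if \<omega>: "\<omega> \<in> circle_sys" for \<omega>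
  proof -
    obtain X where "X \<in> solenoid a \<and> \<Phi> X = \<omega>" using sys_is_coord[OF \<omega>] by blast
    then have "(SOME X. X \<in> solenoid a \<and> \<Phi> X = \<omega>) \<in> solenoid a \<and> \<Phi> (SOME X. X \<in> solenoid a \<and> \<Phi> X = \<omega>) = \<omega>"
      by (rule someI)
    then show ?thesis using \<omega> by (simp add: g_def)
  qed
  have gm: "g \<in> measurable L (sol_borel a)"
    unfolding measurable_sol_borel_iff
  proof (intro conjI allI)
    show "g \<in> space L \<rightarrow> solenoid a" using g by (auto simp: g_def)
    fix n
    have sm: "{\<omega> \<in> space L. norm (\<omega> n) = 1} \<in> sets L" "{\<omega> \<in> space L. \<omega> (Suc n) ^ a n = \<omega> n} \<in> sets L" for n
      by (rule measurable_equality_set; measurable)+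
    have [measurable]: "Measurable.pred L (\<lambda>\<omega>. norm (\<omega> n) = 1)" "Measurable.pred L (\<lambda>\<omega>. \<omega> (Suc n) ^ a n = \<omega> n)" for n
      unfolding pred_def by (rule sm)+
    have "(\<lambda>\<omega>. if \<forall>n. norm (\<omega> n) = 1 \<and> \<omega> (Suc n) ^ a n = \<omega> n then \<omega> n else 1) \<in> borel_measurable L"
      by (intro measurable_If coord_L borel_measurable_const pred_sets1) measurable
    moreover have "\<Phi> (g \<omega>) n = (if \<forall>n. norm (\<omega> n) = 1 \<and> \<omega> (Suc n) ^ a n = \<omega> n then \<omega> n else 1)" for \<omega>
      using g[of \<omega>] by (auto simp: g_def circle_sys_def)
    ultimately show "(\<lambda>\<omega>. \<Phi> (g \<omega>) n) \<in> borel_measurable L" by simp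
  qed
  show ?thesis
  proof (rule that)
    show "sol_prob (distr L (sol_borel a) g)" by (rule sol_prob_distr[OF L.prob_space_axioms gm])
    fix n
    have "distr (distr L (sol_borel a) g) borel (\<lambda>X. \<Phi> X n) = distr L borel (\<lambda>\<omega>. \<Phi> (g \<omega>) n)"
      by (subst distr_distr[OF measurable_coord gm]) (simp add: o_def)
    also have "\<dots> = distr L borel (\<lambda>\<omega>. \<omega> n)"
    proof (rule distr_cong_AE)
      show "AE \<omega> in L. \<Phi> (g \<omega>) n = \<omega> n" using AE_sys by eventually_elim (use g in simp)
      show "(\<lambda>\<omega>. \<Phi> (g \<omega>) n) \<in> borel_measurable L" by (rule gm[unfolded measurable_sol_borel_iff, THEN conjunct2, rule_format])
    qed simp_all
    finally show "distr (distr L (sol_borel a) g) borel (\<lambda>X. \<Phi> X n) = \<nu> n" by (simp add: L_marg)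
  qed
qed

text \<open>Level \<open>n\<close> carries the circle measure dual to the numerators
  \<open>k\<close> with \<open>k / P n\<close> in \<open>S\<close>. The levels are compatible
  because \<open>k / P m\<close> and its refinement over \<open>P n\<close> are the same rational.
  The result is the future Haar distribution of the annihilator of \<open>S\<close>.\<close>

lemma dual_subgroup_measure:
  assumes S: "S \<subseteq> H" "0 \<in> S" "\<And>x y. x \<in> S \<Longrightarrow> y \<in> S \<Longrightarrow> x + y \<in> S" "\<And>x. x \<in> S \<Longrightarrow> - x \<in> S"
  obtains m where "sol_prob m" "\<And>y. y \<in> H \<Longrightarrow> cf m y = (if y \<in> S then 1 else 0)"
proof -
  define SS where "SS n = {k::int. real_of_int k / real (P n) \<in> S}" for n
  have "\<exists>\<nu> :: complex measure. prob_space \<nu> \<and> sets \<nu> = sets borel \<and> (AE z in \<nu>. norm z = 1) \<and>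
      (\<forall>k::nat. integral\<^sup>L \<nu> (\<lambda>z. z ^ k) = (if int k \<in> SS n then 1 else 0))" for n
  proof (rule circle_dual_measure[of "SS n"])
    show "0 \<in> SS n" using S(2) by (simp add: SS_def)
    show "k + l \<in> SS n" if "k \<in> SS n" "l \<in> SS n" for k l
      using that S(3) by (simp add: SS_def add_divide_distrib)
    show "- k \<in> SS n" if "k \<in> SS n" for k
      using S(4)[of "real_of_int k / real (P n)"] that by (simp add: SS_def)
  qed blast
  then obtain \<nu> :: "nat \<Rightarrow> complex measure" where \<nu>: "\<And>n. prob_space (\<nu> n)" "\<And>n. sets (\<nu> n) = sets borel"
      "\<And>n. AE z in \<nu> n. norm z = 1"
    and \<nu>_int: "\<And>n k::nat. integral\<^sup>L (\<nu> n) (\<lambda>z. z ^ k) = (if int k \<in> SS n then 1 else 0)"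
    by metis
  have pm: "(\<lambda>z. z ^ k) \<in> borel_measurable (\<nu> n)" for k n
    by (subst measurable_cong_sets[OF \<nu>(2) refl]) measurable
  have "distr (\<nu> n) borel (\<lambda>z. z ^ (P n div P m)) = \<nu> m" if "m \<le> n" for m n
  proof (rule circle_measure_eqI)
    show "finite_measure (distr (\<nu> n) borel (\<lambda>z. z ^ (P n div P m)))"
      by (intro prob_space.finite_measure prob_space.prob_space_distr \<nu> pm)
    show "AE z in distr (\<nu> n) borel (\<lambda>z. z ^ (P n div P m)). norm z = 1"
    proof (subst AE_distr_iff[OF pm])
      show "AE z in \<nu> n. norm (z ^ (P n div P m)) = 1"
        using \<nu>(3)[of n] by eventually_elim (simp add: norm_power)
    qed measurable
    fix k :: nat
    have "integral\<^sup>L (distr (\<nu> n) borel (\<lambda>z. z ^ (P n div P m))) (\<lambda>z. z ^ k) =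
        integral\<^sup>L (\<nu> n) (\<lambda>z. z ^ (P n div P m * k))"
      by (subst integral_distr[OF pm]) (simp_all add: power_mult)
    also have "\<dots> = (if int (P n div P m * k) \<in> SS n then 1 else 0)" by (rule \<nu>_int)
    also have "int (P n div P m * k) \<in> SS n \<longleftrightarrow> int k \<in> SS m"
      using dual_refine[OF that, of "int k"] by (simp add: SS_def mult.commute)
    finally show "integral\<^sup>L (distr (\<nu> n) borel (\<lambda>z. z ^ (P n div P m))) (\<lambda>z. z ^ k) = integral\<^sup>L (\<nu> m) (\<lambda>z. z ^ k)"
      by (simp add: \<nu>_int)
  qed (use \<nu> in \<open>auto intro: prob_space.finite_measure\<close>)
  from sol_projective_limit[OF \<nu> this]
  obtain m where m: "sol_prob m" "\<And>n. distr m borel (\<lambda>X. \<Phi> X n) = \<nu> n" by blast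
  have cm: "(\<lambda>X. \<Phi> X n) \<in> borel_measurable m" for n
    using measurable_coord by (simp add: sol_prob_measurable[OF m(1)])
  have nat_case: "cf m (real_of_int (int k) / real (P n)) = (if real_of_int (int k) / real (P n) \<in> S then 1 else 0)" for k n
  proof -
    have "cf m (real_of_int (int k) / real (P n)) = (\<integral>X. \<Phi> X n ^ k \<partial>m)"
      unfolding sol_cf_def using sol_prob_space[OF m(1)]
      by (intro Bochner_Integration.integral_cong) (simp_all only: char_frac power_int_of_nat)
    also have "\<dots> = integral\<^sup>L (distr m borel (\<lambda>X. \<Phi> X n)) (\<lambda>z. z ^ k)"
      by (subst integral_distr[OF cm]) simp_all
    finally show ?thesis by (simp add: m(2) \<nu>_int SS_def)
  qed
  show ?thesis
  proof (rule that[OF m(1)])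
    fix y assume "y \<in> H"
    then obtain k n where y: "y = real_of_int k / real (P n)" by (rule dualE)
    \<comment> \<open>Moments give the values at nonnegative numerators only; the others follow by
      conjugation and symmetry of \<open>S\<close>.\<close>
    show "cf m y = (if y \<in> S then 1 else 0)"
    proof (cases "k \<ge> 0")
      case True
      then show ?thesis using nat_case[of "nat k" n] by (simp add: y)
    next
      case False
      then have y': "- y = real_of_int (int (nat (- k))) / real (P n)" by (simp add: y)
      have "cf m y = cnj (cf m (- y))" using cf_minus[OF m(1) dual_minus[OF \<open>y \<in> H\<close>]] by simp
      also have "\<dots> = (if - y \<in> S then 1 else 0)" unfolding y' nat_case by simp
      finally show ?thesis using S(4)[of y] S(4)[of "- y"] by auto
    qed
  qed
qed

end

section \<open>Halving and the subadditivity inequality\<close>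

text \<open>Minkowski's inequality from Cauchy-Schwarz, which is obtained from the nonnegativity of
  the quadratic \<open>\<integral>(t u + v)\<^sup>2\<close> in \<open>t\<close>.\<close>

lemma integral_L2_triangle:
  fixes u v :: "'a \<Rightarrow> real"
  assumes int: "integrable M (\<lambda>x. (u x)\<^sup>2)" "integrable M (\<lambda>x. (v x)\<^sup>2)" "integrable M (\<lambda>x. u x * v x)"
  shows "sqrt (\<integral>x. (u x + v x)\<^sup>2 \<partial>M) \<le> sqrt (\<integral>x. (u x)\<^sup>2 \<partial>M) + sqrt (\<integral>x. (v x)\<^sup>2 \<partial>M)"
proof -
  define A B C where "A = (\<integral>x. (u x)\<^sup>2 \<partial>M)" and "B = (\<integral>x. (v x)\<^sup>2 \<partial>M)" and "C = (\<integral>x. u x * v x \<partial>M)"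
  have nonneg: "A \<ge> 0" "B \<ge> 0" by (simp_all add: A_def B_def)
  have quad: "t\<^sup>2 * A + 2 * t * C + B \<ge> 0" for t
  proof -
    have "(\<integral>x. (t * u x + v x)\<^sup>2 \<partial>M) = (\<integral>x. t\<^sup>2 * (u x)\<^sup>2 + 2 * t * (u x * v x) + (v x)\<^sup>2 \<partial>M)"
      by (simp add: power2_eq_square algebra_simps)
    also have "\<dots> = t\<^sup>2 * A + 2 * t * C + B"
      using int by (simp add: A_def B_def C_def)
    finally have "(\<integral>x. (t * u x + v x)\<^sup>2 \<partial>M) = t\<^sup>2 * A + 2 * t * C + B" .
    moreover have "0 \<le> (\<integral>x. (t * u x + v x)\<^sup>2 \<partial>M)" by simp
    ultimately show ?thesis by linarith
  qed
  have "C\<^sup>2 \<le> A * B"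
  proof (cases "A = 0")
    case True
    have "C = 0"
    proof (rule ccontr)
      assume "C \<noteq> 0"
      \<comment> \<open>With \<open>A = 0\<close> the quadratic is linear in \<open>t\<close>, and
        this \<open>t\<close> gives it the value -1.\<close>
      then show False using quad[of "- (B + 1) / (2 * C)"] True by (simp add: field_simps)
    qed
    then show ?thesis using True by simp
  next
    case False
    then have "A > 0" using nonneg by simp
    \<comment> \<open>The minimiser \<open>t = - C / A\<close> of the quadratic yields the sharp
      inequality.\<close>
    have "(- C / A)\<^sup>2 * A + 2 * (- C / A) * C + B = B - C\<^sup>2 / A"
      using False by (simp add: power2_eq_square field_simps)
    then have "C\<^sup>2 / A \<le> B" using quad[of "- C / A"] by simp
    then show ?thesis using \<open>A > 0\<close> by (simp add: field_simps)
  qed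
  then have "C \<le> sqrt A * sqrt B"
    using nonneg by (metis real_le_rsqrt real_sqrt_mult)
  moreover have "(\<integral>x. (u x + v x)\<^sup>2 \<partial>M) = A + 2 * C + B"
  proof -
    have "(\<integral>x. (u x + v x)\<^sup>2 \<partial>M) = (\<integral>x. (u x)\<^sup>2 + 2 * (u x * v x) + (v x)\<^sup>2 \<partial>M)"
      by (simp add: power2_eq_square algebra_simps)
    then show ?thesis using int by (simp add: A_def B_def C_def)
  qed
  ultimately have "(\<integral>x. (u x + v x)\<^sup>2 \<partial>M) \<le> (sqrt A + sqrt B)\<^sup>2"
    using nonneg by (simp add: power2_sum)
  then show ?thesis
    using nonneg by (simp add: A_def[symmetric] B_def[symmetric] real_le_lsqrt)
qed

context adic_seq
begin

lemma char_nat_mult: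
  assumes "y \<in> H" "X \<in> solenoid a"
  shows "chr (real k * y) X = chr y X ^ k \<and> real k * y \<in> H"
proof (induction k)
  case (Suc k)
  have "real (Suc k) * y = y + real k * y" by (simp add: distrib_right)
  then show ?case using Suc assms char_add[of y "real k * y" X] dual_add[of y "real k * y"] by simp
qed (use assms in simp)

text \<open>If every \<open>a N\<close> with \<open>N \<ge> n\<close> were odd, the sequence that is
  constantly -1 from \<open>n\<close> on would be compatible, since an odd power of -1 is -1. It
  would be the coordinate sequence of an element of order 2.\<close>

lemma even_factor_exists:
  assumes no_order2: "\<forall>X\<in>solenoid a. sol_add a X X = sol_zero a \<longrightarrow> X = sol_zero a"
  obtains N where "N \<ge> n" "even (a N)"
proof (rule ccontr)
  assume "\<not> thesis"
  with that have odd: "odd (a N)" if "N \<ge> n" for N using \<open>N \<ge> n\<close> by blast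
  \<comment> \<open>Below \<open>n\<close> the compatibility condition leaves no choice: those
    entries are powers of the entry -1 at \<open>n\<close>.\<close>
  define z :: "nat \<Rightarrow> complex" where "z k = (if k \<ge> n then - 1 else (- 1) ^ (P n div P k))" for k
  have "z (Suc k) ^ a k = z k" for k
  proof (cases "k \<ge> n")
    case True
    then show ?thesis using odd[of k] by (simp add: z_def)
  next
    case False
    have zS: "z (Suc k) = (- 1) ^ (P n div P (Suc k))"
      using False P_pos[of n] by (cases "Suc k = n") (auto simp: z_def simp del: P_pos)
    obtain l where "P n = P (Suc k) * l" using False P_dvd[of "Suc k" n] by (auto simp: dvd_def)
    then have "P n div P (Suc k) * a k = P n div P k"
      using P_pos[of k] P_pos[of "Suc k"] by (simp add: P_Suc mult.assoc mult.commute del: P_pos)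
    then have "z (Suc k) ^ a k = (- 1) ^ (P n div P k)"
      unfolding zS by (simp only: power_mult[symmetric])
    then show ?thesis using False by (simp add: z_def)
  qed
  moreover have "norm (z k) = 1" for k by (simp add: z_def norm_power)
  ultimately have "z \<in> circle_sys" by (simp add: circle_sys_def)
  then obtain X where X: "X \<in> solenoid a" "\<Phi> X = z" by (rule sys_is_coord)
  have "z k * z k = 1" for k by (simp add: z_def power_mult_distrib[symmetric])
  then have "sol_add a X X = sol_zero a"
    using X by (intro coord_inj) (auto simp: fun_eq_iff coord_add)
  then have "X = sol_zero a" using no_order2 X by blast
  then have "z n = 1" using X by (metis coord_zero)
  then show False by (simp add: z_def)
qed

text \<open>An even factor \<open>a N\<close> with \<open>N \<ge> n\<close> supplies the extra 2 in
  the denominator.\<close>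

lemma dual_half:
  assumes "\<forall>X\<in>solenoid a. sol_add a X X = sol_zero a \<longrightarrow> X = sol_zero a" "y \<in> H"
  shows "y / 2 \<in> H"
proof -
  obtain k n where y: "y = real_of_int k / real (P n)" using assms(2) by (rule dualE)
  obtain N where N: "N \<ge> n" "even (a N)" using even_factor_exists[OF assms(1)] .
  then obtain b where b: "a N = 2 * b" by (elim evenE)
  have "y = real_of_int (k * int (P N div P n)) / real (P N)" using dual_refine[OF N(1)] by (simp only: y)
  then have "y / 2 = real_of_int (k * int (P N div P n) * int b) / real (P (Suc N))"
    using a_pos[of N] b by (simp add: P_Suc field_simps)
  then show ?thesis using dualI by metis
qed

text \<open>The half of \<open>X\<close> is given by its coordinates: at level \<open>n\<close> the
  value at \<open>X\<close> of the halved character \<open>1 / (2 * P n)\<close>. These are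
  compatible because \<open>a n / (2 * P (Suc n)) = 1 / (2 * P n)\<close>.\<close>

lemma sol_half_exists:
  assumes "\<forall>X\<in>solenoid a. sol_add a X X = sol_zero a \<longrightarrow> X = sol_zero a" "X \<in> solenoid a"
  obtains Y where "Y \<in> solenoid a" "sol_mult a 2 Y = X"
proof -
  have inH: "1 / real (P n) / 2 \<in> H" for n
    using dual_half[OF assms(1) dualI[of 1 n]] by simp
  define w where "w n = chr (1 / real (P n) / 2) X" for n
  have "w (Suc n) ^ a n = w n" for n
  proof -
    have "real (a n) * (1 / real (P (Suc n)) / 2) = 1 / real (P n) / 2"
      using a_pos[of n] by (simp add: P_Suc)
    then show ?thesis using char_nat_mult[OF inH[of "Suc n"] assms(2), of "a n"] by (simp add: w_def)
  qed
  moreover have "norm (w n) = 1" for n using inH assms(2) by (simp add: w_def)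
  ultimately have "w \<in> circle_sys" by (simp add: circle_sys_def)
  then obtain Y where Y: "Y \<in> solenoid a" "\<Phi> Y = w" by (rule sys_is_coord)
  have "w n ^ 2 = \<Phi> X n" for n
    using char_double[OF inH[of n] assms(2)] char_frac[OF assms(2), of 1 n] by (simp add: w_def)
  then have "sol_mult a 2 Y = X"
    using Y assms(2) by (intro coord_inj) (auto simp: fun_eq_iff coord_mult)
  then show ?thesis using that Y by blast
qed

text \<open>By \<open>\<bar>chr y X - 1\<bar>\<^sup>2 = 2 - 2 * Re (chr y X)\<close> each root is,
  up to the factor \<open>sqrt 2\<close>, the L2 norm of \<open>chr y - 1\<close>. The claim is
  Minkowski applied to \<open>chr x * chr y - 1 = chr x * (chr y - 1) + (chr x - 1)\<close>.\<close>

lemma cf_subadd: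
  assumes \<mu>: "sol_prob \<mu>" and xy: "x \<in> H" "y \<in> H"
  shows "sqrt (1 - Re (cf \<mu> (x + y))) \<le> sqrt (1 - Re (cf \<mu> x)) + sqrt (1 - Re (cf \<mu> y))"
proof -
  interpret prob_space \<mu> using \<mu> by (simp add: sol_prob_def)
  define d where "d y X = norm (chr y X - 1)" for y X
  have dm: "d y \<in> borel_measurable \<mu>" if "y \<in> H" for y
    unfolding d_def sol_prob_measurable[OF \<mu>] using char_measurable[OF that] by measurable
  have d_bound: "d y X \<le> 2" if "y \<in> H" "X \<in> solenoid a" for y X
    unfolding d_def using norm_triangle_ineq4[of "chr y X" 1] norm_char[OF that] by simp
  have int: "integrable \<mu> (\<lambda>X. d y X * d z X)" if "y \<in> H" "z \<in> H" for y z
  proof (rule integrable_const_bound[where B=4])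
    show "AE X in \<mu>. norm (d y X * d z X) \<le> 4"
    proof (intro AE_I2)
      fix X assume "X \<in> space \<mu>"
      then have "X \<in> solenoid a" by (simp add: sol_prob_space[OF \<mu>])
      then have "d y X * d z X \<le> 2 * 2"
        by (intro mult_mono d_bound that) (simp_all add: d_def)
      moreover have "0 \<le> d y X * d z X" by (simp add: d_def)
      ultimately show "norm (d y X * d z X) \<le> 4" by simp
    qed
  qed (use dm that in measurable)
  have d2: "(\<integral>X. (d y X)\<^sup>2 \<partial>\<mu>) = 2 * (1 - Re (cf \<mu> y))" if y: "y \<in> H" for y
  proof -
    have "(\<integral>X. (d y X)\<^sup>2 \<partial>\<mu>) = (\<integral>X. 2 - 2 * Re (chr y X) \<partial>\<mu>)"
    proof (intro Bochner_Integration.integral_cong refl)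
      fix X assume "X \<in> space \<mu>"
      then have "norm (chr y X) = 1" using y by (simp add: sol_prob_space[OF \<mu>])
      then have "(Re (chr y X))\<^sup>2 + (Im (chr y X))\<^sup>2 = 1" by (simp add: cmod_def)
      then show "(d y X)\<^sup>2 = 2 - 2 * Re (chr y X)"
        by (simp add: d_def cmod_power2 power2_diff)
    qed
    also have "\<dots> = 2 - 2 * Re (cf \<mu> y)"
      using char_integrable'[OF \<mu> y] by (simp add: sol_cf_def prob_space integral_Re)
    finally show ?thesis by simp
  qed
  have le: "d (x + y) X \<le> d x X + d y X" if "X \<in> solenoid a" for X
  proof -
    have "chr (x + y) X - 1 = chr x X * (chr y X - 1) + (chr x X - 1)"
      using char_add[OF xy that] by (simp add: algebra_simps)
    then have "d (x + y) X \<le> norm (chr x X * (chr y X - 1)) + norm (chr x X - 1)"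
      unfolding d_def by (metis norm_triangle_ineq)
    then show ?thesis using norm_char[OF xy(1) that] by (simp add: d_def norm_mult)
  qed
  have "(\<integral>X. (d (x + y) X)\<^sup>2 \<partial>\<mu>) \<le> (\<integral>X. (d x X + d y X)\<^sup>2 \<partial>\<mu>)"
  proof (rule integral_mono)
    show "integrable \<mu> (\<lambda>X. (d (x + y) X)\<^sup>2)"
      using int[of "x + y" "x + y"] xy by (simp add: power2_eq_square dual_add)
    show "integrable \<mu> (\<lambda>X. (d x X + d y X)\<^sup>2)"
    proof -
      have "(\<lambda>X. (d x X + d y X)\<^sup>2) = (\<lambda>X. d x X * d x X + d y X * d y X + 2 * (d x X * d y X))"
        by (simp add: fun_eq_iff power2_eq_square algebra_simps)
      then show ?thesis using int[OF xy] int[of x x] int[of y y] xy by simp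
    qed
    show "(d (x + y) X)\<^sup>2 \<le> (d x X + d y X)\<^sup>2" if "X \<in> space \<mu>" for X
      using le[of X] that by (intro power_mono) (auto simp: sol_prob_space[OF \<mu>] d_def)
  qed
  then have "sqrt (\<integral>X. (d (x + y) X)\<^sup>2 \<partial>\<mu>) \<le> sqrt (\<integral>X. (d x X + d y X)\<^sup>2 \<partial>\<mu>)" by simp
  also have "\<dots> \<le> sqrt (\<integral>X. (d x X)\<^sup>2 \<partial>\<mu>) + sqrt (\<integral>X. (d y X)\<^sup>2 \<partial>\<mu>)"
    using int[OF xy] int[of x x] int[of y y] xy by (intro integral_L2_triangle) (simp_all add: power2_eq_square)
  finally have "sqrt 2 * sqrt (1 - Re (cf \<mu> (x + y))) \<le> sqrt 2 * sqrt (1 - Re (cf \<mu> x)) + sqrt 2 * sqrt (1 - Re (cf \<mu> y))"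
    unfolding d2[OF xy(1)] d2[OF xy(2)] d2[OF dual_add[OF xy]] real_sqrt_mult .
  then show ?thesis by (simp flip: distrib_left)
qed

text \<open>Symmetry is phrased with images under negation. As negation is an involution these are
  preimages, so \<open>\<mu>\<close> equals its image under negation and its characteristic function
  equals its own conjugate.\<close>

lemma cf_symmetric:
  assumes \<mu>: "sol_prob \<mu>" and sym: "sol_symmetric a \<mu>" and y: "y \<in> H"
  shows "cf \<mu> (- y) = cf \<mu> y" "Im (cf \<mu> y) = 0"
proof -
  have nm: "sol_neg a \<in> measurable \<mu> (sol_borel a)"
    unfolding sol_prob_measurable[OF \<mu>] by (rule sol_neg_measurable)
  have invol: "sol_neg a (sol_neg a X) = X" if "X \<in> solenoid a" for X
    using that by (intro coord_inj) (auto simp: fun_eq_iff coord_neg)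
  have "distr \<mu> (sol_borel a) (sol_neg a) = \<mu>"
  proof (rule measure_eqI)
    fix B assume "B \<in> sets (distr \<mu> (sol_borel a) (sol_neg a))"
    then have B: "B \<in> sets (sol_borel a)" by simp
    then have "B \<subseteq> solenoid a" using sets.sets_into_space by fastforce
    then have "sol_neg a -` B \<inter> space \<mu> = sol_neg a ` B"
      using invol by (force simp: sol_prob_space[OF \<mu>] image_iff)
    then have "emeasure (distr \<mu> (sol_borel a) (sol_neg a)) B = emeasure \<mu> (sol_neg a ` B)"
      using emeasure_distr[OF nm B] by simp
    also have "\<dots> = emeasure \<mu> B" using sym B \<mu> by (auto simp: sol_symmetric_def sol_prob_def)
    finally show "emeasure (distr \<mu> (sol_borel a) (sol_neg a)) B = emeasure \<mu> B" .
  qed (use \<mu> in \<open>simp add: sol_prob_def\<close>)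
  then have "cf \<mu> y = (\<integral>X. chr y (sol_neg a X) \<partial>\<mu>)" using cf_distr[OF nm y] by simp
  also have "\<dots> = (\<integral>X. cnj (chr y X) \<partial>\<mu>)"
    by (intro Bochner_Integration.integral_cong) (auto simp: sol_prob_space[OF \<mu>] char_sol_neg y)
  also have "\<dots> = cnj (cf \<mu> y)" by (simp add: sol_cf_def)
  finally have eq: "cf \<mu> y = cnj (cf \<mu> y)" .
  then show "Im (cf \<mu> y) = 0" by (metis add.inverse_neutral cnj.simps(2) eq_neg_iff_add_eq_0 mult_2 mult_eq_0_iff zero_neq_numeral)
  show "cf \<mu> (- y) = cf \<mu> y" using cf_minus[OF \<mu> y] eq by simp
qed

end

section \<open>The functional equation\<close>

context adic_seq
begin

text \<open>The left form has characteristic function \<open>cf \<mu> (2 * y)\<close>. For the right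
  form, splitting by the value of \<open>\<alpha>\<close> averages
  \<open>(cf \<mu> y)\<^sup>2\<close> and \<open>(cf \<mu> y)\<^sup>2 * cf \<mu> (2 * y)\<close>
  with equal weights.\<close>

lemma forms_identically_distributed_iff:
  fixes \<xi> :: "nat \<Rightarrow> 'w \<Rightarrow> sol" and \<alpha> :: "'w \<Rightarrow> nat"
  assumes M: "prob_space M"
    and \<xi>_meas: "\<forall>i\<in>{1,2,3}. \<xi> i \<in> measurable M (sol_borel a)"
    and \<xi>_indep: "prob_space.indep_vars M (\<lambda>_. sol_borel a) \<xi> {1,2,3}"
    and \<xi>_distr: "\<forall>i\<in>{1,2,3}. distr M (sol_borel a) (\<xi> i) = \<mu>"
    and \<alpha>_meas: "\<alpha> \<in> measurable M (count_space UNIV)"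
    and \<alpha>_bern: "measure M {\<omega>\<in>space M. \<alpha> \<omega> = 0} = 1/2"
                 "measure M {\<omega>\<in>space M. \<alpha> \<omega> = 1} = 1/2"
    and \<alpha>_indep: "prob_space.indep_set M
        (sigma_sets (space M) {(\<lambda>\<omega>. (\<xi> 1 \<omega>, \<xi> 2 \<omega>, \<xi> 3 \<omega>)) -` A \<inter> space M | A.
            A \<in> sets (sol_borel a \<Otimes>\<^sub>M sol_borel a \<Otimes>\<^sub>M sol_borel a)})
        (sigma_sets (space M) {\<alpha> -` A \<inter> space M | A. A \<in> sets (count_space UNIV)})"
  shows "distr M (sol_borel a) (\<lambda>\<omega>. sol_mult a 2 (\<xi> 1 \<omega>)) =
           distr M (sol_borel a)
             (\<lambda>\<omega>. sol_add a (sol_add a (\<xi> 1 \<omega>) (\<xi> 2 \<omega>)) (sol_mult a (2 * \<alpha> \<omega>) (\<xi> 3 \<omega>)))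
     \<longleftrightarrow> (\<forall>y\<in>H. 2 * cf \<mu> (2 * y) = (cf \<mu> y)\<^sup>2 * (1 + cf \<mu> (2 * y)))"
    (is "distr M _ ?L = distr M _ ?R \<longleftrightarrow> _")
proof -
  interpret prob_space M by fact
  have indep_set_mono: "indep_set A' B'" if "indep_set A B" "A' \<subseteq> A" "B' \<subseteq> B" for A A' B B'
    using that unfolding indep_sets2_eq by blast
  have \<xi>m: "\<xi> i \<in> measurable M (sol_borel a)" if "i \<in> {1,2,3}" for i using \<xi>_meas that by blast
  have \<xi>s: "\<xi> i \<omega> \<in> solenoid a" if "i \<in> {1,2,3}" "\<omega> \<in> space M" for i \<omega>
    using measurable_space[OF \<xi>m[OF that(1)] that(2)] by simp
  have Lm: "?L \<in> measurable M (sol_borel a)"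
    by (rule measurable_compose[OF \<xi>m sol_mult_measurable]) simp
  have add_m: "(\<lambda>\<omega>. sol_add a (f \<omega>) (g \<omega>)) \<in> measurable M (sol_borel a)"
    if "f \<in> measurable M (sol_borel a)" "g \<in> measurable M (sol_borel a)" for f g
    using measurable_compose[OF measurable_Pair[OF that] sol_add_measurable] by simp
  have mult_m: "(\<lambda>\<omega>. sol_mult a (2 * \<alpha> \<omega>) (\<xi> 3 \<omega>)) \<in> measurable M (sol_borel a)"
    by (rule measurable_compose_countable[OF measurable_compose[OF \<xi>m sol_mult_measurable] \<alpha>_meas]) simp
  have Rm: "?R \<in> measurable M (sol_borel a)"
    by (intro add_m mult_m \<xi>m) simp_all
  have cf_\<mu>: "cf \<mu> y = (\<integral>\<omega>. chr y (\<xi> i \<omega>) \<partial>M)" if "i \<in> {1,2,3}" "y \<in> H" for i y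
    using cf_distr[OF \<xi>m[OF that(1)] that(2)] bspec[OF \<xi>_distr that(1)] by simp
  have cf_L: "cf (distr M (sol_borel a) ?L) y = cf \<mu> (2 * y)" if y: "y \<in> H" for y
  proof -
    have "cf (distr M (sol_borel a) ?L) y = (\<integral>\<omega>. chr (2 * y) (\<xi> 1 \<omega>) \<partial>M)"
      unfolding cf_distr[OF Lm y] using y
      by (intro Bochner_Integration.integral_cong) (simp_all add: \<xi>s char_sol_mult char_double)
    then show ?thesis using cf_\<mu>[of 1 "2 * y"] y by (simp add: dual_double)
  qed
  have cf_R: "cf (distr M (sol_borel a) ?R) y = (cf \<mu> y)\<^sup>2 * (1 + cf \<mu> (2 * y)) / 2" if y: "y \<in> H" for y
  proof -
    \<comment> \<open>On the event \<open>\<alpha> = j\<close>, for \<open>j\<close> equal to 0 or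
      1, the character \<open>y\<close> of the right form is the product of the characters
      \<open>t j i\<close> of the \<open>\<xi> i\<close>: the third argument contributes the trivial
      character or the doubled one.\<close>
    define t where "t j i = (if i = (3::nat) then (if j = (0::nat) then 0 else 2 * y) else y)" for i j
    have tH: "t j i \<in> H" for i j using y by (simp add: t_def dual_double)
    define G where "G j \<omega> = (\<Prod>i\<in>{1,2,3}. chr (t j i) (\<xi> i \<omega>))" for j \<omega>
    define I where "I j \<omega> = (if \<alpha> \<omega> = j then 1 else 0 :: complex)" for j \<omega>
    have G_int: "integral\<^sup>L M (G j) = (\<Prod>i\<in>{1,2,3}. cf \<mu> (t j i))" and G_able: "integrable M (G j)" for j
    proof -
      have ind: "indep_vars (\<lambda>_. borel) (\<lambda>i \<omega>. chr (t j i) (\<xi> i \<omega>)) {1,2,3}"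
        by (rule indep_vars_compose2[OF \<xi>_indep]) (rule char_measurable[OF tH])
      have int: "integrable M (\<lambda>\<omega>. chr (t j i) (\<xi> i \<omega>))" if "i \<in> {1,2,3}" for i
        by (rule char_integrable[OF M \<xi>m[OF that] tH])
      show "integrable M (G j)" unfolding G_def by (rule indep_vars_integrable[OF _ ind int]) simp_all
      have "integral\<^sup>L M (G j) = (\<Prod>i\<in>{1,2,3}. \<integral>\<omega>. chr (t j i) (\<xi> i \<omega>) \<partial>M)"
        unfolding G_def by (rule indep_vars_lebesgue_integral[OF _ ind int]) simp_all
      also have "\<dots> = (\<Prod>i\<in>{1,2,3}. cf \<mu> (t j i))"
        by (rule prod.cong) (simp_all only: cf_\<mu> tH simp_thms)
      finally show "integral\<^sup>L M (G j) = (\<Prod>i\<in>{1,2,3}. cf \<mu> (t j i))" .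
    qed
    have \<mu>: "sol_prob \<mu>" using sol_prob_distr[OF M \<xi>m[of 1]] \<xi>_distr by simp
    have G0: "integral\<^sup>L M (G 0) = (cf \<mu> y)\<^sup>2" and G1: "integral\<^sup>L M (G 1) = (cf \<mu> y)\<^sup>2 * cf \<mu> (2 * y)"
      unfolding G_int by (simp_all add: t_def cf_zero[OF \<mu>] power2_eq_square)
    have I_meas: "{\<omega> \<in> space M. \<alpha> \<omega> = j} \<in> events" for j
      using measurable_sets[OF \<alpha>_meas, of "{j}"] by (simp add: vimage_def Int_def conj_commute)
    have I_ind: "I j \<omega> = of_real (indicator {\<omega> \<in> space M. \<alpha> \<omega> = j} \<omega>)" if "\<omega> \<in> space M" for j \<omega>
      using that by (simp add: I_def)
    have I_able: "integrable M (I j)" for j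
    proof -
      have "integrable M (\<lambda>\<omega>. complex_of_real (indicator {\<omega> \<in> space M. \<alpha> \<omega> = j} \<omega>))"
        using I_meas by (intro integrable_of_real integrable_real_indicator) (auto simp: emeasure_eq_measure)
      then show ?thesis by (subst Bochner_Integration.integrable_cong[OF refl I_ind]) auto
    qed
    have I_int: "integral\<^sup>L M (I j) = of_real (prob {\<omega> \<in> space M. \<alpha> \<omega> = j})" for j
    proof -
      have "integral\<^sup>L M (I j) = (\<integral>\<omega>. complex_of_real (indicator {\<omega> \<in> space M. \<alpha> \<omega> = j} \<omega>) \<partial>M)"
        by (rule Bochner_Integration.integral_cong[OF refl I_ind])
      then show ?thesis using I_meas[of j] by (simp add: Int_absorb2 sets.sets_into_space)
    qed
    have pair: "(\<lambda>\<omega>. (\<xi> 1 \<omega>, \<xi> 2 \<omega>, \<xi> 3 \<omega>)) \<in> measurable M (sol_borel a \<Otimes>\<^sub>M sol_borel a \<Otimes>\<^sub>M sol_borel a)"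
      by (intro measurable_Pair \<xi>m) simp_all
    have GI: "(\<integral>\<omega>. G j \<omega> * I j \<omega> \<partial>M) = integral\<^sup>L M (G j) * integral\<^sup>L M (I j)"
      and GI_able: "integrable M (\<lambda>\<omega>. G j \<omega> * I j \<omega>)" for j
    proof -
      \<comment> \<open>Factoring \<open>G j\<close> through the random vector places its
        sigma-algebra inside that of the vector, so the assumed independence from
        \<open>\<alpha>\<close> passes to \<open>G j\<close> and \<open>I j\<close>.\<close>
      define g where "g p = chr (t j 1) (fst p) * (chr (t j 2) (fst (snd p)) * chr (t j 3) (snd (snd p)))" for p
      have gm: "g \<in> borel_measurable (sol_borel a \<Otimes>\<^sub>M sol_borel a \<Otimes>\<^sub>M sol_borel a)"
        unfolding g_def
        by (intro borel_measurable_times measurable_compose[OF _ char_measurable[OF tH]] measurable_fst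
            measurable_compose[OF measurable_snd measurable_fst] measurable_compose[OF measurable_snd measurable_snd])
      let ?X = "\<lambda>\<omega>. (\<xi> 1 \<omega>, \<xi> 2 \<omega>, \<xi> 3 \<omega>)"
      have Gg: "G j = (\<lambda>\<omega>. g (?X \<omega>))" by (simp add: fun_eq_iff g_def G_def)
      have subG: "{G j -` A \<inter> space M | A. A \<in> sets borel} \<subseteq>
          {?X -` A \<inter> space M | A. A \<in> sets (sol_borel a \<Otimes>\<^sub>M sol_borel a \<Otimes>\<^sub>M sol_borel a)}"
      proof clarify
        fix A :: "complex set" assume A: "A \<in> sets borel"
        have "G j -` A \<inter> space M =
            ?X -` (g -` A \<inter> space (sol_borel a \<Otimes>\<^sub>M sol_borel a \<Otimes>\<^sub>M sol_borel a)) \<inter> space M"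
          using measurable_space[OF pair] by (auto simp: Gg)
        then show "\<exists>B. G j -` A \<inter> space M = ?X -` B \<inter> space M \<and>
            B \<in> sets (sol_borel a \<Otimes>\<^sub>M sol_borel a \<Otimes>\<^sub>M sol_borel a)"
          using measurable_sets[OF gm A] by blast
      qed
      have subI: "{I j -` A \<inter> space M | A. A \<in> sets borel} \<subseteq> {\<alpha> -` A \<inter> space M | A. A \<in> sets (count_space UNIV)}"
      proof clarify
        fix A :: "complex set"
        have "I j -` A \<inter> space M = \<alpha> -` {k. (if k = j then 1 else 0) \<in> A} \<inter> space M"
          by (auto simp: I_def)
        then show "\<exists>B. I j -` A \<inter> space M = \<alpha> -` B \<inter> space M \<and> B \<in> sets (count_space UNIV)"
          by (intro exI[of _ "{k. (if k = j then 1 else 0) \<in> A}"]) simp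
      qed
      have "indep_set (sigma_sets (space M) {G j -` A \<inter> space M | A. A \<in> sets borel})
          (sigma_sets (space M) {I j -` A \<inter> space M | A. A \<in> sets borel})"
        by (rule indep_set_mono[OF \<alpha>_indep sigma_sets_mono'[OF subG] sigma_sets_mono'[OF subI]])
      then have "indep_var borel (G j) borel (I j)"
        unfolding indep_var_eq
        using borel_measurable_integrable[OF G_able] borel_measurable_integrable[OF I_able] by blast
      from indep_var_lebesgue_integral[OF this G_able I_able] indep_var_integrable[OF this G_able I_able]
      show "(\<integral>\<omega>. G j \<omega> * I j \<omega> \<partial>M) = integral\<^sup>L M (G j) * integral\<^sup>L M (I j)"
        "integrable M (\<lambda>\<omega>. G j \<omega> * I j \<omega>)" by auto
    qed
    \<comment> \<open>The two probabilities add up to 1, so other values of \<open>\<alpha>\<close>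
      form a null event.\<close>
    have "AE \<omega> in M. \<alpha> \<omega> = 0 \<or> \<alpha> \<omega> = 1"
    proof -
      have "prob ({\<omega>\<in>space M. \<alpha> \<omega> = 0} \<union> {\<omega>\<in>space M. \<alpha> \<omega> = 1}) =
          prob {\<omega>\<in>space M. \<alpha> \<omega> = 0} + prob {\<omega>\<in>space M. \<alpha> \<omega> = 1}"
        by (rule finite_measure_Union[OF I_meas I_meas]) auto
      also have "{\<omega>\<in>space M. \<alpha> \<omega> = 0} \<union> {\<omega>\<in>space M. \<alpha> \<omega> = 1} = {\<omega>\<in>space M. \<alpha> \<omega> = 0 \<or> \<alpha> \<omega> = 1}" by auto
      finally have "prob {\<omega>\<in>space M. \<alpha> \<omega> = 0 \<or> \<alpha> \<omega> = 1} = 1"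
        unfolding \<alpha>_bern by simp
      moreover have "{\<omega>\<in>space M. \<alpha> \<omega> = 0 \<or> \<alpha> \<omega> = 1} \<in> events"
        using sets.Un[OF I_meas[of 0] I_meas[of 1]] by (simp add: Collect_disj_eq[symmetric] conj_disj_distribL[symmetric])
      ultimately show ?thesis by (subst prob_Collect_eq_1[symmetric])
    qed
    moreover have "AE \<omega> in M. \<omega> \<in> space M" by simp
    ultimately have "AE \<omega> in M. chr y (?R \<omega>) = G 0 \<omega> * I 0 \<omega> + G 1 \<omega> * I 1 \<omega>"
    proof eventually_elim
      case (elim \<omega>)
      then have s: "\<xi> 1 \<omega> \<in> solenoid a" "\<xi> 2 \<omega> \<in> solenoid a" "\<xi> 3 \<omega> \<in> solenoid a" using \<xi>s by auto
      then have "chr y (?R \<omega>) = chr y (\<xi> 1 \<omega>) * chr y (\<xi> 2 \<omega>) * chr y (\<xi> 3 \<omega>) ^ (2 * \<alpha> \<omega>)"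
        using y by (simp add: char_sol_add char_sol_mult)
      then show ?case
        using elim(1) s char_double[OF y s(3)] by (auto simp: G_def I_def t_def)
    qed
    then have "(\<integral>\<omega>. chr y (?R \<omega>) \<partial>M) = (\<integral>\<omega>. G 0 \<omega> * I 0 \<omega> + G 1 \<omega> * I 1 \<omega> \<partial>M)"
      using GI_able measurable_compose[OF Rm char_measurable[OF y]]
      by (intro integral_cong_AE) auto
    also have "\<dots> = (\<integral>\<omega>. G 0 \<omega> * I 0 \<omega> \<partial>M) + (\<integral>\<omega>. G 1 \<omega> * I 1 \<omega> \<partial>M)"
      by (rule Bochner_Integration.integral_add[OF GI_able GI_able])
    also have "\<dots> = (cf \<mu> y)\<^sup>2 * (1 + cf \<mu> (2 * y)) / 2"
      unfolding GI G0 G1 I_int \<alpha>_bern by (simp add: algebra_simps add_divide_distrib)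
    finally show ?thesis using cf_distr[OF Rm y] by simp
  qed
  have half_eq: "2 * A = C \<longleftrightarrow> A = C / 2" for A C :: complex by auto
  show ?thesis
    unfolding half_eq
  proof
    assume eq: "distr M (sol_borel a) ?L = distr M (sol_borel a) ?R"
    show "\<forall>y\<in>H. cf \<mu> (2 * y) = (cf \<mu> y)\<^sup>2 * (1 + cf \<mu> (2 * y)) / 2"
    proof
      fix y assume y: "y \<in> H"
      show "cf \<mu> (2 * y) = (cf \<mu> y)\<^sup>2 * (1 + cf \<mu> (2 * y)) / 2"
        using cf_L[OF y] cf_R[OF y] unfolding eq by (rule trans[OF sym])
    qed
  next
    assume eq: "\<forall>y\<in>H. cf \<mu> (2 * y) = (cf \<mu> y)\<^sup>2 * (1 + cf \<mu> (2 * y)) / 2"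
    show "distr M (sol_borel a) ?L = distr M (sol_borel a) ?R"
    proof (rule cf_eqI)
      fix y assume y: "y \<in> H"
      show "cf (distr M (sol_borel a) ?L) y = cf (distr M (sol_borel a) ?R) y"
        unfolding cf_L[OF y] cf_R[OF y] by (rule bspec[OF eq y])
    qed (rule sol_prob_distr[OF M Lm] sol_prob_distr[OF M Rm])+
  qed
qed

end

section \<open>Annihilators and Haar distributions\<close>

context adic_seq
begin

lemma continuous_map_char:
  assumes "y \<in> H"
  shows "continuous_map (sol_top a) euclidean (chr y)"
proof -
  obtain k n where y: "y = real_of_int k / real (P n)" using assms by (rule dualE)
  \<comment> \<open>Negative powers are replaced by powers of the conjugate. They agree on the
    circle, and this version is continuous on the whole sequence space, including sequences with
    zero entries.\<close>
  define h :: "(nat \<Rightarrow> complex) \<Rightarrow> complex" where "h w = (if k \<ge> 0 then w n ^ nat k else cnj (w n) ^ nat (- k))" for w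
  have "continuous_on UNIV h"
    unfolding h_def
    by (cases "k \<ge> 0") (simp_all only: if_True if_False,
      (intro continuous_on_power continuous_on_cnj continuous_on_product_coordinates)+)
  then have "continuous_map (sol_top a) euclidean (h \<circ> \<Phi>)"
    by (intro continuous_map_compose[OF continuous_map_coord]) simp
  moreover have "(h \<circ> \<Phi>) X = chr y X" if "X \<in> topspace (sol_top a)" for X
  proof (cases "k \<ge> 0")
    case True
    then show ?thesis using that by (simp add: h_def y char_frac power_int_def)
  next
    case False
    have "chr y X = cnj (chr (- y) X)" using char_minus[OF dual_minus[OF assms], of X] that by simp
    moreover have "- y = real_of_int (int (nat (- k))) / real (P n)" using False by (simp add: y)
    ultimately show ?thesis using False that char_frac[of X "int (nat (- k))" n] by (simp add: h_def power_int_def)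
  qed
  ultimately show ?thesis by (rule continuous_map_eq)
qed

definition annihilator :: "real set \<Rightarrow> sol set" where
  "annihilator S = {X \<in> solenoid a. \<forall>y\<in>S. chr y X = 1}"

lemma annihilator_subgroup:
  assumes "S \<subseteq> H"
  shows "sol_subgroup a (annihilator S)"
  unfolding sol_subgroup_def annihilator_def
proof (intro conjI ballI)
  show "sol_zero a \<in> {X \<in> solenoid a. \<forall>y\<in>S. chr y X = 1}"
    using assms by (auto simp: sol_dual_def char_frac subset_iff)
qed (use assms in \<open>auto simp: char_sol_add char_sol_neg subset_iff\<close>)

lemma annihilator_compact:
  assumes "S \<subseteq> H"
  shows "compactin (sol_top a) (annihilator S)"
proof -
  have cl: "closedin (sol_top a) (annihilator S)"
  proof -
    have "annihilator S = (if S = {} then solenoid a else (\<Inter>y\<in>S. {X \<in> topspace (sol_top a). chr y X \<in> {1}}))"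
      by (auto simp: annihilator_def)
    moreover have "closedin (sol_top a) {X \<in> topspace (sol_top a). chr y X \<in> {1}}" if "y \<in> S" for y
      using that assms by (intro closedin_continuous_map_preimage[OF continuous_map_char]) auto
    ultimately show ?thesis
      using closedin_topspace[of "sol_top a"] by (auto intro!: closedin_Inter simp del: mem_Collect_eq)
  qed
  show ?thesis
    by (rule closed_compactin[OF compactin_solenoid _ cl]) (simp add: annihilator_def)
qed

text \<open>Every half \<open>Y\<close> of an annihilated \<open>X\<close> is itself annihilated:
  for \<open>y\<close> in \<open>S\<close>, \<open>chr y Y\<close> is the square of
  \<open>chr (y / 2) Y\<close>, which equals \<open>chr (y / 2) X\<close>, and \<open>y / 2\<close>
  is again in \<open>S\<close>.\<close>

lemma annihilator_corwin:
  assumes no_order2: "\<forall>X\<in>solenoid a. sol_add a X X = sol_zero a \<longrightarrow> X = sol_zero a"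
    and S: "S \<subseteq> H" "\<And>y. y \<in> S \<Longrightarrow> y / 2 \<in> S"
  shows "sol_corwin a (annihilator S)"
  unfolding sol_corwin_def
proof (intro subset_antisym subsetI)
  fix X assume "X \<in> sol_mult a 2 ` annihilator S"
  then show "X \<in> annihilator S" using S by (auto simp: annihilator_def char_sol_mult subset_iff)
next
  fix X assume X: "X \<in> annihilator S"
  then obtain Y where Y: "Y \<in> solenoid a" "sol_mult a 2 Y = X"
    using sol_half_exists[OF no_order2] by (auto simp: annihilator_def)
  have "chr y Y = 1" if "y \<in> S" for y
  proof -
    have h: "y / 2 \<in> S" "y / 2 \<in> H" using S that by auto
    have "chr y Y = (chr (y / 2) Y)\<^sup>2" using char_double[OF h(2) Y(1)] by simp
    also have "\<dots> = chr (y / 2) X" using char_sol_mult[OF h(2) Y(1), of 2] Y by simp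
    finally show ?thesis using X h by (simp add: annihilator_def)
  qed
  then have "Y \<in> annihilator S" using Y by (simp add: annihilator_def)
  then show "X \<in> sol_mult a 2 ` annihilator S" using Y by blast
qed

lemma translate_measurable:
  assumes "X \<in> solenoid a"
  shows "sol_add a X \<in> measurable (sol_borel a) (sol_borel a)"
  using measurable_compose[OF measurable_Pair1' sol_add_measurable, of X] assms by simp

lemma translate_inverse:
  assumes "X \<in> solenoid a" "Y \<in> solenoid a"
  shows "sol_add a (sol_neg a X) (sol_add a X Y) = Y" "sol_add a X (sol_add a (sol_neg a X) Y) = Y"
proof -
  have c: "cnj (\<Phi> X n) * \<Phi> X n = 1" "\<Phi> X n * cnj (\<Phi> X n) = 1" for n
    using norm_coord[OF assms(1), of n] complex_norm_square[of "\<Phi> X n"] by (simp_all add: mult.commute)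
  show "sol_add a (sol_neg a X) (sol_add a X Y) = Y"
    using assms by (intro coord_inj ext) (simp_all add: coord_add coord_neg c flip: mult.assoc)
  show "sol_add a X (sol_add a (sol_neg a X) Y) = Y"
    using assms by (intro coord_inj ext) (simp_all add: coord_add coord_neg c flip: mult.assoc)
qed

text \<open>Haar invariance is stated with images of translations, image measures use preimages;
  this passes from one to the other.\<close>

lemma translate_image:
  assumes "X \<in> solenoid a" "B \<subseteq> solenoid a"
  shows "sol_add a X ` B = sol_add a (sol_neg a X) -` B \<inter> solenoid a"
proof (intro subset_antisym subsetI)
  fix Y assume "Y \<in> sol_add a X ` B"
  then show "Y \<in> sol_add a (sol_neg a X) -` B \<inter> solenoid a"
    using assms translate_inverse(1) by (auto simp: subset_iff)
next
  fix Y assume Y: "Y \<in> sol_add a (sol_neg a X) -` B \<inter> solenoid a"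
  then have "Y = sol_add a X (sol_add a (sol_neg a X) Y)" using translate_inverse(2) assms by simp
  then show "Y \<in> sol_add a X ` B" using Y by blast
qed

lemma cf_translate:
  assumes "sol_prob m" "X \<in> solenoid a" "y \<in> H"
  shows "cf (distr m (sol_borel a) (sol_add a X)) y = chr y X * cf m y"
proof -
  have tm: "sol_add a X \<in> measurable m (sol_borel a)"
    unfolding sol_prob_measurable[OF assms(1)] by (rule translate_measurable[OF assms(2)])
  have "cf (distr m (sol_borel a) (sol_add a X)) y = (\<integral>Y. chr y X * chr y Y \<partial>m)"
    unfolding cf_distr[OF tm assms(3)] using assms
    by (intro Bochner_Integration.integral_cong) (auto simp: sol_prob_space char_sol_add)
  then show ?thesis by (simp add: sol_cf_def)
qed

lemma compl_compact_in_sets: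
  assumes "compactin (sol_top a) K"
  shows "solenoid a - K \<in> sets (sol_borel a)"
proof -
  have "openin (sol_top a) (solenoid a - K)"
    using compactin_imp_closedin[OF assms] by (simp add: closedin_def)
  then obtain V where "open V" "solenoid a - K = \<Phi> -` V \<inter> solenoid a" unfolding openin_sol_top_iff by blast
  then show ?thesis using sets_sol_borel by auto
qed

text \<open>Concentration: for \<open>y\<close> in \<open>S\<close> the nonnegative function
  \<open>1 - Re (chr y X)\<close> has integral 0, and countably many \<open>y\<close> are combined.
  Invariance: translating by \<open>X\<close> multiplies the characteristic function by
  \<open>chr y X\<close>, which is 1 on \<open>S\<close>, while off \<open>S\<close> the function is
  0.\<close>

lemma annihilator_haar:
  assumes S: "S \<subseteq> H" and m: "sol_prob m" "\<And>y. y \<in> H \<Longrightarrow> cf m y = (if y \<in> S then 1 else 0)"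
  shows "sol_haar a (annihilator S) m"
  unfolding sol_haar_def
proof (intro conjI ballI)
  interpret prob_space m using m by (simp add: sol_prob_def)
  show "prob_space m" "sets m = sets (sol_borel a)" using m by (auto simp: sol_prob_def)
  have "AE X in m. chr y X = 1" if y: "y \<in> S" for y
  proof -
    have yH: "y \<in> H" using y S by blast
    have norm: "AE X in m. norm (chr y X) = 1"
      using yH by (intro AE_I2) (simp add: sol_prob_space[OF m(1)])
    have int: "integrable m (\<lambda>X. 1 - Re (chr y X))"
      using char_integrable'[OF m(1) yH] by simp
    have "(\<integral>X. 1 - Re (chr y X) \<partial>m) = 1 - Re (cf m y)"
      using char_integrable'[OF m(1) yH] by (simp add: sol_cf_def prob_space integral_Re)
    then have "(\<integral>X. 1 - Re (chr y X) \<partial>m) = 0" using m(2)[OF yH] y by simp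
    moreover have "AE X in m. 0 \<le> 1 - Re (chr y X)"
      using norm by eventually_elim (metis abs_Re_le_cmod abs_le_D1 diff_ge_0_iff_ge)
    ultimately have "AE X in m. 1 - Re (chr y X) = 0"
      using integral_nonneg_eq_0_iff_AE[OF int] by blast
    with norm show ?thesis
    proof eventually_elim
      case (elim X)
      then have "Re (chr y X) = 1" by simp
      moreover from this have "Im (chr y X) = 0" using elim by (simp add: cmod_def)
      ultimately show ?case by (simp add: complex_eq_iff)
    qed
  qed
  then have "AE X in m. \<forall>y\<in>S. chr y X = 1"
    using countable_subset[OF S countable_dual] by (subst AE_ball_countable) auto
  moreover have "AE X in m. X \<in> solenoid a" using sol_prob_space[OF m(1)] by (intro AE_I2) simp
  ultimately have "AE X in m. X \<notin> solenoid a - annihilator S"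
    by eventually_elim (simp add: annihilator_def)
  moreover have "solenoid a - annihilator S \<in> sets m"
    using compl_compact_in_sets[OF annihilator_compact[OF S]] m(1) by (simp add: sol_prob_def)
  ultimately show "emeasure m (solenoid a - annihilator S) = 0"
    using AE_iff_measurable[of "solenoid a - annihilator S" m "\<lambda>X. X \<notin> solenoid a - annihilator S"]
      sol_prob_space[OF m(1)] by auto
next
  fix X B assume X: "X \<in> annihilator S" and B: "B \<in> sets m"
  have Xs: "sol_neg a X \<in> solenoid a" "X \<in> solenoid a" using X by (auto simp: annihilator_def)
  have tm: "sol_add a (sol_neg a X) \<in> measurable m (sol_borel a)"
    unfolding sol_prob_measurable[OF m(1)] by (rule translate_measurable[OF Xs(1)])
  have B': "B \<in> sets (sol_borel a)" using B m by (simp add: sol_prob_def)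
  have "distr m (sol_borel a) (sol_add a (sol_neg a X)) = m"
  proof (rule cf_eqI[OF _ m(1)])
    show "sol_prob (distr m (sol_borel a) (sol_add a (sol_neg a X)))"
      using m(1) by (intro sol_prob_distr tm) (simp add: sol_prob_def)
    fix y assume y: "y \<in> H"
    show "cf (distr m (sol_borel a) (sol_add a (sol_neg a X))) y = cf m y"
      unfolding cf_translate[OF m(1) Xs(1) y] m(2)[OF y] using X y
      by (auto simp: annihilator_def char_sol_neg)
  qed
  then have "emeasure m B = emeasure m (sol_add a (sol_neg a X) -` B \<inter> space m)"
    using emeasure_distr[OF tm B'] by simp
  also have "sol_add a (sol_neg a X) -` B \<inter> space m = sol_add a X ` B"
    using translate_image[OF Xs(2), of B] sets.sets_into_space[OF B'] by (simp add: sol_prob_space[OF m(1)])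
  finally show "emeasure m (sol_add a X ` B) = emeasure m B" by simp
qed

text \<open>If \<open>chr y X \<noteq> 1\<close> for some \<open>X\<close> in \<open>K\<close>,
  invariance under translation by \<open>X\<close> gives \<open>cf m y = chr y X * cf m y\<close>,
  so the value is 0. Otherwise the character is almost surely 1.\<close>

lemma haar_cf:
  assumes K: "sol_subgroup a K" "compactin (sol_top a) K" and m: "sol_haar a K m" and y: "y \<in> H"
  shows "cf m y = (if \<forall>X\<in>K. chr y X = 1 then 1 else 0)"
proof -
  have mp: "sol_prob m" using m by (simp add: sol_haar_def sol_prob_def)
  interpret prob_space m using m by (simp add: sol_haar_def)
  have Ks: "K \<subseteq> solenoid a" using K by (simp add: sol_subgroup_def)
  show ?thesis
  proof (cases "\<forall>X\<in>K. chr y X = 1")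
    case True
    have "solenoid a - K \<in> sets m"
      using compl_compact_in_sets[OF K(2)] mp by (simp add: sol_prob_def)
    then have "AE X in m. X \<notin> solenoid a - K"
      using m by (intro AE_not_in) (simp add: null_setsI sol_haar_def)
    moreover have "AE X in m. X \<in> solenoid a" using sol_prob_space[OF mp] by (intro AE_I2) simp
    ultimately have "AE X in m. chr y X = 1" by eventually_elim (use True in blast)
    then have "cf m y = (\<integral>X. 1 \<partial>m)"
      unfolding sol_cf_def using char_integrable'[OF mp y] by (intro integral_cong_AE) auto
    then show ?thesis using True by (simp add: prob_space)
  next
    case False
    then obtain X where X: "X \<in> K" "chr y X \<noteq> 1" by blast
    have Xs: "X \<in> solenoid a" using X Ks by blast
    have nX: "sol_neg a X \<in> K" using K(1) X by (simp add: sol_subgroup_def)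
    have nn: "sol_neg a (sol_neg a X) = X" using Xs by (intro coord_inj) (auto simp: fun_eq_iff coord_neg)
    have tm: "sol_add a X \<in> measurable m (sol_borel a)"
      unfolding sol_prob_measurable[OF mp] by (rule translate_measurable[OF Xs])
    have "distr m (sol_borel a) (sol_add a X) = m"
    proof (rule measure_eqI)
      fix B assume "B \<in> sets (distr m (sol_borel a) (sol_add a X))"
      then have B: "B \<in> sets (sol_borel a)" by simp
      have "emeasure (distr m (sol_borel a) (sol_add a X)) B = emeasure m (sol_add a X -` B \<inter> solenoid a)"
        using emeasure_distr[OF tm B] by (simp add: sol_prob_space[OF mp])
      also have "sol_add a X -` B \<inter> solenoid a = sol_add a (sol_neg a X) ` B"
        using translate_image[of "sol_neg a X" B] sets.sets_into_space[OF B] Xs nn by simp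
      also have "emeasure m \<dots> = emeasure m B"
        using m nX B by (simp add: sol_haar_def)
      finally show "emeasure (distr m (sol_borel a) (sol_add a X)) B = emeasure m B" .
    qed (use mp in \<open>simp add: sol_prob_def\<close>)
    then have "cf m y = chr y X * cf m y" using cf_translate[OF mp Xs y] by simp
    then show ?thesis using X(2) False by auto
  qed
qed

end

section \<open>Continuous lines in the solenoid and the main theorem\<close>

lemma inverse_cosh_exp: "1 / cosh x = 2 / (exp x + exp (- x))" for x :: real
  by (simp add: cosh_def)

context adic_seq
begin

definition sol_line :: "real \<Rightarrow> sol" where
  "sol_line t = sol_class a (t, adic_zero)"

lemma sol_line_closed [simp]: "sol_line t \<in> solenoid a"
  by (simp add: sol_line_def)

lemma coord_line: "\<Phi> (sol_line t) n = cis (2 * pi * (t / real (P n)))"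
  by (simp add: sol_line_def adic_exp_def)

lemma char_line:
  assumes "y \<in> H"
  shows "chr y (sol_line t) = cis (2 * pi * y * t)"
proof -
  obtain k n where "y = real_of_int k / real (P n)" using assms by (rule dualE)
  then show ?thesis by (simp add: char_frac coord_line cis_power_int mult.commute mult.left_commute)
qed

text \<open>Injectivity: equal images force \<open>s - t\<close> to be a multiple of every
  \<open>P n\<close>, and \<open>P n > n\<close> eventually exceeds
  \<open>\<bar>s - t\<bar>\<close>.\<close>

lemma sol_line_mono: "sol_cont_mono a sol_line"
  unfolding sol_cont_mono_def
proof (intro conjI allI)
  have "continuous_map euclideanreal T (\<lambda>t. (t, adic_zero))"
    by (intro continuous_map_pairedI) simp_all
  from continuous_map_compose[OF this continuous_map_sol_class]
  show "continuous_map euclideanreal (sol_top a) sol_line" by (simp add: o_def sol_line_def[abs_def])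
  show "inj sol_line"
  proof (rule injI)
    fix s t assume eq: "sol_line s = sol_line t"
    obtain n :: nat where n: "\<bar>s - t\<bar> < real n" using reals_Archimedean2 by blast
    also have "real n < real (P n)" using P_ge[of n] by simp
    finally have lt: "\<bar>(s - t) / real (P n)\<bar> < 1" by (simp add: abs_divide)
    have "cis (2 * pi * (s / real (P n))) = cis (2 * pi * (t / real (P n)))"
      using coord_line[of s n] coord_line[of t n] eq by simp
    then have "(s - t) / real (P n) \<in> \<int>" unfolding cis_2pi_eq_iff diff_divide_distrib .
    then have "(s - t) / real (P n) = 0" using lt by (rule Ints_nonzero_abs_less1)
    then show "s = t" using P_pos[of n] by (simp del: P_pos)
  qed
  show "sol_line (s + t) = sol_add a (sol_line s) (sol_line t)" for s t
    by (intro coord_inj ext) (simp_all add: coord_add coord_line cis_mult add_divide_distrib distrib_left)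
qed

lemma continuous_map_imp_measurable:
  assumes "continuous_map euclideanreal (sol_top a) \<tau>"
  shows "\<tau> \<in> measurable borel (sol_borel a)"
  unfolding measurable_sol_borel_iff
proof (intro conjI allI)
  show "\<tau> \<in> space borel \<rightarrow> solenoid a" using continuous_map_funspace[OF assms] by auto
  fix n
  have "continuous_on UNIV (\<Phi> \<circ> \<tau>)"
    using continuous_map_compose[OF assms continuous_map_coord] by simp
  from continuous_on_product_then_coordinatewise[OF this, of n]
  show "(\<lambda>t. \<Phi> (\<tau> t) n) \<in> borel_measurable borel"
    by (simp add: borel_measurable_continuous_onI)
qed

lemma decomposition_of_functional_equation:
  assumes no_order2: "\<forall>X\<in>solenoid a. sol_add a X X = sol_zero a \<longrightarrow> X = sol_zero a"
    and \<mu>: "sol_prob \<mu>" and sym: "sol_symmetric a \<mu>"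
    and eq: "\<forall>y\<in>H. 2 * cf \<mu> (2 * y) = (cf \<mu> y)\<^sup>2 * (1 + cf \<mu> (2 * y))"
  shows "\<exists>\<tau> N K m. sol_cont_mono a \<tau> \<and> hyperbolic_secant N \<and>
        sol_subgroup a K \<and> compactin (sol_top a) K \<and> sol_corwin a K \<and> sol_haar a K m \<and>
        \<mu> = sol_conv a (distr N (sol_borel a) \<tau>) m"
proof -
  define f where "f y = Re (cf \<mu> y)" for y
  have cf_f: "cf \<mu> y = of_real (f y)" if "y \<in> H" for y
    using cf_symmetric(2)[OF \<mu> sym that] by (simp add: f_def complex_eq_iff)
  have f_bound: "\<bar>f y\<bar> \<le> 1" if "y \<in> H" for y
    using abs_Re_le_cmod[of "cf \<mu> y"] norm_cf_le_1[OF \<mu> that] by (simp add: f_def)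
  have f_even: "f (- y) = f y" if "y \<in> H" for y
    using cf_symmetric(1)[OF \<mu> sym that] by (simp add: f_def)
  have f0: "f 0 = 1" by (simp add: f_def cf_zero[OF \<mu>])
  have f_double: "f (2 * y) * (2 - (f y)\<^sup>2) = (f y)\<^sup>2" if y: "y \<in> H" for y
  proof -
    have "complex_of_real (2 * f (2 * y)) = complex_of_real ((f y)\<^sup>2 * (1 + f (2 * y)))"
      using bspec[OF eq y] unfolding cf_f[OF y] cf_f[OF dual_double[OF y]] by simp
    then have "2 * f (2 * y) = (f y)\<^sup>2 * (1 + f (2 * y))" by (simp only: of_real_eq_iff)
    then show ?thesis by (simp add: algebra_simps)
  qed
  note f = cosh_doubling_on_subgroup[of H f, OF dual_zero dual_add dual_minus dual_half[OF no_order2]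
      dual_rat f0 f_bound f_even f_double cf_subadd[OF \<mu>, folded f_def]]
  define S where "S = {y \<in> H. f y \<noteq> 0}"
  have S_H: "S \<subseteq> H" and S_0: "0 \<in> S" by (auto simp: S_def f0)
  have S_add: "x + y \<in> S" if "x \<in> S" "y \<in> S" for x y
    using f(1)[of x y] that by (auto simp: S_def dual_add)
  have S_minus: "- x \<in> S" if "x \<in> S" for x using that f_even by (auto simp: S_def dual_minus)
  have S_half: "x / 2 \<in> S" if "x \<in> S" for x
    using f(3)[of x] that dual_half[OF no_order2] by (auto simp: S_def)
  obtain \<sigma> where \<sigma>: "\<And>y. y \<in> S \<Longrightarrow> f y = 1 / cosh (\<sigma> * y)" using f(2) by (auto simp: S_def)
  obtain m where m: "sol_prob m" "\<And>y. y \<in> H \<Longrightarrow> cf m y = (if y \<in> S then 1 else 0)"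
    using dual_subgroup_measure[OF S_H S_0 S_add S_minus] by blast
  \<comment> \<open>On the line, the character \<open>y\<close> is
    \<open>cis (2 * pi * y * t)\<close>; the division by \<open>2 * pi\<close> compensates for this
    factor.\<close>
  obtain N where N: "real_distribution N" "\<And>s. char N s = of_real (1 / cosh (\<sigma> / (2 * pi) * s))"
    using hyperbolic_secant_exists by blast
  interpret N: real_distribution N by (rule N(1))
  have sech: "hyperbolic_secant N"
    unfolding hyperbolic_secant_def
  proof (intro conjI exI[of _ "\<sigma> / (2 * pi)"] allI)
    show "char N s = complex_of_real (2 / (exp (\<sigma> / (2 * pi) * s) + exp (- (\<sigma> / (2 * pi)) * s)))" for s
      using N(2)[of s] unfolding inverse_cosh_exp by simp
  qed (rule N(1))
  have line_m: "sol_line \<in> measurable N (sol_borel a)"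
    using continuous_map_imp_measurable[of sol_line] sol_line_mono
    by (simp add: sol_cont_mono_def cong: measurable_cong_sets)
  have dp: "sol_prob (distr N (sol_borel a) sol_line)"
    by (rule sol_prob_distr[OF N.prob_space_axioms line_m])
  have "\<mu> = sol_conv a (distr N (sol_borel a) sol_line) m"
  proof (rule cf_eqI[OF \<mu> sol_conv_prob[OF dp m(1)]])
    fix y assume y: "y \<in> H"
    have "cf (distr N (sol_borel a) sol_line) y = (\<integral>t. cis (2 * pi * y * t) \<partial>N)"
      unfolding cf_distr[OF line_m y] by (simp add: char_line[OF y])
    also have "\<dots> = char N (2 * pi * y)" by (simp add: char_def cis_conv_exp)
    also have "\<dots> = of_real (1 / cosh (\<sigma> * y))" unfolding N(2) by simp
    finally have line: "cf (distr N (sol_borel a) sol_line) y = of_real (1 / cosh (\<sigma> * y))" .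
    \<comment> \<open>On \<open>S\<close> the Haar factor is 1 and the secant law matches
      \<open>f\<close>. Off \<open>S\<close> the Haar factor is 0, whatever the secant factor is
      there.\<close>
    show "cf \<mu> y = cf (sol_conv a (distr N (sol_borel a) sol_line) m) y"
    proof (cases "y \<in> S")
      case True
      then show ?thesis unfolding cf_conv[OF dp m(1) y] line m(2)[OF y] cf_f[OF y] by (simp add: \<sigma>)
    next
      case False
      then have "f y = 0" using y by (simp add: S_def)
      then show ?thesis unfolding cf_conv[OF dp m(1) y] m(2)[OF y] cf_f[OF y] using False by simp
    qed
  qed
  then show ?thesis
    using sol_line_mono sech annihilator_subgroup[OF S_H] annihilator_compact[OF S_H]
      annihilator_corwin[OF no_order2 S_H S_half] annihilator_haar[OF S_H m] by blast
qed

lemma functional_equation_of_decomposition: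
  assumes \<tau>: "sol_cont_mono a \<tau>" and N: "hyperbolic_secant N"
    and K: "sol_subgroup a K" "compactin (sol_top a) K" "sol_corwin a K" and m: "sol_haar a K m"
    and \<mu>: "\<mu> = sol_conv a (distr N (sol_borel a) \<tau>) m"
  shows "\<forall>y\<in>H. 2 * cf \<mu> (2 * y) = (cf \<mu> y)\<^sup>2 * (1 + cf \<mu> (2 * y))"
proof
  fix y assume y: "y \<in> H"
  have y2: "2 * y \<in> H" using y by (rule dual_double)
  obtain \<sigma> where N_rd: "real_distribution N"
    and \<sigma>: "\<And>s. char N s = of_real (1 / cosh (\<sigma> * s))"
    using N unfolding hyperbolic_secant_def by (auto simp: inverse_cosh_exp)
  interpret N: real_distribution N by (rule N_rd)
  have \<tau>_cont: "continuous_map euclideanreal (sol_top a) \<tau>"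
    and \<tau>_add: "\<And>s t. \<tau> (s + t) = sol_add a (\<tau> s) (\<tau> t)" using \<tau> by (auto simp: sol_cont_mono_def)
  have \<tau>_s: "\<tau> t \<in> solenoid a" for t using continuous_map_funspace[OF \<tau>_cont] by auto
  have \<tau>_m: "\<tau> \<in> measurable N (sol_borel a)"
    using continuous_map_imp_measurable[OF \<tau>_cont] by (simp cong: measurable_cong_sets)
  have mp: "sol_prob m" using m by (simp add: sol_haar_def sol_prob_def)
  have dp: "sol_prob (distr N (sol_borel a) \<tau>)" by (rule sol_prob_distr[OF N.prob_space_axioms \<tau>_m])
  have "continuous_on UNIV (chr y \<circ> \<tau>)"
    using continuous_map_compose[OF \<tau>_cont continuous_map_char[OF y]] by simp
  then have "continuous_on UNIV (\<lambda>t. chr y (\<tau> t))" by (simp add: o_def)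
  then obtain c where c: "\<And>t. chr y (\<tau> t) = cis (c * t)"
    by (rule continuous_real_character) (use y \<tau>_s in \<open>auto simp: \<tau>_add char_sol_add\<close>)
  have c2: "chr (2 * y) (\<tau> t) = cis (2 * c * t)" for t
    using char_double[OF y \<tau>_s] by (simp add: c power2_eq_square cis_mult algebra_simps)
  have "cf (distr N (sol_borel a) \<tau>) y = char N c"
    unfolding cf_distr[OF \<tau>_m y] c char_def by (simp add: cis_conv_exp)
  then have A1: "cf (distr N (sol_borel a) \<tau>) y = of_real (1 / cosh (\<sigma> * c))" by (simp only: \<sigma>)
  have "cf (distr N (sol_borel a) \<tau>) (2 * y) = char N (2 * c)"
    unfolding cf_distr[OF \<tau>_m y2] c2 char_def by (simp add: cis_conv_exp)
  then have A2: "cf (distr N (sol_borel a) \<tau>) (2 * y) = of_real (1 / cosh (2 * (\<sigma> * c)))"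
    by (simp add: \<sigma> mult.left_commute)
  have K_s: "K \<subseteq> solenoid a" using K by (simp add: sol_subgroup_def)
  \<comment> \<open>The character \<open>2 * y\<close> at \<open>X\<close> is the character
    \<open>y\<close> at the double of \<open>X\<close>, and doubling maps \<open>K\<close> onto
    itself. So \<open>2 * y\<close> annihilates \<open>K\<close> exactly when \<open>y\<close>
    does.\<close>
  have "(\<forall>X\<in>K. chr (2 * y) X = 1) \<longleftrightarrow> (\<forall>X\<in>K. chr y (sol_mult a 2 X) = 1)"
    using K_s y by (intro ball_cong) (auto simp: char_sol_mult char_double)
  also have "\<dots> \<longleftrightarrow> (\<forall>X\<in>(\<lambda>x. sol_mult a 2 x) ` K. chr y X = 1)" by simp
  also have "\<dots> \<longleftrightarrow> (\<forall>X\<in>K. chr y X = 1)" using K(3) by (simp add: sol_corwin_def)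
  finally have K2: "cf m (2 * y) = cf m y"
    unfolding haar_cf[OF K(1,2) m y] haar_cf[OF K(1,2) m y2] by simp
  define C where "C = cosh (\<sigma> * c)"
  have C: "C \<ge> 1" "cosh (2 * (\<sigma> * c)) = 2 * C\<^sup>2 - 1"
    by (simp_all add: C_def cosh_real_ge_1 cosh_double_cosh)
  have "C\<^sup>2 \<ge> 1" using C(1) by simp
  \<comment> \<open>The double angle formula rewritten for reciprocals: with
    \<open>D = 2 * C\<^sup>2 - 1\<close>, both sides equal \<open>2 / D\<close>.\<close>
  have real_eq: "2 * (1 / (2 * C\<^sup>2 - 1)) = (1 / C)\<^sup>2 * (1 + 1 / (2 * C\<^sup>2 - 1))"
  proof -
    define D where "D = 2 * C\<^sup>2 - 1"
    have "D > 0" using \<open>C\<^sup>2 \<ge> 1\<close> unfolding D_def by linarith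
    moreover have "C \<noteq> 0" "C\<^sup>2 = (D + 1) / 2" using C(1) by (simp_all add: D_def)
    ultimately show ?thesis unfolding D_def[symmetric] power_divide by (simp add: divide_simps)
  qed
  show "2 * cf \<mu> (2 * y) = (cf \<mu> y)\<^sup>2 * (1 + cf \<mu> (2 * y))"
  proof (cases "\<forall>X\<in>K. chr y X = 1")
    case True
    then have "cf m y = 1" by (simp add: haar_cf[OF K(1,2) m y])
    then have "cf \<mu> y = of_real (1 / C)" "cf \<mu> (2 * y) = of_real (1 / (2 * C\<^sup>2 - 1))"
      unfolding \<mu> cf_conv[OF dp mp y] cf_conv[OF dp mp y2] A1 A2 K2 C by (simp_all add: C_def)
    then show ?thesis
      using arg_cong[OF real_eq, of complex_of_real] by simp
  next
    case False
    then have "cf m y = 0" by (simp add: haar_cf[OF K(1,2) m y])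
    then show ?thesis unfolding \<mu> cf_conv[OF dp mp y] cf_conv[OF dp mp y2] K2 by simp
  qed
qed

end

theorem theorem2p4:
  fixes a :: "nat \<Rightarrow> nat"
    and M :: "'w measure"
    and \<xi> :: "nat \<Rightarrow> 'w \<Rightarrow> sol"
    and \<alpha> :: "'w \<Rightarrow> nat"
    and \<mu> :: "sol measure"
  assumes a_gt1: "\<forall>j. a j > 1"
    and no_order2: "\<forall>x\<in>solenoid a. sol_add a x x = sol_zero a \<longrightarrow> x = sol_zero a"
    and M: "prob_space M"
    and \<xi>_meas: "\<forall>i\<in>{1,2,3}. \<xi> i \<in> measurable M (sol_borel a)"
    and \<xi>_indep: "prob_space.indep_vars M (\<lambda>_. sol_borel a) \<xi> {1,2,3}"
    and \<xi>_distr: "\<forall>i\<in>{1,2,3}. distr M (sol_borel a) (\<xi> i) = \<mu>"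
    and \<mu>_sym: "sol_symmetric a \<mu>"
    and \<alpha>_meas: "\<alpha> \<in> measurable M (count_space UNIV)"
    and \<alpha>_bern: "measure M {\<omega>\<in>space M. \<alpha> \<omega> = 0} = 1/2"
                 "measure M {\<omega>\<in>space M. \<alpha> \<omega> = 1} = 1/2"
    and \<alpha>_indep: "prob_space.indep_set M
        (sigma_sets (space M) {(\<lambda>\<omega>. (\<xi> 1 \<omega>, \<xi> 2 \<omega>, \<xi> 3 \<omega>)) -` A \<inter> space M | A.
            A \<in> sets (sol_borel a \<Otimes>\<^sub>M sol_borel a \<Otimes>\<^sub>M sol_borel a)})
        (sigma_sets (space M) {\<alpha> -` A \<inter> space M | A. A \<in> sets (count_space UNIV)})"
  shows "distr M (sol_borel a) (\<lambda>\<omega>. sol_mult a 2 (\<xi> 1 \<omega>)) =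
           distr M (sol_borel a)
             (\<lambda>\<omega>. sol_add a (sol_add a (\<xi> 1 \<omega>) (\<xi> 2 \<omega>)) (sol_mult a (2 * \<alpha> \<omega>) (\<xi> 3 \<omega>)))
     \<longleftrightarrow>
     (\<exists>\<tau> N K m. sol_cont_mono a \<tau> \<and> hyperbolic_secant N \<and>
        sol_subgroup a K \<and> compactin (sol_top a) K \<and> sol_corwin a K \<and> sol_haar a K m \<and>
        \<mu> = sol_conv a (distr N (sol_borel a) \<tau>) m)"
proof -
  interpret adic_seq a using a_gt1 by unfold_locales simp
  have \<mu>_eq: "distr M (sol_borel a) (\<xi> 1) = \<mu>" and "\<xi> 1 \<in> measurable M (sol_borel a)"
    using \<xi>_distr \<xi>_meas by simp_all
  then have \<mu>: "sol_prob \<mu>" using sol_prob_distr[OF M] by blast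
  show ?thesis
    unfolding forms_identically_distributed_iff[OF M \<xi>_meas \<xi>_indep \<xi>_distr \<alpha>_meas \<alpha>_bern \<alpha>_indep]
    using decomposition_of_functional_equation[OF no_order2 \<mu> \<mu>_sym] functional_equation_of_decomposition
    by blast
qed

end
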